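(* Consider the constrained Markov decision model, notation and definitions given in the context. Suppose that for every $x\in\mathbf{X}$: $\mathbf{A}(x)$ is compact; $Q(\Lambda|x,\cdot)$ is continuous on $\mathbf{A}(x)$ for every Borel $\Lambda\subseteq\mathbf{X}$; and $r(x,\cdot)$ and $c_i(x,\cdot)$, $i\in\{1,\dots,q\}$, are upper-semicontinuous on $\mathbf{A}(x)$. Let $\{\xi_k\}_{k\ge1}$ be a sequence of measurable selectors of the multifunction $x\mapsto\mathbf{A}(x)$ (measurable maps $\xi_k:\mathbf{X}\to\mathbf{A}$ with $\xi_k(x)\in\mathbf{A}(x)$) such that $\mathbf{A}(x)=\overline{\{\xi_k(x):k\ge1\}}$ for every $x\in\mathbf{X}$, let $$P(dy|x)=\sum_{k\ge1}2^{-k}Q(dy|x,\xi_k(x)),\qquad p(dx)=\sum_{k\in\mathbb{N}}2^{-(k+1)}\,\nu P^k(dx),$$ and let $\mathcal{K}_p$ be the associated set of feasible variables. Suppose further that: (1) $\sup\{\eta^{\Phi}(r^{+}):\Phi\in\mathcal{K}_p\}<+\infty$ and $\sup\{\eta^{\Phi}(c_i^{+}):\Phi\in\mathcal{K}_p\}<+\infty$ for every $i\in\{1,\dots,q\}$; (2) $\mu(r^{-})<+\infty$ and $\mu(c_i^{-})<+\infty$ for every $\mu\in\mathcal{O}$ and $i\in\{1,\dots,q\}$; (3) there exists $\mu^{*}\in\mathcal{O}$ with $\theta^{*}_i<\mu^{*}(c_i)$ for every $i\in\{1,\dots,q\}$. Then $$\sup\{\mathcal{J}_\nu(r,\pi):\pi\in\Pi_{\theta^*}\}=\sup\{\eta^{\Phi}(r):\Phi\in\mathcal{K}_p\text{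 and }\eta^{\Phi}(c_i)\ge\theta^*_i\text{ for } i\in\{1,\dots,q\}\}.$$ Moreover, if $\hat\Phi\in\mathcal{K}_p$ is an optimal solution of the convex program, i.e. $\eta^{\hat\Phi}(c_i)\ge\theta_i^*$ for all $i\in\{1,\dots,q\}$ and $\eta^{\hat\Phi}(r)$ equals the right-hand side above, then the stationary randomized policy $\varphi_{\hat\Phi}$ induced by $\hat\Phi$ is optimal for the constrained control problem, that is, $\varphi_{\hat\Phi}\in\Pi_{\theta^*}$ and $\mathcal{J}_\nu(r,\varphi_{\hat\Phi})=\sup\{\mathcal{J}_\nu(r,\pi):\pi\in\Pi_{\theta^*}\}$.
   Context: Model. $\mathbf{X}$ (states) and $\mathbf{A}$ (actions) are Borel spaces (Borel subsets of complete separable metric spaces). For each $x\in\mathbf{X}$, $\mathbf{A}(x)\subseteq\mathbf{A}$ is a non-empty measurable set; $\mathbf{K}=\{(x,a)\in\mathbf{X}\times\mathbf{A}:a\in\mathbf{A}(x)\}$ is a measurable subset of $\mathbf{X}\times\mathbf{A}$, and there is a measurable map $\vartheta:\mathbf{X}\to\mathbf{A}$ with $\vartheta(x)\in\mathbf{A}(x)$ for all $x$. $Q$ is a stochastic kernel on $\mathbf{X}$ given $\mathbf{K}$ (transition kernel), $r:\mathbf{K}\to\mathbb{R}$ (reward) and $c_i:\mathbf{K}\to\mathbb{R}$, $i\in\{1,\dots,q\}$ (constraint functions) are measurable, $\theta^*=(\theta_i^* )_{1\le i\le q}$ are real numbers and $\nu$ is a probability measure on $\mathbf{X}$ (initial distribution).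 Policies. Let $\mathbf{H}_1=\mathbf{X}$ and $\mathbf{H}_t=\mathbf{K}^{t-1}\times\mathbf{X}$ for $t\ge2$. A policy is a sequence $\pi=\{\pi_t\}_{t\ge1}$ of stochastic kernels $\pi_t$ on $\mathbf{A}$ given $\mathbf{H}_t$ with $\pi_t(\mathbf{A}(x_t)|h_t)=1$ for all $h_t=(x_1,a_1,\dots,x_t)\in\mathbf{H}_t$; $\Pi$ is the set of policies. A policy is stationary randomized if $\pi_t(\cdot|h_t)=\varphi(\cdot|x_t)$ for all $t,h_t$, for some stochastic kernel $\varphi$ on $\mathbf{A}$ given $\mathbf{X}$ with $\varphi(\mathbf{A}(x)|x)=1$ for all $x$; it is then identified with $\varphi$. $\Pi_s$ is the set of stationary randomized policies. $\mathbb{P}^\pi_\nu$ is the canonical (Ionescu-Tulcea) probability on $(\mathbf{X}\times\mathbf{A})^\infty$ with coordinate processes $(X_t,A_t)_{t\ge1}$ for which $X_1\sim\nu$, $A_t$ has conditional law $\pi_t$ given the history $(X_1,A_1,\dots,X_t)$, and $X_{t+1}$ has conditional law $Q(\cdot|X_t,A_t)$ given $(X_1,\dots,X_t,A_t)$. Occupation measures and criteria. Measures may take the value $+\infty$. $\mu^\pi(\Gamma)=\sum_{t\ge1}\mathbb{P}^\pi_\nu((X_t,A_t)\in\Gamma)$ for Borel $\Gamma\subseteq\mathbf{X}\times\mathbf{A}$; $\mathcal{O}=\{\mu^\pi:\pi\in\Pi\}$. For a measure $\mu$ on $\mathbf{X}\times\mathbf{A}$ concentrated on $\mathbf{K}$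 and a measurable $h:\mathbf{K}\to\mathbb{R}$, $\mu(h)=\int h^+d\mu-\int h^-d\mu$ with the convention $(+\infty)-(+\infty)=-\infty$, where $h^\pm$ are the positive and negative parts. $\mathcal{J}_\nu(h,\pi)=\mu^\pi(h)$. $\Pi_{\theta^*}=\{\pi\in\Pi:\mathcal{J}_\nu(c_i,\pi)\ge\theta_i^*\ \forall i\in\{1,\dots,q\}\}$. The constrained control problem is to maximize $\mathcal{J}_\nu(r,\pi)$ over $\pi\in\Pi_{\theta^*}$. Feasible variables. Let $\mathcal{K}(\mathbf{A}|\mathbf{X})$ be the set of finite kernels on $\mathbf{A}$ given $\mathbf{X}$ (i.e. $K(\cdot|x)$ is a measure with $K(\mathbf{A}|x)<\infty$ for each $x$, and $K(\Lambda|\cdot)$ is measurable for each Borel $\Lambda$). For $\Phi=(\varphi^\infty,\varphi^* )\in\mathcal{K}(\mathbf{A}|\mathbf{X})^2$, $\eta^\Phi$ is the measure on $\mathbf{X}\times\mathbf{A}$ given by $\eta^\Phi(dx,da)=\mathcal{I}_\infty(x)\varphi^\infty(da|x)p(dx)+\varphi^*(da|x)p(dx)$, where $\mathcal{I}_\infty\equiv+\infty$ and $0\times\infty=0$. $\mathcal{K}_p$ is the set of $\Phi=(\varphi^\infty,\varphi^* )\in\mathcal{K}(\mathbf{A}|\mathbf{X})^2$ such that, for all $x\in\mathbf{X}$, $\varphi^\infty(\mathbf{A}|x)+\varphi^*(\mathbf{A}|x)>0$ and $\varphi^\infty(\mathbf{A}(x)^c|x)+\varphi^*(\mathbf{A}(x)^c|x)=0$,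 and such that $\eta^\Phi_{\mathbf{X}}=\nu+\eta^\Phi Q$, where $\eta^\Phi_{\mathbf{X}}$ is the marginal of $\eta^\Phi$ on $\mathbf{X}$ and $\eta^\Phi Q=\int Q(\cdot|x,a)\,\eta^\Phi(dx,da)$. Induced policy. For $\Phi\in\mathcal{K}_p$ let $\mathcal{E}_\Phi=\{x:\varphi^\infty(\mathbf{A}|x)=0\}$; the stationary randomized policy induced by $\Phi$ is $\varphi_\Phi(da|x)=\varphi^\infty(da|x)/\varphi^\infty(\mathbf{A}|x)$ if $x\notin\mathcal{E}_\Phi$ and $\varphi_\Phi(da|x)=\varphi^*(da|x)/\varphi^*(\mathbf{A}|x)$ if $x\in\mathcal{E}_\Phi$. *)

theory Defs
  imports "HOL-Probability.Probability"
begin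

text \<open>
  A constrained Markov decision model. The Borel spaces of states and actions are Borel subsets
  of Polish types. Functions and kernels given on the set of feasible state-action pairs are total
  functions on pairs whose values outside that set are never used. The constraints are indexed
  by \<open>{1..num_constraints M}\<close>.
\<close>

record ('x, 'a) cmdm =
  states :: "'x set"
  actions :: "'a set"
  admissible :: "'x \<Rightarrow> 'a set"
  transition :: "'x \<times> 'a \<Rightarrow> 'x measure"
  reward :: "'x \<times> 'a \<Rightarrow> real"
  num_constraints :: nat
  constraint :: "nat \<Rightarrow> 'x \<times> 'a \<Rightarrow> real"
  threshold :: "nat \<Rightarrow> real"
  initial :: "'x measure"

abbreviation state_space :: "('x::polish_space, 'a::polish_space, 'z) cmdm_scheme \<Rightarrow> 'x measure"
  where "state_space M \<equiv> restrict_space borel (states M)"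

abbreviation action_space :: "('x::polish_space, 'a::polish_space, 'z) cmdm_scheme \<Rightarrow> 'a measure"
  where "action_space M \<equiv> restrict_space borel (actions M)"

abbreviation pair_space ::
    "('x::polish_space, 'a::polish_space, 'z) cmdm_scheme \<Rightarrow> ('x \<times> 'a) measure"
  where "pair_space M \<equiv> state_space M \<Otimes>\<^sub>M action_space M"

definition feasible_pairs :: "('x, 'a, 'z) cmdm_scheme \<Rightarrow> ('x \<times> 'a) set" where
  "feasible_pairs M = {(x, a). x \<in> states M \<and> a \<in> admissible M x}"

abbreviation feasible_space ::
    "('x::polish_space, 'a::polish_space, 'z) cmdm_scheme \<Rightarrow> ('x \<times> 'a) measure"
  where "feasible_space M \<equiv> restrict_space (pair_space M) (feasible_pairs M)"

definition measurable_selector ::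
    "('x::polish_space, 'a::polish_space, 'z) cmdm_scheme \<Rightarrow> ('x \<Rightarrow> 'a) \<Rightarrow> bool" where
  "measurable_selector M \<xi> \<longleftrightarrow>
     \<xi> \<in> state_space M \<rightarrow>\<^sub>M action_space M \<and> (\<forall>x\<in>states M. \<xi> x \<in> admissible M x)"

definition control_model :: "('x::polish_space, 'a::polish_space, 'z) cmdm_scheme \<Rightarrow> bool" where
  "control_model M \<longleftrightarrow>
     states M \<in> sets borel \<and>
     actions M \<in> sets borel \<and>
     (\<forall>x\<in>states M. admissible M x \<noteq> {} \<and> admissible M x \<in> sets (action_space M)) \<and>
     feasible_pairs M \<in> sets (pair_space M) \<and>
     (\<exists>f. measurable_selector M f) \<and>
     transition M \<in> feasible_space M \<rightarrow>\<^sub>M prob_algebra (state_space M) \<and>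
     reward M \<in> borel_measurable (feasible_space M) \<and>
     (\<forall>i\<in>{1..num_constraints M}. constraint M i \<in> borel_measurable (feasible_space M)) \<and>
     initial M \<in> space (prob_algebra (state_space M))"

definition usc_on :: "'a::topological_space set \<Rightarrow> ('a \<Rightarrow> real) \<Rightarrow> bool" where
  "usc_on S f \<longleftrightarrow> (\<forall>a\<in>S. \<forall>y. f a < y \<longrightarrow> (\<forall>\<^sub>F b in at a within S. f b < y))"


section \<open>Policies and the canonical process\<close>

text \<open>
  Time is counted from \<open>0\<close>: the decision at stage \<open>t\<close> is based on the pair \<open>(h, x)\<close> of the
  \<open>t\<close> feasible state-action pairs \<open>h 0, \<dots>, h (t - 1)\<close> observed earlier and the current state \<open>x\<close>.
\<close>

type_synonym ('x, 'a) policy = "nat \<Rightarrow> (nat \<Rightarrow> 'x \<times> 'a) \<times> 'x \<Rightarrow> 'a measure"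

abbreviation history_space ::
    "('x::polish_space, 'a::polish_space, 'z) cmdm_scheme \<Rightarrow> nat \<Rightarrow> ((nat \<Rightarrow> 'x \<times> 'a) \<times> 'x) measure"
  where "history_space M t \<equiv> (\<Pi>\<^sub>M i\<in>{0..<t}. feasible_space M) \<Otimes>\<^sub>M state_space M"

definition policies :: "('x::polish_space, 'a::polish_space, 'z) cmdm_scheme \<Rightarrow> ('x, 'a) policy set"
  where "policies M = {\<pi>. \<forall>t.
     \<pi> t \<in> history_space M t \<rightarrow>\<^sub>M prob_algebra (action_space M) \<and>
     (\<forall>(h, x)\<in>space (history_space M t). emeasure (\<pi> t (h, x)) (admissible M x) = 1)}"

definition stationary_policy :: "('x \<Rightarrow> 'a measure) \<Rightarrow> ('x, 'a) policy" where
  "stationary_policy \<phi> = (\<lambda>t (h, x). \<phi> x)"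

text \<open>
  Conditional law of the state-action pair at stage \<open>t\<close> given the earlier pairs. Histories with
  an infeasible pair form a null set; there, an arbitrary fixed law is used, so as to obtain
  a stochastic kernel on the whole product space.
\<close>

definition step_kernel ::
    "('x::polish_space, 'a::polish_space, 'z) cmdm_scheme \<Rightarrow> ('x, 'a) policy \<Rightarrow>
      nat \<Rightarrow> (nat \<Rightarrow> 'x \<times> 'a) \<Rightarrow> ('x \<times> 'a) measure" where
  "step_kernel M \<pi> t h =
     (if \<forall>i<t. h i \<in> feasible_pairs M
      then do {
        x \<leftarrow> (if t = 0 then initial M else transition M (h (t - 1)));
        a \<leftarrow> \<pi> t (h, x);
        return (pair_space M) (x, a)
      }
      else return (pair_space M) (SOME z. z \<in> feasible_pairs M))"

definition policy_measure ::
    "('x::polish_space, 'a::polish_space, 'z) cmdm_scheme \<Rightarrow> ('x, 'a) policy \<Rightarrow>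
      (nat \<Rightarrow> 'x \<times> 'a) measure" where
  "policy_measure M \<pi> =
     projective_family.lim UNIV
       (Ionescu_Tulcea.CI (step_kernel M \<pi>) (\<lambda>_. pair_space M)) (\<lambda>_. pair_space M)"


section \<open>Occupation measures and criteria\<close>

definition occupation_measure ::
    "('x::polish_space, 'a::polish_space, 'z) cmdm_scheme \<Rightarrow> ('x, 'a) policy \<Rightarrow> ('x \<times> 'a) measure"
  where "occupation_measure M \<pi> =
     measure_of (space (pair_space M)) (sets (pair_space M))
       (\<lambda>\<Gamma>. \<Sum>t. emeasure (policy_measure M \<pi>) {\<omega> \<in> space (policy_measure M \<pi>). \<omega> t \<in> \<Gamma>})"

definition occupation_measures ::
    "('x::polish_space, 'a::polish_space, 'z) cmdm_scheme \<Rightarrow> ('x \<times> 'a) measure set"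
  where "occupation_measures M = occupation_measure M ` policies M"

text \<open>
  The case distinction implements \<open>(+\<infinity>) - (+\<infinity>) = -\<infinity>\<close>; subtraction on \<^typ>\<open>ereal\<close> gives \<open>\<infinity>\<close>.
\<close>

definition ext_integral ::
    "('x, 'a, 'z) cmdm_scheme \<Rightarrow> ('x \<times> 'a) measure \<Rightarrow> ('x \<times> 'a \<Rightarrow> real) \<Rightarrow> ereal" where
  "ext_integral M \<mu> h =
     (let p = (\<integral>\<^sup>+z\<in>feasible_pairs M. ennreal (max 0 (h z)) \<partial>\<mu>);
          n = (\<integral>\<^sup>+z\<in>feasible_pairs M. ennreal (max 0 (- h z)) \<partial>\<mu>)
      in if p = \<infinity> \<and> n = \<infinity> then - \<infinity> else enn2ereal p - enn2ereal n)"

definition criterion ::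
    "('x::polish_space, 'a::polish_space, 'z) cmdm_scheme \<Rightarrow> ('x \<times> 'a \<Rightarrow> real) \<Rightarrow>
      ('x, 'a) policy \<Rightarrow> ereal" where
  "criterion M h \<pi> = ext_integral M (occupation_measure M \<pi>) h"

definition constrained_policies ::
    "('x::polish_space, 'a::polish_space, 'z) cmdm_scheme \<Rightarrow> ('x, 'a) policy set" where
  "constrained_policies M =
     {\<pi> \<in> policies M. \<forall>i\<in>{1..num_constraints M}. criterion M (constraint M i) \<pi> \<ge> threshold M i}"


section \<open>The reference measure\<close>

text \<open>The mixture of the measures \<open>N k\<close> on \<open>S\<close> with weights \<open>2 ^ -(k + 1)\<close>, \<open>k \<ge> 0\<close>.\<close>

definition geometric_mixture :: "'b measure \<Rightarrow> (nat \<Rightarrow> 'b measure) \<Rightarrow> 'b measure" where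
  "geometric_mixture S N =
     measure_of (space S) (sets S) (\<lambda>\<Lambda>. \<Sum>k. ennreal ((1 / 2) ^ Suc k) * emeasure (N k) \<Lambda>)"

definition mixed_kernel ::
    "('x::polish_space, 'a::polish_space, 'z) cmdm_scheme \<Rightarrow> (nat \<Rightarrow> 'x \<Rightarrow> 'a) \<Rightarrow> 'x \<Rightarrow> 'x measure"
  where "mixed_kernel M \<xi> x =
     geometric_mixture (state_space M) (\<lambda>k. transition M (x, \<xi> (Suc k) x))"

definition reference_measure ::
    "('x::polish_space, 'a::polish_space, 'z) cmdm_scheme \<Rightarrow> (nat \<Rightarrow> 'x \<Rightarrow> 'a) \<Rightarrow> 'x measure"
  where "reference_measure M \<xi> =
     geometric_mixture (state_space M) (\<lambda>k. ((\<lambda>\<mu>. \<mu> \<bind> mixed_kernel M \<xi>) ^^ k) (initial M))"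


section \<open>Feasible variables and induced policies\<close>

definition finite_kernel :: "'b measure \<Rightarrow> 'c measure \<Rightarrow> ('b \<Rightarrow> 'c measure) \<Rightarrow> bool" where
  "finite_kernel S T \<kappa> \<longleftrightarrow>
     (\<forall>x\<in>space S. sets (\<kappa> x) = sets T \<and> finite_measure (\<kappa> x)) \<and>
     (\<forall>\<Lambda>\<in>sets T. (\<lambda>x. emeasure (\<kappa> x) \<Lambda>) \<in> borel_measurable S)"

type_synonym ('x, 'a) kernel_pair = "('x \<Rightarrow> 'a measure) \<times> ('x \<Rightarrow> 'a measure)"

text \<open>
  A pair \<open>(\<kappa>, \<phi>)\<close> stands for the measure \<open>\<infinity> \<cdot> \<kappa>(da|x) p(dx) + \<phi>(da|x) p(dx)\<close>, where \<open>0 \<cdot> \<infinity> = 0\<close>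
  as always in \<^typ>\<open>ennreal\<close>.
\<close>

definition kernel_pair_measure ::
    "('x::polish_space, 'a::polish_space, 'z) cmdm_scheme \<Rightarrow> 'x measure \<Rightarrow> ('x, 'a) kernel_pair \<Rightarrow>
      ('x \<times> 'a) measure" where
  "kernel_pair_measure M p = (\<lambda>(\<kappa>, \<phi>).
     measure_of (space (pair_space M)) (sets (pair_space M))
       (\<lambda>\<Gamma>. (\<integral>\<^sup>+x. \<infinity> * emeasure (\<kappa> x) (Pair x -` \<Gamma>) \<partial>p) +
            (\<integral>\<^sup>+x. emeasure (\<phi> x) (Pair x -` \<Gamma>) \<partial>p)))"

definition feasible_variables ::
    "('x::polish_space, 'a::polish_space, 'z) cmdm_scheme \<Rightarrow> 'x measure \<Rightarrow> ('x, 'a) kernel_pair set"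
  where "feasible_variables M p = {(\<kappa>, \<phi>).
     finite_kernel (state_space M) (action_space M) \<kappa> \<and>
     finite_kernel (state_space M) (action_space M) \<phi> \<and>
     (\<forall>x\<in>states M.
        emeasure (\<kappa> x) (actions M) + emeasure (\<phi> x) (actions M) > 0 \<and>
        emeasure (\<kappa> x) (actions M - admissible M x) +
          emeasure (\<phi> x) (actions M - admissible M x) = 0) \<and>
     (\<forall>\<Lambda>\<in>sets (state_space M).
        emeasure (distr (kernel_pair_measure M p (\<kappa>, \<phi>)) (state_space M) fst) \<Lambda> =
        emeasure (initial M) \<Lambda> +
          (\<integral>\<^sup>+z\<in>feasible_pairs M. emeasure (transition M z) \<Lambda>
             \<partial>kernel_pair_measure M p (\<kappa>, \<phi>)))}"

definition normalized :: "'b measure \<Rightarrow> 'b measure" where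
  "normalized \<mu> = scale_measure (inverse (emeasure \<mu> (space \<mu>))) \<mu>"

definition induced_policy :: "('x, 'a) kernel_pair \<Rightarrow> ('x, 'a) policy" where
  "induced_policy = (\<lambda>(\<kappa>, \<phi>). stationary_policy (\<lambda>x.
     if emeasure (\<kappa> x) (space (\<kappa> x)) \<noteq> 0 then normalized (\<kappa> x) else normalized (\<phi> x)))"

end

theory Submission
  imports Defs
begin

text \<open>
  A feasible variable splits into the occupation measure of its induced stationary policy and
  a surplus. Adding multiples of the surplus keeps it feasible, so by the finite suprema the
  surplus carries no positive part of the reward or of a constraint: the induced policy does at
  least as well as the variable.

  Conversely, disintegration replaces a policy by a Markov policy with the same occupation measure.
  On the set of states of infinite expected occupation time, a compactness argument yields
  a measurable selector all of whose rewards and constraints are nonnegative and which never leaves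
  the set. Following the Markov policy but using the selector in that set from stage \<open>T\<close> on, one gets
  an occupation measure of the required form whose criteria are asymptotically at least as large.
  Mixing with the Slater policy and with the measure of the policy that generates \<open>p\<close> restores
  the constraints and the positivity condition.
\<close>

section \<open>Mixtures of measures\<close>

text \<open>The obstacle is infinite mass. At a state of infinite occupation a Markov policy may use
  different actions at different stages, each with finite density; its action measure is then
  infinite without being of the form \<open>\<infinity> * \<kappa> + \<phi>\<close> with finite
  \<open>\<kappa>\<close> and \<open>\<phi>\<close>. So a policy is only approximated, by freezing
  the action from stage \<open>T\<close> on at such states. A nonnegative lower semicontinuous
  function with finite integral must vanish there. This applies to the negative part of an upper
  semicontinuous criterion and to the probability, continuous in the action, of jumping into a set
  of finite occupation. Hence nothing negative is earned and no jump leads back to states of finite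
  density. That one measure \<open>p\<close> serves all policies is due to continuity as well: a
  null transition probability passes from the dense selectors to every admissible action.\<close>

lemma emeasure_mixture:
  assumes sets_k: "\<And>y. y \<in> space R \<Longrightarrow> sets (k y) = sets S"
    and meas: "\<And>A. A \<in> sets S \<Longrightarrow> (\<lambda>y. emeasure (k y) A) \<in> borel_measurable R"
    and A: "A \<in> sets S"
  shows "emeasure (measure_of (space S) (sets S) (\<lambda>A. \<integral>\<^sup>+y. emeasure (k y) A \<partial>R)) A =
    (\<integral>\<^sup>+y. emeasure (k y) A \<partial>R)"
proof (rule emeasure_measure_of)
  show "countably_additive (sets (measure_of (space S) (sets S) (\<lambda>A. \<integral>\<^sup>+y. emeasure (k y) A \<partial>R)))
      (\<lambda>A. \<integral>\<^sup>+y. emeasure (k y) A \<partial>R)"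
  proof (rule countably_additiveI)
    fix B :: "nat \<Rightarrow> _"
    assume "range B \<subseteq> sets (measure_of (space S) (sets S) (\<lambda>A. \<integral>\<^sup>+y. emeasure (k y) A \<partial>R))"
      and d: "disjoint_family B"
    then have B: "range B \<subseteq> sets S" by (simp add: sets.sets_measure_of_eq)
    have "(\<Sum>i. \<integral>\<^sup>+y. emeasure (k y) (B i) \<partial>R) = (\<integral>\<^sup>+y. (\<Sum>i. emeasure (k y) (B i)) \<partial>R)"
      using B by (intro nn_integral_suminf[symmetric] meas) auto
    also have "\<dots> = (\<integral>\<^sup>+y. emeasure (k y) (\<Union>i. B i) \<partial>R)"
      using B d by (intro nn_integral_cong suminf_emeasure) (auto simp: sets_k)
    finally show "(\<Sum>i. \<integral>\<^sup>+y. emeasure (k y) (B i) \<partial>R) = (\<integral>\<^sup>+y. emeasure (k y) (\<Union>i. B i) \<partial>R)" .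
  qed
qed (use A in \<open>auto simp: positive_def sets.sets_measure_of_eq dest: sets.sets_into_space\<close>)

text \<open>Infinite masses are covered: a counting measure \<open>R\<close> gives sums of measures,
  a factor \<infinity> in \<open>k\<close> the measures of kernel pairs. Both claims go through one
  induction over \<open>f\<close> because the sum and limit cases of the formula use measurability
  of the inner integral.\<close>

lemma nn_integral_mixture:
  assumes sets_k: "\<And>y. y \<in> space R \<Longrightarrow> sets (k y) = sets S"
    and meas: "\<And>A. A \<in> sets S \<Longrightarrow> (\<lambda>y. emeasure (k y) A) \<in> borel_measurable R"
    and sets_N: "sets N = sets S"
    and N: "\<And>A. A \<in> sets S \<Longrightarrow> emeasure N A = (\<integral>\<^sup>+y. emeasure (k y) A \<partial>R)"
    and f: "f \<in> borel_measurable S"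
  shows "(\<lambda>y. \<integral>\<^sup>+a. f a \<partial>k y) \<in> borel_measurable R \<and>
    (\<integral>\<^sup>+a. f a \<partial>N) = (\<integral>\<^sup>+y. \<integral>\<^sup>+a. f a \<partial>k y \<partial>R)"
proof -
  have spN: "space N = space S" using sets_N by (rule sets_eq_imp_space_eq)
  have spk: "space (k y) = space S" if "y \<in> space R" for y
    using sets_k[OF that] by (rule sets_eq_imp_space_eq)
  have mN[measurable_cong]: "sets N = sets S" by (fact sets_N)
  show ?thesis
    using f
  proof (induction rule: borel_measurable_induct)
    case (cong f g)
    have "(\<integral>\<^sup>+a. f a \<partial>N) = (\<integral>\<^sup>+a. g a \<partial>N)"
      using cong(3) by (intro nn_integral_cong) (simp add: spN)
    moreover have e: "(\<integral>\<^sup>+a. f a \<partial>k y) = (\<integral>\<^sup>+a. g a \<partial>k y)" if "y \<in> space R" for y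
      using cong(3) that by (intro nn_integral_cong) (simp add: spk)
    ultimately show ?case
      using cong(4) by (auto cong: measurable_cong nn_integral_cong)
  next
    case (set A)
    have "(\<integral>\<^sup>+a. indicator A a \<partial>k y) = emeasure (k y) A" if "y \<in> space R" for y
      using set that by (simp add: sets_k)
    then show ?case
      using set meas[OF set] N[OF set] by (simp add: sets_N cong: measurable_cong nn_integral_cong)
  next
    case (mult u c)
    have "(\<integral>\<^sup>+a. c * u a \<partial>k y) = c * (\<integral>\<^sup>+a. u a \<partial>k y)" if "y \<in> space R" for y
      using mult that by (intro nn_integral_cmult) (simp add: measurable_cong_sets[OF sets_k[OF that] refl])
    then show ?case
      using mult borel_measurable_times_ennreal[OF borel_measurable_const, of "\<lambda>y. integral\<^sup>N (k y) u" R c]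
      by (simp add: nn_integral_cmult cong: measurable_cong nn_integral_cong)
  next
    case (add u v)
    have "(\<integral>\<^sup>+a. v a + u a \<partial>k y) = (\<integral>\<^sup>+a. v a \<partial>k y) + (\<integral>\<^sup>+a. u a \<partial>k y)" if "y \<in> space R" for y
      using add that by (intro nn_integral_add) (simp_all add: measurable_cong_sets[OF sets_k[OF that] refl])
    then show ?case
      using add borel_measurable_add[of "\<lambda>y. integral\<^sup>N (k y) v" R "\<lambda>y. integral\<^sup>N (k y) u"]
      by (simp add: nn_integral_add cong: measurable_cong nn_integral_cong)
  next
    case (seq U)
    have e1: "(SUP i. U i) = (\<lambda>x. SUP i. U i x)" by (auto simp: fun_eq_iff image_comp)
    have e: "(\<integral>\<^sup>+a. (SUP i. U i a) \<partial>k y) = (SUP i. \<integral>\<^sup>+a. U i a \<partial>k y)" if "y \<in> space R" for y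
      using seq that by (intro nn_integral_monotone_convergence_SUP)
        (simp_all add: measurable_cong_sets[OF sets_k[OF that] refl])
    have inc: "incseq (\<lambda>i y. \<integral>\<^sup>+a. U i a \<partial>k y)"
      using seq(3) by (auto simp: incseq_def le_fun_def intro!: nn_integral_mono)
    have "(\<integral>\<^sup>+a. (SUP i. U i a) \<partial>N) = (SUP i. \<integral>\<^sup>+a. U i a \<partial>N)"
      using seq by (intro nn_integral_monotone_convergence_SUP) auto
    also have "\<dots> = (SUP i. \<integral>\<^sup>+y. \<integral>\<^sup>+a. U i a \<partial>k y \<partial>R)"
      using seq by simp
    also have "\<dots> = (\<integral>\<^sup>+y. (SUP i. \<integral>\<^sup>+a. U i a \<partial>k y) \<partial>R)"
      using seq inc by (intro nn_integral_monotone_convergence_SUP[symmetric]) auto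
    finally have 2: "(\<integral>\<^sup>+a. (SUP i. U i a) \<partial>N) = (\<integral>\<^sup>+y. (SUP i. \<integral>\<^sup>+a. U i a \<partial>k y) \<partial>R)" .
    have 1: "(\<lambda>y. SUP i. \<integral>\<^sup>+a. U i a \<partial>k y) \<in> borel_measurable R"
      using seq by (intro borel_measurable_SUP) auto
    show ?case unfolding e1
      using 1 2 e by (simp cong: measurable_cong nn_integral_cong)
  qed
qed

section \<open>Countable sums and geometric mixtures of measures\<close>

definition sum_measure :: "'b measure \<Rightarrow> (nat \<Rightarrow> 'b measure) \<Rightarrow> 'b measure" where
  "sum_measure S k = measure_of (space S) (sets S) (\<lambda>A. \<Sum>t. emeasure (k t) A)"

lemma sets_sum_measure[simp, measurable_cong]: "sets (sum_measure S k) = sets S"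
  by (simp add: sum_measure_def sets.sets_measure_of_eq)

lemma space_sum_measure[simp]: "space (sum_measure S k) = space S"
  by (rule sets_eq_imp_space_eq) simp

lemma emeasure_sum_measure:
  assumes "\<And>t. sets (k t) = sets S" "A \<in> sets S"
  shows "emeasure (sum_measure S k) A = (\<Sum>t. emeasure (k t) A)"
  using emeasure_mixture[of "count_space UNIV" k S A] assms
  by (simp add: sum_measure_def nn_integral_count_space_nat)

lemma nn_integral_sum_measure:
  assumes "\<And>t. sets (k t) = sets S" "f \<in> borel_measurable S"
  shows "(\<integral>\<^sup>+a. f a \<partial>sum_measure S k) = (\<Sum>t. \<integral>\<^sup>+a. f a \<partial>k t)"
  using nn_integral_mixture[of "count_space UNIV" k S "sum_measure S k" f] assms
  by (simp add: emeasure_sum_measure nn_integral_count_space_nat)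

lemma geometric_mixture_eq_sum_measure:
  "geometric_mixture S N = sum_measure S (\<lambda>k. scale_measure (ennreal ((1 / 2) ^ Suc k)) (N k))"
  unfolding geometric_mixture_def sum_measure_def by simp

lemma half_suminf: "(\<Sum>k. ennreal ((1 / 2) ^ Suc k)) = 1"
  using power_half_series by (simp add: suminf_ennreal2 sums_iff)

lemma prob_space_geometric_mixture:
  assumes "\<And>k. N k \<in> space (prob_algebra S)"
  shows "geometric_mixture S N \<in> space (prob_algebra S)"
proof -
  have s: "sets (N k) = sets S" and p: "emeasure (N k) (space S) = 1" for k
    using assms[of k] prob_space.emeasure_space_1[of "N k"] sets_eq_imp_space_eq[of "N k" S]
    by (auto simp: space_prob_algebra)
  have "emeasure (geometric_mixture S N) (space S) = 1"
    unfolding geometric_mixture_eq_sum_measure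
    by (subst emeasure_sum_measure) (simp_all add: s p half_suminf del: power_Suc)
  then show ?thesis
    by (auto simp: space_prob_algebra geometric_mixture_eq_sum_measure intro!: prob_spaceI)
qed

lemma emeasure_geometric_mixture:
  assumes "\<And>k. sets (N k) = sets S" "A \<in> sets S"
  shows "emeasure (geometric_mixture S N) A = (\<Sum>k. ennreal ((1 / 2) ^ Suc k) * emeasure (N k) A)"
  unfolding geometric_mixture_eq_sum_measure using assms
  by (subst emeasure_sum_measure) simp_all

lemma ennreal_half_pos: "ennreal ((1 / 2) ^ n) \<noteq> 0"
  by (simp add: ennreal_eq_0_iff not_le)

text \<open>All weights are positive, so a set is null for the mixture exactly if it is null for
  every summand; domination by \<open>p\<close> rests on this.\<close>

lemma null_geometric_mixture:
  assumes "\<And>k. sets (N k) = sets S" "A \<in> sets S"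
  shows "emeasure (geometric_mixture S N) A = 0 \<longleftrightarrow> (\<forall>k. emeasure (N k) A = 0)"
  by (subst emeasure_geometric_mixture[OF assms])
    (auto simp: suminf_eq_zero_iff ennreal_half_pos simp del: power_Suc)

section \<open>Finite kernels\<close>

lemma finite_kernel_sets: "finite_kernel S T \<phi> \<Longrightarrow> x \<in> space S \<Longrightarrow> sets (\<phi> x) = sets T"
  by (auto simp: finite_kernel_def)

lemma finite_kernel_space: "finite_kernel S T \<phi> \<Longrightarrow> x \<in> space S \<Longrightarrow> space (\<phi> x) = space T"
  by (rule sets_eq_imp_space_eq) (rule finite_kernel_sets)

lemma finite_kernel_finite: "finite_kernel S T \<phi> \<Longrightarrow> x \<in> space S \<Longrightarrow> emeasure (\<phi> x) A < \<infinity>"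
  unfolding finite_kernel_def using finite_measure.emeasure_finite[of "\<phi> x"] by (auto simp: less_top)

lemma finite_kernel_measurable:
  "finite_kernel S T \<phi> \<Longrightarrow> A \<in> sets T \<Longrightarrow> (\<lambda>x. emeasure (\<phi> x) A) \<in> borel_measurable S"
  by (auto simp: finite_kernel_def)

text \<open>Dynkin argument from rectangles. Finiteness of the kernel enters with complements, whose
  mass is a difference.\<close>

lemma finite_kernel_section:
  assumes \<phi>: "finite_kernel S T \<phi>" and G: "G \<in> sets (S \<Otimes>\<^sub>M T)"
  shows "(\<lambda>x. emeasure (\<phi> x) (Pair x -` G)) \<in> borel_measurable S"
proof -
  note sets_\<phi> = finite_kernel_sets[OF \<phi>] and fin = finite_kernel_finite[OF \<phi>]
  have sec: "Pair x -` B \<in> sets (\<phi> x)" if "x \<in> space S" "B \<in> sets (S \<Otimes>\<^sub>M T)" for x B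
    using sets_Pair1[OF that(2)] sets_\<phi>[OF that(1)] by auto
  have "G \<in> sigma_sets (space S \<times> space T) {a \<times> b |a b. a \<in> sets S \<and> b \<in> sets T}"
    using G by (simp add: sets_pair_measure)
  then show ?thesis
  proof (induction rule: sigma_sets_induct_disjoint[OF Int_stable_pair_measure_generator pair_measure_closed,
        consumes 1, case_names basic empty compl union])
    case (basic B)
    then obtain a b where B: "B = a \<times> b" "a \<in> sets S" "b \<in> sets T" by auto
    have "emeasure (\<phi> x) (Pair x -` B) = indicator a x * emeasure (\<phi> x) b" for x
      by (cases "x \<in> a") (auto simp: B(1))
    then show ?case
      using B finite_kernel_measurable[OF \<phi> B(3)] by simp
  next
    case empty then show ?case by simp
  next
    case (compl B)
    have B: "B \<in> sets (S \<Otimes>\<^sub>M T)" using compl(1) by (simp add: sets_pair_measure)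
    have "emeasure (\<phi> x) (Pair x -` (space S \<times> space T - B)) =
        emeasure (\<phi> x) (space T) - emeasure (\<phi> x) (Pair x -` B)" if x: "x \<in> space S" for x
    proof -
      have "Pair x -` (space S \<times> space T - B) = space (\<phi> x) - Pair x -` B"
        using x by (auto simp: finite_kernel_space[OF \<phi> x])
      then show ?thesis
        using emeasure_compl[OF sec[OF x B]] fin[OF x, of "Pair x -` B"]
        by (simp add: finite_kernel_space[OF \<phi> x] less_top)
    qed
    then show ?case
      using compl(2) finite_kernel_measurable[OF \<phi> sets.top]
      by (simp cong: measurable_cong)
  next
    case (union F)
    have F: "F i \<in> sets (S \<Otimes>\<^sub>M T)" for i using union(2) by (auto simp: sets_pair_measure)
    have "emeasure (\<phi> x) (Pair x -` (\<Union>i. F i)) = (\<Sum>i. emeasure (\<phi> x) (Pair x -` F i))"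
      if x: "x \<in> space S" for x
    proof -
      have "disjoint_family (\<lambda>i. Pair x -` F i)"
        using union(1) by (auto simp: disjoint_family_on_def)
      then show ?thesis
        using sec[OF x F] by (subst suminf_emeasure) (auto simp: vimage_UN)
    qed
    then show ?case
      using union(3) by (simp cong: measurable_cong)
  qed
qed

text \<open>The section integral is the integral of \<open>f\<close> against the image of
  \<open>\<phi> x\<close> under \<open>Pair x\<close>, and these images form a kernel into the
  product space.\<close>

lemma finite_kernel_nn_integral:
  assumes \<phi>: "finite_kernel S T \<phi>" and f: "f \<in> borel_measurable (S \<Otimes>\<^sub>M T)"
  shows "(\<lambda>x. \<integral>\<^sup>+a. f (x, a) \<partial>\<phi> x) \<in> borel_measurable S"
proof -
  \<comment> \<open>The mixture over \<open>S\<close> itself; what is taken from it is the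
    measurability of the inner integral.\<close>
  define N where "N = measure_of (space (S \<Otimes>\<^sub>M T)) (sets (S \<Otimes>\<^sub>M T))
    (\<lambda>G. \<integral>\<^sup>+x. emeasure (distr (\<phi> x) (S \<Otimes>\<^sub>M T) (Pair x)) G \<partial>S)"
  have Pm: "Pair x \<in> \<phi> x \<rightarrow>\<^sub>M S \<Otimes>\<^sub>M T" if "x \<in> space S" for x
    using that by (simp add: measurable_cong_sets[OF finite_kernel_sets[OF \<phi> that] refl])
  have e: "emeasure (distr (\<phi> x) (S \<Otimes>\<^sub>M T) (Pair x)) G = emeasure (\<phi> x) (Pair x -` G)"
    if "x \<in> space S" "G \<in> sets (S \<Otimes>\<^sub>M T)" for x G
  proof -
    have "Pair x -` G \<inter> space (\<phi> x) = Pair x -` G"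
      using sets.sets_into_space[OF that(2)] finite_kernel_space[OF \<phi> that(1)]
      by (auto simp: space_pair_measure)
    then show ?thesis using that by (simp add: emeasure_distr Pm)
  qed
  have m: "(\<lambda>x. emeasure (distr (\<phi> x) (S \<Otimes>\<^sub>M T) (Pair x)) G) \<in> borel_measurable S"
    if "G \<in> sets (S \<Otimes>\<^sub>M T)" for G
    using finite_kernel_section[OF \<phi> that] e that by (simp cong: measurable_cong)
  have "(\<lambda>x. \<integral>\<^sup>+z. f z \<partial>distr (\<phi> x) (S \<Otimes>\<^sub>M T) (Pair x)) \<in> borel_measurable S"
    using nn_integral_mixture[of S "\<lambda>x. distr (\<phi> x) (S \<Otimes>\<^sub>M T) (Pair x)" "S \<Otimes>\<^sub>M T" N f] m f
    by (auto simp: N_def emeasure_mixture sets.sets_measure_of_eq)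
  moreover have "(\<integral>\<^sup>+z. f z \<partial>distr (\<phi> x) (S \<Otimes>\<^sub>M T) (Pair x)) = (\<integral>\<^sup>+a. f (x, a) \<partial>\<phi> x)"
    if "x \<in> space S" for x
    using f by (simp add: nn_integral_distr Pm[OF that])
  ultimately show ?thesis by (simp cong: measurable_cong)
qed

lemma finite_kernel_prob:
  assumes "k \<in> S \<rightarrow>\<^sub>M prob_algebra T"
  shows "finite_kernel S T k"
  unfolding finite_kernel_def
proof (intro conjI ballI)
  fix x assume "x \<in> space S"
  from measurable_space[OF assms this] show "sets (k x) = sets T" "finite_measure (k x)"
    by (auto simp: space_prob_algebra intro: prob_space.finite_measure)
next
  fix A assume A: "A \<in> sets T"
  show "(\<lambda>x. emeasure (k x) A) \<in> borel_measurable S"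
    using measurable_prob_algebraD[OF assms] measurable_emeasure_subprob_algebra[OF A]
    by (rule measurable_compose)
qed

section \<open>Disintegration on Polish spaces\<close>

text \<open>By completeness the set of convergence is the Cauchy set, which is given by countably
  many conditions and is therefore measurable.\<close>

lemma measurable_lim_complete:
  fixes f :: "nat \<Rightarrow> 'a \<Rightarrow> 'b::polish_space"
  assumes f[measurable]: "\<And>i. f i \<in> borel_measurable M"
  shows "(\<lambda>x. if Cauchy (\<lambda>i. f i x) then lim (\<lambda>i. f i x) else c) \<in> borel_measurable M"
proof (rule borel_measurable_LIMSEQ_metric)
  show "(\<lambda>x. if Cauchy (\<lambda>i. f i x) then f n x else c) \<in> borel_measurable M" for n
    by measurable
  show "(\<lambda>i. if Cauchy (\<lambda>i. f i x) then f i x else c) \<longlonglongrightarrow>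
      (if Cauchy (\<lambda>i. f i x) then lim (\<lambda>i. f i x) else c)" for x
    by (auto simp: Cauchy_convergent_iff convergent_LIMSEQ_iff)
qed

text \<open>Bits serve as ternary digits 0 and 1. The tail behind any digit is at most half a unit
  of that digit, so the digits can be read off by \<open>floor\<close>; with binary digits, tails of
  ones would make this ambiguous.\<close>

definition ternary :: "(nat \<Rightarrow> bool) \<Rightarrow> real" where
  "ternary b = (\<Sum>k. of_bool (b k) * (1 / 3) ^ Suc k)"

lemma suminf_third: "(\<lambda>k. (1 / 3 :: real) ^ Suc k) sums (1 / 2)"
proof -
  have "(\<lambda>k. (1 / 3 :: real) * (1 / 3) ^ k) sums (1 / 3 * (1 / (1 - 1 / 3)))"
    by (intro sums_mult geometric_sums) simp
  then show ?thesis by simp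
qed

lemma ternary_summable: "summable (\<lambda>k. of_bool (b k) * (1 / 3 :: real) ^ Suc k)"
  by (rule summable_comparison_test'[OF sums_summable[OF suminf_third], of 0]) auto

lemma ternary_bounds: "0 \<le> ternary b" "ternary b \<le> 1 / 2"
proof -
  show "0 \<le> ternary b"
    unfolding ternary_def by (intro suminf_nonneg ternary_summable) auto
  have "ternary b \<le> (\<Sum>k. (1 / 3 :: real) ^ Suc k)"
    unfolding ternary_def by (intro suminf_le ternary_summable sums_summable[OF suminf_third]) auto
  then show "ternary b \<le> 1 / 2" using suminf_third by (simp add: sums_iff)
qed

text \<open>Multiplication by \<open>3 ^ Suc n\<close> moves the first \<open>n + 1\<close> digits
  into an integer whose last ternary digit is \<open>b n\<close>; what remains is again a
  \<open>ternary\<close> value, in [0, 1/2].\<close>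

lemma ternary_digit: "\<lfloor>3 ^ Suc n * ternary b\<rfloor> mod 3 = of_bool (b n)"
proof -
  define I :: int where "I = (\<Sum>k<Suc n. of_bool (b k) * 3 ^ (n - k))"
  have "ternary b = (\<Sum>k. of_bool (b (k + Suc n)) * (1 / 3) ^ Suc (k + Suc n)) +
      (\<Sum>k<Suc n. of_bool (b k) * (1 / 3) ^ Suc k)"
    unfolding ternary_def by (rule suminf_split_initial_segment[OF ternary_summable])
  also have "(\<Sum>k. of_bool (b (k + Suc n)) * (1 / 3 :: real) ^ Suc (k + Suc n)) =
      (\<Sum>k. (1 / 3) ^ Suc n * (of_bool (b (k + Suc n)) * (1 / 3) ^ Suc k))"
    by (intro suminf_cong) (simp add: power_add)
  also have "\<dots> = (1 / 3) ^ Suc n * ternary (\<lambda>k. b (k + Suc n))"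
    unfolding ternary_def by (intro suminf_mult ternary_summable)
  finally have "3 ^ Suc n * ternary b = ternary (\<lambda>k. b (k + Suc n)) +
      (\<Sum>k<Suc n. 3 ^ Suc n * (of_bool (b k) * (1 / 3) ^ Suc k))"
    by (simp add: algebra_simps sum_distrib_left power_divide del: sum.lessThan_Suc)
  also have "(\<Sum>k<Suc n. 3 ^ Suc n * (of_bool (b k) * (1 / 3) ^ Suc k)) = real_of_int I"
    unfolding I_def of_int_sum
  proof (intro sum.cong refl)
    fix k assume "k \<in> {..<Suc n}"
    then have "(3::real) ^ Suc n = 3 ^ (n - k) * 3 ^ Suc k"
      by (subst power_add[symmetric]) auto
    then show "3 ^ Suc n * (of_bool (b k) * (1 / 3 :: real) ^ Suc k) = of_int (of_bool (b k) * 3 ^ (n - k))"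
      by (simp add: power_divide del: power_Suc)
  qed
  finally have "\<lfloor>3 ^ Suc n * ternary b\<rfloor> = I"
    using ternary_bounds[of "\<lambda>k. b (k + Suc n)"] by (intro floor_unique) auto
  moreover have "I = (\<Sum>k<n. of_bool (b k) * 3 ^ (n - k)) + of_bool (b n)"
    by (simp add: I_def)
  moreover have "3 dvd (\<Sum>k<n. of_bool (b k) * 3 ^ (n - k) :: int)"
    by (intro dvd_sum dvd_mult) auto
  ultimately show ?thesis by auto
qed

text \<open>A Borel embedding into [0, 1) with Borel left inverse. The code of \<open>a\<close>
  lists which balls of radius \<open>(1 / 2) ^ m\<close> around a dense sequence contain
  \<open>a\<close>; decoding takes, for each \<open>m\<close>, the first centre listed and passes to
  the limit.\<close>

lemma ex_real_code:
  "\<exists>(e :: 'a::polish_space \<Rightarrow> real) (d :: real \<Rightarrow> 'a). e \<in> borel_measurable borel \<and>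
    d \<in> borel_measurable borel \<and> (\<forall>a. 0 \<le> e a \<and> e a < 1 \<and> d (e a) = a)"
proof -
  obtain D :: "'a set" where D: "countable D" "\<And>X. open X \<Longrightarrow> X \<noteq> {} \<Longrightarrow> \<exists>d\<in>D. d \<in> X"
    using countable_dense_setE by blast
  define s where "s = from_nat_into D"
  have "D \<noteq> {}" using D(2)[of UNIV] by auto
  then have s: "\<exists>i. s i \<in> X" if "open X" "X \<noteq> {}" for X
    using D(2)[OF that] D(1) unfolding s_def by (metis from_nat_into_surj)
  define b where "b a n = (a \<in> ball (s (snd (prod_decode n))) ((1 / 2) ^ fst (prod_decode n)))" for a n
  define e where "e a = ternary (b a)" for a
  define c where "c y m = (LEAST i. \<lfloor>3 ^ Suc (prod_encode (m, i)) * y\<rfloor> mod 3 = 1)" for y :: real and m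
  define d where "d y = (if Cauchy (\<lambda>m. s (c y m)) then lim (\<lambda>m. s (c y m)) else s 0)" for y
  have "e \<in> borel_measurable borel"
    unfolding e_def ternary_def b_def mem_ball by measurable
  moreover have "d \<in> borel_measurable borel"
    unfolding d_def c_def
    by (intro measurable_lim_complete) measurable
  moreover have "d (e a) = a" for a
  proof -
    have "c (e a) m = (LEAST i. a \<in> ball (s i) ((1 / 2) ^ m))" for m
      unfolding c_def e_def ternary_digit by (simp add: b_def)
    moreover have "\<exists>i. a \<in> ball (s i) ((1 / 2) ^ m)" for m
      using s[of "ball a ((1 / 2) ^ m)"] centre_in_ball[of a "(1 / 2) ^ m"]
      by (fastforce simp: dist_commute)
    ultimately have "a \<in> ball (s (c (e a) m)) ((1 / 2) ^ m)" for m
      by (metis LeastI_ex)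
    then have le: "dist (s (c (e a) m)) a \<le> (1 / 2) ^ m" for m by (simp add: less_imp_le)
    have "(\<lambda>m. dist (s (c (e a) m)) a) \<longlonglongrightarrow> 0"
      by (rule tendsto_sandwich[of "\<lambda>_. 0" _ _ "\<lambda>m. (1 / 2) ^ m"]) (auto simp: le intro: LIMSEQ_realpow_zero)
    then have "(\<lambda>m. s (c (e a) m)) \<longlonglongrightarrow> a" by (subst tendsto_dist_iff)
    then show ?thesis
      unfolding d_def by (auto simp: limI dest: LIMSEQ_imp_Cauchy)
  qed
  moreover have "0 \<le> e a \<and> e a < 1" for a
    using ternary_bounds[of "b a"] by (auto simp: e_def)
  ultimately show ?thesis by blast
qed

text \<open>Both functions may be infinite, and integrals can be subtracted only where they are
  finite. So the bad set is cut into the pieces where \<open>v\<close> is at most \<open>j\<close>;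
  finiteness of \<open>n\<close> bounds the integral of \<open>v\<close> there.\<close>

lemma AE_le_of_set_nn_integral:
  assumes fin: "finite_measure n" and [measurable]: "u \<in> borel_measurable n" "v \<in> borel_measurable n"
    and le: "\<And>A. A \<in> sets n \<Longrightarrow> (\<integral>\<^sup>+x\<in>A. u x \<partial>n) \<le> (\<integral>\<^sup>+x\<in>A. v x \<partial>n)"
  shows "AE x in n. u x \<le> (v x :: ennreal)"
proof -
  interpret finite_measure n by fact
  have "AE x in n. \<not> (v x < u x \<and> v x \<le> of_nat j)" for j :: nat
  proof -
    define A where "A = {x \<in> space n. v x < u x \<and> v x \<le> of_nat j}"
    have A[measurable]: "A \<in> sets n" unfolding A_def by measurable
    have "(\<integral>\<^sup>+x\<in>A. v x \<partial>n) \<le> (\<integral>\<^sup>+x. of_nat j \<partial>n)"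
      by (intro nn_integral_mono) (auto simp: A_def indicator_def)
    also have "\<dots> < \<infinity>" by (simp add: ennreal_mult_eq_top_iff less_top[symmetric])
    finally have vfin: "(\<integral>\<^sup>+x\<in>A. v x \<partial>n) < \<infinity>" .
    have "(\<integral>\<^sup>+x\<in>A. v x \<partial>n) + (\<integral>\<^sup>+x\<in>A. (u x - v x) \<partial>n) = (\<integral>\<^sup>+x. v x * indicator A x + (u x - v x) * indicator A x \<partial>n)"
      by (subst nn_integral_add) auto
    also have "\<dots> = (\<integral>\<^sup>+x\<in>A. u x \<partial>n)"
      by (intro nn_integral_cong) (auto simp: A_def indicator_def less_imp_le intro: add_diff_inverse_ennreal)
    also have "\<dots> \<le> (\<integral>\<^sup>+x\<in>A. v x \<partial>n) + 0" using le[OF A] by simp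
    finally have "(\<integral>\<^sup>+x\<in>A. (u x - v x) \<partial>n) = 0"
      using vfin by (auto simp: ennreal_add_left_cancel_le)
    then have "AE x in n. (u x - v x) * indicator A x = 0"
      by (subst (asm) nn_integral_0_iff_AE) auto
    with AE_space show ?thesis
      by eventually_elim (auto simp: A_def diff_eq_0_iff_ennreal)
  qed
  then have "AE x in n. \<forall>j::nat. \<not> (v x < u x \<and> v x \<le> of_nat j)"
    by (subst AE_all_countable) blast
  then show ?thesis
  proof eventually_elim
    case (elim x)
    show ?case
    proof (rule ccontr)
      assume "\<not> u x \<le> v x"
      then have "v x < u x" by simp
      then have "v x \<noteq> \<infinity>" by auto
      then obtain j where "v x < of_nat j" using ennreal_Ex_less_of_nat[of "v x"] by (auto simp: less_top)
      with elim \<open>v x < u x\<close> show False by (meson less_imp_le)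
    qed
  qed
qed

lemma emeasure_distr_density_indicator:
  assumes [measurable]: "Measurable.pred N P" "g \<in> N \<rightarrow>\<^sub>M B" "C \<in> sets B"
  shows "emeasure (distr (density N (indicator {z. P z})) B g) C = emeasure N {z\<in>space N. P z \<and> g z \<in> C}"
proof -
  have [measurable]: "(indicator {z. P z} :: _ \<Rightarrow> ennreal) \<in> borel_measurable N" by measurable
  have "emeasure (distr (density N (indicator {z. P z})) B g) C =
      (\<integral>\<^sup>+z. indicator {z. P z} z * indicator (g -` C \<inter> space N) z \<partial>N)"
    by (simp add: emeasure_distr emeasure_density)
  also have "\<dots> = (\<integral>\<^sup>+z. indicator {z\<in>space N. P z \<and> g z \<in> C} z \<partial>N)"
    by (intro nn_integral_cong) (auto simp: indicator_def)
  finally show ?thesis by simp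
qed

text \<open>Regular conditional distributions through quantile functions. With actions coded as
  reals, \<open>F q x\<close> is the conditional probability of a code above \<open>q\<close>,
  \<open>\<tau> x\<close> is the generalised inverse of this tail function, and \<open>k x\<close>
  is the law of the decoded \<open>\<tau> x u\<close> for uniform \<open>u\<close>. Being the law of
  a random variable, \<open>k x\<close> is a probability measure at every \<open>x\<close>, whatever
  the densities do on null sets.\<close>

lemma disintegration_space:
  fixes A0 :: "'a::polish_space set" and S :: "'x measure"
  defines "T \<equiv> restrict_space borel A0"
  assumes A0: "A0 \<in> sets borel" and m: "prob_space m" "sets m = sets (S \<Otimes>\<^sub>M T)"
  shows "\<exists>k\<in>S \<rightarrow>\<^sub>M prob_algebra T. \<forall>f\<in>borel_measurable (S \<Otimes>\<^sub>M T).
    (\<integral>\<^sup>+z. f z \<partial>m) = (\<integral>\<^sup>+x. \<integral>\<^sup>+a. f (x, a) \<partial>k x \<partial>distr m S fst)"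
proof -
  interpret m: prob_space m by fact
  note [measurable_cong] = m(2)
  have spm: "space m = space S \<times> space T"
    using sets_eq_imp_space_eq[OF m(2)] by (simp add: space_pair_measure)
  have spT: "space T = A0" by (simp add: T_def space_restrict_space)
  define n where "n = distr m S fst"
  have fst_m[measurable]: "fst \<in> m \<rightarrow>\<^sub>M S" and snd_m[measurable]: "snd \<in> m \<rightarrow>\<^sub>M T"
    by measurable
  interpret n: prob_space n unfolding n_def by (rule m.prob_space_distr) measurable
  have sets_n[simp, measurable_cong]: "sets n = sets S" by (simp add: n_def)
  obtain a0 where a0: "a0 \<in> A0" using m.not_empty spm spT by auto
  obtain e :: "'a \<Rightarrow> real" and d where e: "e \<in> borel_measurable borel"
    and d[measurable]: "d \<in> borel_measurable borel"
    and ed: "\<And>a. 0 \<le> e a" "\<And>a. e a < 1" "\<And>a. d (e a) = a"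
    using ex_real_code by metis
  have eT[measurable]: "e \<in> borel_measurable T" unfolding T_def by (rule measurable_restrict_space1[OF e])
  have "\<exists>f. f \<in> borel_measurable S \<and>
      (\<forall>L\<in>sets S. (\<integral>\<^sup>+x\<in>L. f x \<partial>n) = emeasure m {z\<in>space m. fst z \<in> L \<and> e (snd z) \<in> B})"
    if B[measurable]: "B \<in> sets borel" for B
  proof -
    define N where "N = distr (density m (indicator {z. e (snd z) \<in> B})) S fst"
    have em: "emeasure N L = emeasure m {z\<in>space m. fst z \<in> L \<and> e (snd z) \<in> B}" if L[measurable]: "L \<in> sets S" for L
      unfolding N_def by (subst emeasure_distr_density_indicator) (auto intro!: arg_cong2[where f=emeasure])
    have "absolutely_continuous n N"
      unfolding absolutely_continuous_def
    proof
      fix L assume "L \<in> null_sets n"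
      then have L[measurable]: "L \<in> sets S" and 0: "emeasure m (fst -` L \<inter> space m) = 0"
        by (auto simp: null_sets_def n_def emeasure_distr)
      have "emeasure N L \<le> emeasure m (fst -` L \<inter> space m)"
        unfolding em[OF L] by (intro emeasure_mono) auto
      with 0 show "L \<in> null_sets N" by (simp add: null_sets_def N_def)
    qed
    moreover have "sets N = sets n" by (simp add: N_def)
    ultimately obtain f where f: "f \<in> borel_measurable n" "density n f = N"
      using n.Radon_Nikodym by blast
    have fL: "(\<integral>\<^sup>+x\<in>L. f x \<partial>n) = emeasure m {z\<in>space m. fst z \<in> L \<and> e (snd z) \<in> B}" if "L \<in> sets S" for L
    proof -
      have "(\<integral>\<^sup>+x\<in>L. f x \<partial>n) = emeasure N L"
        unfolding f(2)[symmetric] using that f(1) by (intro emeasure_density[symmetric]) simp_all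
      then show ?thesis unfolding em[OF that] .
    qed
    then show ?thesis
      using f(1) unfolding measurable_cong_sets[OF sets_n refl] by blast
  qed
  then have "\<forall>B. \<exists>f. B \<in> sets borel \<longrightarrow> f \<in> borel_measurable S \<and>
      (\<forall>L\<in>sets S. (\<integral>\<^sup>+x\<in>L. f x \<partial>n) = emeasure m {z\<in>space m. fst z \<in> L \<and> e (snd z) \<in> B})"
    by blast
  from choice[OF this] obtain dens where dens: "\<And>B. B \<in> sets borel \<Longrightarrow> dens B \<in> borel_measurable S \<and>
      (\<forall>L\<in>sets S. (\<integral>\<^sup>+x\<in>L. dens B x \<partial>n) = emeasure m {z\<in>space m. fst z \<in> L \<and> e (snd z) \<in> B})"
    by blast
  define F where "F q = dens {q<..}" for q
  have F[measurable]: "F q \<in> borel_measurable S" for q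
    unfolding F_def by (rule dens[THEN conjunct1]) simp
  have F_int: "(\<integral>\<^sup>+x\<in>L. F q x \<partial>n) = emeasure m {z\<in>space m. fst z \<in> L \<and> q < e (snd z)}"
    if "L \<in> sets S" for q L
  proof -
    have "{q<..} \<in> sets borel" by simp
    from dens[OF this, THEN conjunct2, THEN bspec, OF that] show ?thesis
      unfolding F_def greaterThan_iff .
  qed
  \<comment> \<open>Codes lie in [0, 1); restricting to rational levels leaves countably many
    densities to control.\<close>
  define I where "I = \<rat> \<inter> {0..1::real}"
  have cI: "countable I" unfolding I_def by (intro countable_Int1 countable_rat)
  have I0: "0 \<in> I" by (simp add: I_def)
  \<comment> \<open>The value 0 at levels that fail keeps the supremum over the fixed bounded set
    \<open>I\<close>; codes are nonnegative, so it distorts nothing.\<close>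
  define \<tau> where "\<tau> x u = (SUP q\<in>I. if ennreal u < F q x then q else 0)" for x u
  have bdd: "bdd_above ((\<lambda>q. if ennreal u < F q x then q else 0) ` I)" for u x
    by (rule bdd_aboveI[of _ 1]) (auto simp: I_def)
  have \<tau>_m[measurable]: "(\<lambda>(x, u). \<tau> x u) \<in> borel_measurable (S \<Otimes>\<^sub>M borel)"
    unfolding \<tau>_def split_beta' by (intro borel_measurable_cSUP cI bdd) measurable
  have \<tau>_less: "y < \<tau> x u \<longleftrightarrow> y < 0 \<or> (\<exists>q\<in>I. y < q \<and> ennreal u < F q x)" for x u y
  proof -
    have "y < \<tau> x u \<longleftrightarrow> (\<exists>q\<in>I. y < (if ennreal u < F q x then q else 0))"
      unfolding \<tau>_def using I0 by (intro less_cSUP_iff bdd) auto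
    also have "\<dots> \<longleftrightarrow> y < 0 \<or> (\<exists>q\<in>I. y < q \<and> ennreal u < F q x)"
    proof
      assume "\<exists>q\<in>I. y < (if ennreal u < F q x then q else 0)"
      then show "y < 0 \<or> (\<exists>q\<in>I. y < q \<and> ennreal u < F q x)" by (auto split: if_splits)
    next
      assume *: "y < 0 \<or> (\<exists>q\<in>I. y < q \<and> ennreal u < F q x)"
      show "\<exists>q\<in>I. y < (if ennreal u < F q x then q else 0)"
      proof (cases "y < 0")
        case True
        then show ?thesis using I0 by (intro bexI[of _ 0]) auto
      next
        case False
        with * obtain q where "q \<in> I" "y < q" "ennreal u < F q x" by auto
        then show ?thesis by (intro bexI[of _ q]) auto
      qed
    qed
    finally show ?thesis .
  qed
  define U where "U = uniform_measure lborel {0..<1::real}"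
  interpret U: prob_space U unfolding U_def by (rule prob_space_uniform_measure) auto
  have sets_U[simp, measurable_cong]: "sets U = sets borel" by (simp add: U_def)
  have U_less: "emeasure U {u. ennreal u < c} = min 1 c" for c
  proof -
    have "{u. ennreal u < c} \<in> sets borel" by measurable
    then have "emeasure U {u. ennreal u < c} = emeasure lborel ({0..<1} \<inter> {u. ennreal u < c})"
      by (simp add: U_def divide_ennreal_def)
    also have "\<dots> = min 1 c"
    proof (cases c)
      case (real r)
      then have "{0..<1} \<inter> {u. ennreal u < c} = {0..<min 1 r}"
        by (auto simp: ennreal_less_iff)
      then show ?thesis using real by (simp add: min_def)
    next
      case top
      then have "{0..<1} \<inter> {u. ennreal u < c} = {0..<1::real}" by auto
      then show ?thesis using top by (simp add: min_def)
    qed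
    finally show ?thesis .
  qed
  have law: "(\<integral>\<^sup>+x\<in>L. emeasure U {u. y < \<tau> x u} \<partial>n) = emeasure m {z\<in>space m. fst z \<in> L \<and> y < e (snd z)}"
    if L[measurable]: "L \<in> sets S" for L y
  proof (cases "y < 0")
    case True
    have "emeasure U UNIV = 1" using U.emeasure_space_1 by (simp add: U_def)
    then have "(\<integral>\<^sup>+x\<in>L. emeasure U {u. y < \<tau> x u} \<partial>n) = emeasure n L"
      using True by (simp add: \<tau>_less)
    also have "\<dots> = emeasure m {z\<in>space m. fst z \<in> L \<and> y < e (snd z)}"
    proof -
      have "y < e a" for a using True ed(1)[of a] by linarith
      then have "{z\<in>space m. fst z \<in> L \<and> y < e (snd z)} = fst -` L \<inter> space m" by auto
      then show ?thesis unfolding n_def by (simp add: emeasure_distr)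
    qed
    finally show ?thesis .
  next
    case False
    \<comment> \<open>The right limit of the tail function: \<open>y < \<tau> x u\<close> holds
      exactly if \<open>u < G x\<close>. Its integrals are compared with those of \<open>F y\<close>
      from above by monotonicity of the tails, and from below by continuity of \<open>m\<close>
      along the levels \<open>y + 1 / Suc i\<close>.\<close>
    define G where "G x = (SUP q\<in>{q\<in>I. y < q}. F q x)" for x
    have G[measurable]: "G \<in> borel_measurable S"
      unfolding G_def using cI by (intro borel_measurable_SUP) auto
    have "{u. y < \<tau> x u} = {u. ennreal u < G x}" for x
      using False by (auto simp: \<tau>_less G_def less_SUP_iff)
    then have UG: "emeasure U {u. y < \<tau> x u} = min 1 (G x)" for x by (simp add: U_less)
    have "AE x in n. F q x \<le> F y x" if "q \<in> {q\<in>I. y < q}" for q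
      using that by (intro AE_le_of_set_nn_integral) (auto simp: F_int intro!: emeasure_mono, unfold_locales)
    then have "AE x in n. \<forall>q\<in>{q\<in>I. y < q}. F q x \<le> F y x"
      using cI by (subst AE_ball_countable) auto
    then have GF: "AE x in n. G x \<le> F y x"
      by eventually_elim (auto simp: G_def intro!: SUP_least)
    have "AE x in n. F y x \<le> 1"
    proof (rule AE_le_of_set_nn_integral[OF n.finite_measure_axioms])
      fix L assume "L \<in> sets n"
      then have L[measurable]: "L \<in> sets S" by simp
      have "(\<integral>\<^sup>+x\<in>L. F y x \<partial>n) \<le> emeasure m (fst -` L \<inter> space m)"
        unfolding F_int[OF L] by (intro emeasure_mono) auto
      also have "\<dots> = (\<integral>\<^sup>+x\<in>L. 1 \<partial>n)" by (simp add: n_def emeasure_distr)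
      finally show "(\<integral>\<^sup>+x\<in>L. F y x \<partial>n) \<le> (\<integral>\<^sup>+x\<in>L. 1 \<partial>n)" .
    qed simp_all
    with GF have G1: "AE x in n. min 1 (G x) = G x"
      by eventually_elim (auto simp: min_def)
    have "(\<integral>\<^sup>+x\<in>L. emeasure U {u. y < \<tau> x u} \<partial>n) = (\<integral>\<^sup>+x\<in>L. G x \<partial>n)"
      unfolding UG using G1 by (intro nn_integral_cong_AE) (auto elim!: eventually_mono)
    also have "\<dots> = emeasure m {z\<in>space m. fst z \<in> L \<and> y < e (snd z)}"
    proof (rule antisym)
      show "(\<integral>\<^sup>+x\<in>L. G x \<partial>n) \<le> emeasure m {z\<in>space m. fst z \<in> L \<and> y < e (snd z)}"
        unfolding F_int[OF L, symmetric] using GF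
        by (intro nn_integral_mono_AE) (auto elim!: eventually_mono intro: mult_right_mono)
      define B where "B i = {z\<in>space m. fst z \<in> L \<and> y + 1 / Suc i < e (snd z)}" for i :: nat
      have B_eq: "{z\<in>space m. fst z \<in> L \<and> y < e (snd z)} = (\<Union>i. B i)"
      proof (intro equalityI subsetI)
        fix z assume z: "z \<in> {z\<in>space m. fst z \<in> L \<and> y < e (snd z)}"
        then obtain i where "inverse (real (Suc i)) < e (snd z) - y"
          using reals_Archimedean[of "e (snd z) - y"] by auto
        with z show "z \<in> (\<Union>i. B i)" by (auto simp: B_def inverse_eq_divide intro!: exI[of _ i])
      next
        fix z assume "z \<in> (\<Union>i. B i)"
        then obtain i where "z \<in> B i" by auto
        moreover have "y < y + 1 / real (Suc i)" by simp
        ultimately show "z \<in> {z\<in>space m. fst z \<in> L \<and> y < e (snd z)}"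
          unfolding B_def using less_trans by blast
      qed
      have "incseq B"
      proof (rule incseq_SucI, rule subsetI)
        fix i z assume "z \<in> B i"
        moreover have "1 / real (Suc (Suc i)) \<le> 1 / real (Suc i)" by (simp add: frac_le)
        ultimately show "z \<in> B (Suc i)" unfolding B_def by (auto simp del: of_nat_Suc)
      qed
      moreover have "range B \<subseteq> sets m" unfolding B_def by auto
      ultimately have "emeasure m {z\<in>space m. fst z \<in> L \<and> y < e (snd z)} = (SUP i. emeasure m (B i))"
        unfolding B_eq by (intro SUP_emeasure_incseq[symmetric])
      also have "\<dots> \<le> (\<integral>\<^sup>+x\<in>L. G x \<partial>n)"
      proof (rule SUP_least)
        fix i :: nat
        show "emeasure m (B i) \<le> (\<integral>\<^sup>+x\<in>L. G x \<partial>n)"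
        \<comment> \<open>Below 1 a rational level of \<open>I\<close> fits between \<open>y\<close>
          and \<open>y + 1 / Suc i\<close>; from 1 on there are no codes.\<close>
        proof (cases "y < 1")
          case True
          then have "y < min 1 (y + 1 / Suc i)" by simp
          then obtain q where q: "q \<in> \<rat>" "y < q" "q < min 1 (y + 1 / Suc i)"
            using Rats_dense_in_real by blast
          then have qI: "q \<in> {q\<in>I. y < q}" using False by (auto simp: I_def)
          have "emeasure m (B i) \<le> (\<integral>\<^sup>+x\<in>L. F q x \<partial>n)"
            unfolding F_int[OF L] using q by (intro emeasure_mono) (auto simp: B_def)
          also have "\<dots> \<le> (\<integral>\<^sup>+x\<in>L. G x \<partial>n)"
            using qI by (intro nn_integral_mono mult_right_mono) (auto simp: G_def intro: SUP_upper)
          finally show ?thesis .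
        next
          case False
          have "0 < 1 / real (Suc i)" by simp
          then have "e a < y + 1 / real (Suc i)" for a using ed(2)[of a] False by linarith
          then have "B i = {}" unfolding B_def using less_asym by blast
          then show ?thesis by simp
        qed
      qed
      finally show "emeasure m {z\<in>space m. fst z \<in> L \<and> y < e (snd z)} \<le> (\<integral>\<^sup>+x\<in>L. G x \<partial>n)" .
    qed
    finally show ?thesis .
  qed
  \<comment> \<open>A real that codes no point of \<open>A0\<close> may be decoded to a point
    outside \<open>A0\<close>.\<close>
  define d' where "d' y = (if d y \<in> A0 then d y else a0)" for y
  have d'[measurable]: "d' \<in> borel \<rightarrow>\<^sub>M T"
    unfolding T_def
  proof (rule measurable_restrict_space2)
    show "d' \<in> borel_measurable borel"
      unfolding d'_def using A0 by measurable
  qed (use a0 in \<open>auto simp: d'_def\<close>)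
  define mr where "mr = distr m (S \<Otimes>\<^sub>M borel) (\<lambda>z. (fst z, e (snd z)))"
  define mr' where "mr' = distr (n \<Otimes>\<^sub>M U) (S \<Otimes>\<^sub>M borel) (\<lambda>z. (fst z, \<tau> (fst z) (snd z)))"
  interpret nU: pair_sigma_finite n U ..
  interpret nUp: prob_space "n \<Otimes>\<^sub>M U" by (intro prob_space_pair n.prob_space_axioms U.prob_space_axioms)
  have \<tau>_m'[measurable]: "(\<lambda>z. \<tau> (fst z) (snd z)) \<in> borel_measurable (S \<Otimes>\<^sub>M borel)"
    using \<tau>_m by (simp add: split_beta')
  have \<tau>_nU[measurable]: "(\<lambda>z. \<tau> (fst z) (snd z)) \<in> borel_measurable (n \<Otimes>\<^sub>M U)"
    using \<tau>_m' by (simp cong: measurable_cong_sets sets_pair_measure_cong)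
  have rect: "emeasure mr (L \<times> B) = emeasure mr' (L \<times> B)" if L[measurable]: "L \<in> sets S" and B[measurable]: "B \<in> sets borel" for L B
  proof -
    \<comment> \<open>For fixed \<open>L\<close> both are finite Borel measures on the line, so the
      equality \<open>law\<close> on half-lines identifies them.\<close>
    define M1 where "M1 = distr (density m (indicator {z. fst z \<in> L})) borel (\<lambda>z. e (snd z))"
    define M2 where "M2 = distr (density (n \<Otimes>\<^sub>M U) (indicator {z. fst z \<in> L})) borel (\<lambda>z. \<tau> (fst z) (snd z))"
    have M1: "emeasure M1 C = emeasure m {z\<in>space m. fst z \<in> L \<and> e (snd z) \<in> C}" if [measurable]: "C \<in> sets borel" for C
      unfolding M1_def by (rule emeasure_distr_density_indicator) measurable
    have M2: "emeasure M2 C = emeasure (n \<Otimes>\<^sub>M U) {z\<in>space (n \<Otimes>\<^sub>M U). fst z \<in> L \<and> \<tau> (fst z) (snd z) \<in> C}"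
      if [measurable]: "C \<in> sets borel" for C
      unfolding M2_def by (rule emeasure_distr_density_indicator) measurable
    have "M1 = M2"
    proof (rule measure_eqI_lessThan)
      fix y :: real
      show "emeasure M1 {y<..} < \<infinity>" by (subst M1) (auto simp: less_top[symmetric])
      have "emeasure M2 {y<..} = emeasure (n \<Otimes>\<^sub>M U) {z\<in>space (n \<Otimes>\<^sub>M U). fst z \<in> L \<and> y < \<tau> (fst z) (snd z)}"
        by (subst M2) auto
      also have "\<dots> = (\<integral>\<^sup>+x. emeasure U (Pair x -` {z\<in>space (n \<Otimes>\<^sub>M U). fst z \<in> L \<and> y < \<tau> (fst z) (snd z)}) \<partial>n)"
        by (rule U.emeasure_pair_measure_alt) measurable
      also have "\<dots> = (\<integral>\<^sup>+x\<in>L. emeasure U {u. y < \<tau> x u} \<partial>n)"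
      proof (rule nn_integral_cong)
        fix x assume "x \<in> space n"
        moreover have "space U = UNIV" by (simp add: U_def)
        ultimately have "Pair x -` {z\<in>space (n \<Otimes>\<^sub>M U). fst z \<in> L \<and> y < \<tau> (fst z) (snd z)} =
            (if x \<in> L then {u. y < \<tau> x u} else {})"
          by (auto simp: space_pair_measure)
        then show "emeasure U (Pair x -` {z\<in>space (n \<Otimes>\<^sub>M U). fst z \<in> L \<and> y < \<tau> (fst z) (snd z)}) =
            emeasure U {u. y < \<tau> x u} * indicator L x" by simp
      qed
      also have "\<dots> = emeasure M1 {y<..}" unfolding law[OF L] by (subst M1) auto
      finally show "emeasure M1 {y<..} = emeasure M2 {y<..}" by simp
    qed (simp_all add: M1_def M2_def)
    moreover have "emeasure mr (L \<times> B) = emeasure M1 B"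
      unfolding mr_def M1[OF B] by (subst emeasure_distr) (auto intro!: arg_cong2[where f=emeasure])
    moreover have "emeasure mr' (L \<times> B) = emeasure M2 B"
      unfolding mr'_def M2[OF B] by (subst emeasure_distr) (auto intro!: arg_cong2[where f=emeasure])
    ultimately show ?thesis by simp
  qed
  have "mr = mr'"
  proof (rule measure_eqI_generator_eq[OF Int_stable_pair_measure_generator[of S borel], where \<Omega>="space S \<times> UNIV" and A="\<lambda>_. space S \<times> UNIV"])
    show "{a \<times> b |a b. a \<in> sets S \<and> b \<in> sets (borel :: real measure)} \<subseteq> Pow (space S \<times> UNIV)"
      using sets.sets_into_space[of _ S] by auto
    show "sets mr = sigma_sets (space S \<times> UNIV) {a \<times> b |a b. a \<in> sets S \<and> b \<in> sets borel}"
      "sets mr' = sigma_sets (space S \<times> UNIV) {a \<times> b |a b. a \<in> sets S \<and> b \<in> sets borel}"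
      by (simp_all add: mr_def mr'_def sets_pair_measure)
    have "prob_space mr" unfolding mr_def by (intro m.prob_space_distr) measurable
    then interpret mr: prob_space mr .
    show "emeasure mr (space S \<times> UNIV) \<noteq> \<infinity>" by simp
    have "space S \<times> UNIV \<in> {a \<times> b |a b. a \<in> sets S \<and> b \<in> sets (borel :: real measure)}"
      by (intro CollectI exI[of _ "space S"] exI[of _ UNIV]) simp
    then show "range (\<lambda>_::nat. space S \<times> UNIV) \<subseteq> {a \<times> b |a b. a \<in> sets S \<and> b \<in> sets (borel :: real measure)}"
      by auto
  qed (use rect in auto)
  define k where "k x = distr U T (\<lambda>u. d' (\<tau> x u))" for x
  have k: "k \<in> S \<rightarrow>\<^sub>M prob_algebra T"
    unfolding k_def
  proof (rule measurable_distr_prob_space2)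
    show "(\<lambda>x. U) \<in> S \<rightarrow>\<^sub>M prob_algebra borel"
      by (rule measurable_const) (simp add: space_prob_algebra U.prob_space_axioms)
  qed measurable
  have eq: "(\<integral>\<^sup>+z. f z \<partial>m) = (\<integral>\<^sup>+x. \<integral>\<^sup>+a. f (x, a) \<partial>k x \<partial>n)" if f[measurable]: "f \<in> borel_measurable (S \<Otimes>\<^sub>M T)" for f
  proof -
    have "(\<integral>\<^sup>+z. f z \<partial>m) = (\<integral>\<^sup>+z. f (fst z, d' (e (snd z))) \<partial>m)"
      by (intro nn_integral_cong) (auto simp: spm spT d'_def ed(3))
    also have "\<dots> = (\<integral>\<^sup>+z. f (fst z, d' (snd z)) \<partial>mr)"
      unfolding mr_def by (subst nn_integral_distr) simp_all
    also have "\<dots> = (\<integral>\<^sup>+z. f (fst z, d' (\<tau> (fst z) (snd z))) \<partial>(n \<Otimes>\<^sub>M U))"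
      unfolding \<open>mr = mr'\<close> mr'_def by (subst nn_integral_distr) simp_all
    also have "\<dots> = (\<integral>\<^sup>+x. \<integral>\<^sup>+u. f (x, d' (\<tau> x u)) \<partial>U \<partial>n)"
      by (subst U.nn_integral_fst[symmetric]) simp_all
    also have "\<dots> = (\<integral>\<^sup>+x. \<integral>\<^sup>+a. f (x, a) \<partial>k x \<partial>n)"
    proof (rule nn_integral_cong)
      fix x assume "x \<in> space n"
      then have x[measurable]: "x \<in> space S" by (simp add: n_def)
      have [measurable]: "\<tau> x \<in> borel_measurable borel"
        using measurable_Pair2[OF \<tau>_m, of x] x by simp
      show "(\<integral>\<^sup>+u. f (x, d' (\<tau> x u)) \<partial>U) = (\<integral>\<^sup>+a. f (x, a) \<partial>k x)"
        unfolding k_def by (subst nn_integral_distr) simp_all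
    qed
    finally show ?thesis .
  qed
  show ?thesis
  proof (rule bexI[OF _ k], rule ballI)
    fix f :: "'x \<times> 'a \<Rightarrow> ennreal" assume "f \<in> borel_measurable (S \<Otimes>\<^sub>M T)"
    from eq[OF this] show "(\<integral>\<^sup>+z. f z \<partial>m) = (\<integral>\<^sup>+x. \<integral>\<^sup>+a. f (x, a) \<partial>k x \<partial>distr m S fst)"
      unfolding n_def .
  qed
qed

section \<open>Markov policies\<close>

lemma nn_integral_bind_prob:
  assumes n: "n \<in> space (prob_algebra S)" and R: "R \<in> S \<rightarrow>\<^sub>M prob_algebra T"
    and f: "f \<in> borel_measurable T"
  shows "(\<integral>\<^sup>+y. f y \<partial>(n \<bind> R)) = (\<integral>\<^sup>+x. \<integral>\<^sup>+y. f y \<partial>R x \<partial>n)"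
proof (rule nn_integral_bind[OF f])
  show "R \<in> n \<rightarrow>\<^sub>M subprob_algebra T"
    using measurable_prob_algebraD[OF R] n by (simp add: space_prob_algebra cong: measurable_cong_sets)
qed

lemma bind_in_prob_algebra:
  assumes "n \<in> space (prob_algebra S)" and "R \<in> S \<rightarrow>\<^sub>M prob_algebra T"
  shows "n \<bind> R \<in> space (prob_algebra T)"
  using prob_space_bind'[OF assms] sets_bind'[OF assms] by (simp add: space_prob_algebra)

lemma nn_integral_prob_kernel_measurable:
  assumes "k \<in> S \<rightarrow>\<^sub>M prob_algebra T" "f \<in> borel_measurable (S \<Otimes>\<^sub>M T)"
  shows "(\<lambda>x. \<integral>\<^sup>+a. f (x, a) \<partial>k x) \<in> borel_measurable S"
  by (rule finite_kernel_nn_integral[OF finite_kernel_prob[OF assms(1)] assms(2)])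

section \<open>The model, decision rules and state laws\<close>

locale controlled_model =
  fixes M :: "('x::polish_space, 'a::polish_space) cmdm"
  assumes model: "control_model M"
begin

abbreviation "X \<equiv> state_space M"
abbreviation "A \<equiv> action_space M"
abbreviation "XA \<equiv> pair_space M"
abbreviation "K \<equiv> feasible_pairs M"

lemma space_X [simp]: "space X = states M" and space_A [simp]: "space A = actions M"
  by (simp_all add: space_restrict_space)

lemma space_XA [simp]: "space XA = states M \<times> actions M"
  by (simp add: space_pair_measure)

lemma K_sets [measurable]: "K \<in> sets XA"
  using model by (simp add: control_model_def)

lemma admissible_sets: "x \<in> states M \<Longrightarrow> admissible M x \<in> sets A"
  using model by (simp add: control_model_def)

lemma admissible_sub: "x \<in> states M \<Longrightarrow> a \<in> admissible M x \<Longrightarrow> a \<in> actions M"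
  using sets.sets_into_space[OF admissible_sets] by auto

lemma K_sub: "K \<subseteq> states M \<times> actions M"
  using admissible_sub by (auto simp: feasible_pairs_def)

lemma in_K [simp]: "(x, a) \<in> K \<longleftrightarrow> x \<in> states M \<and> a \<in> admissible M x"
  by (simp add: feasible_pairs_def)

lemma vimage_K: "x \<in> states M \<Longrightarrow> Pair x -` K = admissible M x"
  by auto

lemma initial_prob: "initial M \<in> space (prob_algebra X)"
  using model by (simp add: control_model_def)

lemma obtain_selector:
  obtains f where "f \<in> X \<rightarrow>\<^sub>M A" "\<And>x. x \<in> states M \<Longrightarrow> f x \<in> admissible M x"
  using model unfolding control_model_def measurable_selector_def by blast

text \<open>A version of the transition law on all pairs. Infeasible pairs, which no decision rule
  charges, receive \<open>initial M\<close>, a probability law that is at hand.\<close>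

definition Q :: "'x \<times> 'a \<Rightarrow> 'x measure" where
  "Q z = (if z \<in> K then transition M z else initial M)"

lemma Q_measurable [measurable]: "Q \<in> XA \<rightarrow>\<^sub>M prob_algebra X"
proof -
  have "transition M \<in> restrict_space XA {z. z \<in> K} \<rightarrow>\<^sub>M prob_algebra X"
    using model by (simp add: control_model_def)
  moreover have "{z \<in> space XA. z \<in> K} \<in> sets XA" by measurable
  ultimately show ?thesis
    unfolding Q_def using initial_prob by (subst measurable_If_restrict_space_iff) auto
qed

text \<open>This concerns a single decision rule; a Markov policy is a sequence of such
  rules.\<close>

definition markov :: "('x \<Rightarrow> 'a measure) \<Rightarrow> bool" where
  "markov k \<longleftrightarrow> k \<in> X \<rightarrow>\<^sub>M prob_algebra A \<and> (\<forall>x\<in>states M. emeasure (k x) (admissible M x) = 1)"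

lemma markovD: "markov k \<Longrightarrow> k \<in> X \<rightarrow>\<^sub>M prob_algebra A"
  by (simp add: markov_def)

lemma markov_prob: "markov k \<Longrightarrow> x \<in> states M \<Longrightarrow> k x \<in> space (prob_algebra A)"
  using measurable_space[of k X "prob_algebra A" x] by (simp add: markov_def)

lemma markov_sets: "markov k \<Longrightarrow> x \<in> states M \<Longrightarrow> sets (k x) = sets A"
  using markov_prob[of k x] by (simp add: space_prob_algebra)

lemma markov_space: "markov k \<Longrightarrow> x \<in> states M \<Longrightarrow> space (k x) = actions M"
  using sets_eq_imp_space_eq[OF markov_sets[of k x]] by simp

lemma markov_total: "markov k \<Longrightarrow> x \<in> states M \<Longrightarrow> emeasure (k x) (actions M) = 1"
  using in_space_prob_algebra[OF markov_prob[of k x]] by simp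

lemma markov_AE: assumes "markov k" "x \<in> states M" shows "AE a in k x. a \<in> admissible M x"
proof -
  interpret prob_space "k x" using markov_prob[OF assms] by (simp add: space_prob_algebra)
  show ?thesis
    by (rule AE_prob_1) (use assms in \<open>simp_all add: markov_def measure_def\<close>)
qed

definition nxt :: "('x \<Rightarrow> 'a measure) \<Rightarrow> 'x \<Rightarrow> 'x measure" where
  "nxt k x = k x \<bind> (\<lambda>a. Q (x, a))"

lemma nxt_measurable: "markov k \<Longrightarrow> nxt k \<in> X \<rightarrow>\<^sub>M prob_algebra X"
  unfolding nxt_def by (intro measurable_bind_prob_space2[where N=A]) (auto dest: markovD)

lemma nn_integral_nxt:
  assumes "markov k" "x \<in> states M" "g \<in> borel_measurable X"
  shows "(\<integral>\<^sup>+y. g y \<partial>nxt k x) = (\<integral>\<^sup>+a. \<integral>\<^sup>+y. g y \<partial>Q (x, a) \<partial>k x)"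
  unfolding nxt_def using assms(2)
  by (intro nn_integral_bind_prob[OF markov_prob[OF assms(1,2)] _ assms(3)]) measurable

text \<open>The state distribution at stage \<open>t\<close> under the Markov policy
  \<open>k\<close>, obtained by recursion instead of from a path space.\<close>

fun law :: "(nat \<Rightarrow> 'x \<Rightarrow> 'a measure) \<Rightarrow> nat \<Rightarrow> 'x measure" where
  "law k 0 = initial M"
| "law k (Suc t) = law k t \<bind> nxt (k t)"

lemma law_prob: "(\<And>t. markov (k t)) \<Longrightarrow> law k t \<in> space (prob_algebra X)"
  by (induction t) (auto intro: initial_prob bind_in_prob_algebra nxt_measurable)

lemma sets_law: "(\<And>t. markov (k t)) \<Longrightarrow> sets (law k t) = sets X"
  using law_prob[of k t] by (simp add: space_prob_algebra)

lemma space_law: "(\<And>t. markov (k t)) \<Longrightarrow> space (law k t) = states M"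
  using sets_eq_imp_space_eq[OF sets_law[of k t]] by simp

lemma Q_integral_measurable:
  "g \<in> borel_measurable X \<Longrightarrow> (\<lambda>z. \<integral>\<^sup>+y. g y \<partial>Q z) \<in> borel_measurable XA"
  by (rule measurable_compose[OF measurable_prob_algebraD[OF Q_measurable] nn_integral_measurable_subprob_algebra])

lemma nn_integral_law_Suc:
  assumes k: "\<And>t. markov (k t)" and g: "g \<in> borel_measurable X"
  shows "(\<integral>\<^sup>+y. g y \<partial>law k (Suc t)) = (\<integral>\<^sup>+x. \<integral>\<^sup>+a. \<integral>\<^sup>+y. g y \<partial>Q (x, a) \<partial>k t x \<partial>law k t)"
proof -
  have "(\<integral>\<^sup>+y. g y \<partial>law k (Suc t)) = (\<integral>\<^sup>+x. \<integral>\<^sup>+y. g y \<partial>nxt (k t) x \<partial>law k t)"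
    by (simp add: nn_integral_bind_prob[OF law_prob[of k, OF k] nxt_measurable[OF k] g])
  also have "\<dots> = (\<integral>\<^sup>+x. \<integral>\<^sup>+a. \<integral>\<^sup>+y. g y \<partial>Q (x, a) \<partial>k t x \<partial>law k t)"
    by (intro nn_integral_cong nn_integral_nxt k g) (simp add: space_law[of k, OF k])
  finally show ?thesis .
qed

text \<open>The integral of \<open>f\<close> against the occupation measure of the Markov policy \<open>k\<close>.\<close>

definition occ :: "(nat \<Rightarrow> 'x \<Rightarrow> 'a measure) \<Rightarrow> ('x \<times> 'a \<Rightarrow> ennreal) \<Rightarrow> ennreal" where
  "occ k f = (\<Sum>t. \<integral>\<^sup>+x. \<integral>\<^sup>+a. f (x, a) \<partial>k t x \<partial>law k t)"

text \<open>A disintegration is admissible only at almost all states, whereas a policy has to be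
  admissible at every state. On the exceptional set, which is measurable because it is read off the
  masses of the sections of \<open>K\<close>, a selector is followed instead.\<close>

lemma markov_disintegration:
  assumes m: "m \<in> space (prob_algebra XA)" and mK: "AE z in m. z \<in> K"
  shows "\<exists>k. markov k \<and> (\<forall>f\<in>borel_measurable XA.
    (\<integral>\<^sup>+z. f z \<partial>m) = (\<integral>\<^sup>+x. \<integral>\<^sup>+a. f (x, a) \<partial>k x \<partial>distr m X fst))"
proof -
  have actions: "actions M \<in> sets borel" using model by (simp add: control_model_def)
  have pm: "prob_space m" and sm[measurable_cong]: "sets m = sets XA" using m by (auto simp: space_prob_algebra)
  obtain k where k: "k \<in> X \<rightarrow>\<^sub>M prob_algebra A"
    and kf: "\<And>f. f \<in> borel_measurable XA \<Longrightarrow>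
      (\<integral>\<^sup>+z. f z \<partial>m) = (\<integral>\<^sup>+x. \<integral>\<^sup>+a. f (x, a) \<partial>k x \<partial>distr m X fst)"
    using disintegration_space[OF actions pm sm] by (elim bexE) blast
  define n where "n = distr m X fst"
  have sn: "sets n = sets X" by (simp add: n_def)
  note fk = finite_kernel_prob[OF k]
  have k_sets: "sets (k x) = sets A" and k_prob: "prob_space (k x)" if "x \<in> states M" for x
    using measurable_space[OF k, of x] that by (auto simp: space_prob_algebra)
  obtain s where s: "s \<in> X \<rightarrow>\<^sub>M A" "\<And>x. x \<in> states M \<Longrightarrow> s x \<in> admissible M x"
    using obtain_selector by blast
  define k' where "k' x = (if emeasure (k x) (Pair x -` K) = 1 then k x else return A (s x))" for x
  have sec: "(\<lambda>x. emeasure (k x) (Pair x -` K)) \<in> borel_measurable X"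
    by (rule finite_kernel_section[OF fk]) measurable
  have k': "k' \<in> X \<rightarrow>\<^sub>M prob_algebra A"
    unfolding k'_def
  proof (rule measurable_If[OF k])
    show "(\<lambda>x. return A (s x)) \<in> X \<rightarrow>\<^sub>M prob_algebra A"
      by (rule measurable_compose[OF s(1) measurable_return_prob_space])
    show "{x \<in> space X. emeasure (k x) (Pair x -` K) = 1} \<in> sets X"
      using sec by measurable
  qed
  have "markov k'"
    unfolding markov_def
  proof (intro conjI ballI k')
    fix x assume x: "x \<in> states M"
    then show "emeasure (k' x) (admissible M x) = 1"
      using vimage_K[OF x] s(2)[OF x] admissible_sets[OF x] by (auto simp: k'_def)
  qed
  moreover have "AE x in n. k' x = k x"
  proof -
    \<comment> \<open>Infeasible pairs are \<open>m\<close>-null, so their sections are null for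
      almost every state and the correction does not change the disintegration.\<close>
    define N where "N = space XA - K"
    have N[measurable]: "N \<in> sets XA" unfolding N_def by measurable
    have Nm: "N \<in> sets m" using N sm by simp
    have "0 = (\<integral>\<^sup>+z. indicator (N) z \<partial>m)"
      using mK Nm by (subst nn_integral_0_iff_AE[THEN iffD2, of _ m]) (auto simp: N_def elim!: eventually_mono)
    also have "\<dots> = (\<integral>\<^sup>+x. \<integral>\<^sup>+a. indicator (N) (x, a) \<partial>k x \<partial>n)"
      unfolding n_def by (rule kf) measurable
    finally have "AE x in n. (\<integral>\<^sup>+a. indicator (N) (x, a) \<partial>k x) = 0"
      using finite_kernel_nn_integral[OF fk, of "indicator (N)"]
      by (subst (asm) eq_commute, subst (asm) nn_integral_0_iff_AE) (auto cong: measurable_cong_sets simp: sn)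
    moreover have "AE x in n. x \<in> states M"
      using AE_space[of n] sets_eq_imp_space_eq[OF sn] by simp
    ultimately show ?thesis
    proof eventually_elim
      case (elim x)
      interpret prob_space "k x" using k_prob[OF elim(2)] .
      have "AE a in k x. (indicator (N) (x, a) :: ennreal) = 0"
        using elim k_sets[OF elim(2)] by (subst (asm) nn_integral_0_iff_AE) (auto cong: measurable_cong_sets)
      moreover have "AE a in k x. a \<in> actions M"
        using AE_space[of "k x"] sets_eq_imp_space_eq[OF k_sets[OF elim(2)]] by simp
      ultimately have "AE a in k x. a \<in> admissible M x"
        by eventually_elim (use elim(2) in \<open>auto simp: N_def indicator_def split: if_splits\<close>)
      then have "prob (admissible M x) = 1"
        using admissible_sets[OF elim(2)] k_sets[OF elim(2)] by (intro prob_eq_1[THEN iffD2]) auto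
      then show ?case
        using elim(2) by (simp add: k'_def vimage_K emeasure_eq_measure)
    qed
  qed
  then have "(\<integral>\<^sup>+x. \<integral>\<^sup>+a. f (x, a) \<partial>k x \<partial>n) = (\<integral>\<^sup>+x. \<integral>\<^sup>+a. f (x, a) \<partial>k' x \<partial>n)" for f :: "_ \<Rightarrow> ennreal"
    by (intro nn_integral_cong_AE) (auto elim!: eventually_mono)
  ultimately show ?thesis using kf unfolding n_def by (intro exI[of _ k']) auto
qed

section \<open>Reduction of policies to Markov policies\<close>

text \<open>Histories of arbitrary pairs, on which the Ionescu-Tulcea construction runs;
  \<open>history_space\<close> admits feasible pairs only.\<close>

definition histories :: "nat \<Rightarrow> (nat \<Rightarrow> 'x \<times> 'a) measure" where
  "histories t = PiM {0..<t} (\<lambda>_. XA)"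

definition source :: "nat \<Rightarrow> (nat \<Rightarrow> 'x \<times> 'a) \<Rightarrow> 'x measure" where
  "source t h = (if t = 0 then initial M else transition M (h (t - 1)))"

lemma feasible_history_space:
  assumes "h \<in> space (histories t)" "\<forall>i<t. h i \<in> K" "x \<in> states M"
  shows "(h, x) \<in> space (history_space M t)"
  using assms by (auto simp: histories_def space_pair_measure space_PiM space_restrict_space PiE_iff)

lemma policy_kernel:
  assumes \<pi>: "\<pi> \<in> policies M" and h: "h \<in> space (histories t)" "\<forall>i<t. h i \<in> K"
  shows "(\<lambda>x. \<pi> t (h, x)) \<in> X \<rightarrow>\<^sub>M prob_algebra A"
    and "x \<in> states M \<Longrightarrow> emeasure (\<pi> t (h, x)) (admissible M x) = 1"
proof -
  have h': "h \<in> space (\<Pi>\<^sub>M i\<in>{0..<t}. feasible_space M)"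
    using h by (auto simp: histories_def space_PiM space_restrict_space PiE_iff)
  have "\<pi> t \<in> history_space M t \<rightarrow>\<^sub>M prob_algebra A"
    using \<pi> by (simp add: policies_def)
  then show "(\<lambda>x. \<pi> t (h, x)) \<in> X \<rightarrow>\<^sub>M prob_algebra A"
    by (rule measurable_Pair2) (rule h')
  show "emeasure (\<pi> t (h, x)) (admissible M x) = 1" if "x \<in> states M"
    using \<pi> feasible_history_space[OF h that] unfolding policies_def by blast
qed

lemma source_in_prob:
  assumes "h \<in> space (histories t)" "\<forall>i<t. h i \<in> K"
  shows "source t h \<in> space (prob_algebra X)"
proof (cases "t = 0")
  case False
  then have "h (t - 1) \<in> K" using assms by simp
  moreover from this have "h (t - 1) \<in> space XA" using K_sub by auto
  ultimately show ?thesis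
    using measurable_space[OF Q_measurable, of "h (t - 1)"] False by (simp add: source_def Q_def)
qed (simp add: source_def initial_prob)

lemma step_kernel_feasible:
  "\<forall>i<t. h i \<in> K \<Longrightarrow>
    step_kernel M \<pi> t h = source t h \<bind> (\<lambda>x. \<pi> t (h, x) \<bind> (\<lambda>a. return XA (x, a)))"
  by (simp add: step_kernel_def source_def)

lemma history_component: "i < t \<Longrightarrow> (\<lambda>h. h i) \<in> histories t \<rightarrow>\<^sub>M XA"
  unfolding histories_def by (rule measurable_component_singleton) simp

lemma histories_feasible:
  "{h \<in> space (histories t). \<forall>i<t. h i \<in> K} \<in> sets (histories t)"
proof -
  have "{h \<in> space (histories t). h i \<in> K} \<in> sets (histories t)" if "i \<in> {..<t}" for i
  proof -
    have "(\<lambda>h. h i) -` K \<inter> space (histories t) = {h \<in> space (histories t). h i \<in> K}" by auto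
    then show ?thesis using measurable_sets[OF history_component[of i t] K_sets] that by (metis lessThan_iff)
  qed
  then have "{h \<in> space (histories t). \<forall>i\<in>{..<t}. h i \<in> K} \<in> sets (histories t)"
    by (rule sets.sets_Collect_finite_All) (assumption, rule finite_lessThan)
  then show ?thesis unfolding Ball_def lessThan_iff .
qed

text \<open>On feasible histories the kernel is composed of \<open>source\<close> and the policy,
  elsewhere it is constant; the pieces are glued along the measurable set of feasible
  histories.\<close>

lemma step_kernel_measurable:
  assumes \<pi>: "\<pi> \<in> policies M"
  shows "step_kernel M \<pi> t \<in> histories t \<rightarrow>\<^sub>M prob_algebra XA"
proof -
  define H where "H = restrict_space (histories t) {h. \<forall>i<t. h i \<in> K}"
  note comp = history_component
  have compK: "(\<lambda>h. h i) \<in> H \<rightarrow>\<^sub>M feasible_space M" if "i < t" for i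
    unfolding H_def using that
    by (intro measurable_restrict_space2 measurable_restrict_space1 comp) (auto simp: space_restrict_space)
  have src: "source t \<in> H \<rightarrow>\<^sub>M prob_algebra X"
  proof (cases "t = 0")
    case True
    then have "source t = (\<lambda>_. initial M)" by (auto simp: source_def)
    then show ?thesis using initial_prob by simp
  next
    case False
    then have "(\<lambda>h. h (t - 1)) \<in> H \<rightarrow>\<^sub>M feasible_space M" by (intro compK) simp
    moreover have "transition M \<in> feasible_space M \<rightarrow>\<^sub>M prob_algebra X"
      using model by (simp add: control_model_def)
    moreover have "source t = (\<lambda>h. transition M (h (t - 1)))" using False by (auto simp: source_def)
    ultimately show ?thesis by (simp add: measurable_compose)
  qed
  \<comment> \<open>On \<open>H\<close> the identity is measurable into the product of feasible
    spaces, which is where the policy is given.\<close>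
  have incl: "(\<lambda>h. h) \<in> H \<rightarrow>\<^sub>M (\<Pi>\<^sub>M i\<in>{0..<t}. feasible_space M)"
  proof (rule measurable_PiM_single'[where f="\<lambda>i h. h i"])
    show "(\<lambda>\<omega> i. \<omega> i) \<in> space H \<rightarrow> (\<Pi>\<^sub>E i\<in>{0..<t}. space (feasible_space M))"
      by (auto simp: H_def histories_def space_restrict_space space_PiM PiE_iff)
  qed (use compK in auto)
  have "(\<lambda>z. (fst z, snd z)) \<in> H \<Otimes>\<^sub>M X \<rightarrow>\<^sub>M history_space M t"
    by (intro measurable_Pair measurable_compose[OF measurable_fst incl] measurable_snd)
  moreover have "\<pi> t \<in> history_space M t \<rightarrow>\<^sub>M prob_algebra A"
    using \<pi> by (simp add: policies_def)
  ultimately have pol: "(\<lambda>z. \<pi> t (fst z, snd z)) \<in> H \<Otimes>\<^sub>M X \<rightarrow>\<^sub>M prob_algebra A"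
    by (rule measurable_compose)
  have "(\<lambda>h. source t h \<bind> (\<lambda>x. \<pi> t (h, x) \<bind> (\<lambda>a. return XA (x, a)))) \<in> H \<rightarrow>\<^sub>M prob_algebra XA"
  proof (rule measurable_bind_prob_space2[OF src])
    show "(\<lambda>(h, x). \<pi> t (h, x) \<bind> (\<lambda>a. return XA (x, a))) \<in> H \<Otimes>\<^sub>M X \<rightarrow>\<^sub>M prob_algebra XA"
      unfolding split_beta'
    proof (rule measurable_bind_prob_space2[OF pol])
      have "(\<lambda>y. (snd (fst y), snd y)) \<in> (H \<Otimes>\<^sub>M X) \<Otimes>\<^sub>M A \<rightarrow>\<^sub>M XA" by measurable
      then show "(\<lambda>(z, a). return XA (snd z, a)) \<in> (H \<Otimes>\<^sub>M X) \<Otimes>\<^sub>M A \<rightarrow>\<^sub>M prob_algebra XA"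
        unfolding split_beta' by (rule measurable_compose[OF _ measurable_return_prob_space])
    qed
  qed
  \<comment> \<open>A feasible pair exists: \<open>initial M\<close> is a probability measure, so
    there is a state, and a selector supplies an action.\<close>
  moreover have "(SOME z. z \<in> K) \<in> space XA"
  proof -
    obtain s where "s \<in> X \<rightarrow>\<^sub>M A" and s: "\<And>x. x \<in> states M \<Longrightarrow> s x \<in> admissible M x"
      using obtain_selector by blast
    interpret prob_space "initial M" using initial_prob by (simp add: space_prob_algebra)
    have "space (initial M) = states M"
      using initial_prob sets_eq_imp_space_eq[of "initial M" X] by (auto simp: space_prob_algebra)
    then obtain x where "x \<in> states M" using not_empty by auto
    with s have "(x, s x) \<in> K" by simp
    then have "(SOME z. z \<in> K) \<in> K" by (rule someI[of "\<lambda>z. z \<in> K"])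
    then show ?thesis unfolding space_XA by (rule subsetD[OF K_sub])
  qed
  then have "return XA (SOME z. z \<in> K) \<in> space (prob_algebra XA)"
    by (rule measurable_space[OF measurable_return_prob_space])
  ultimately have "(\<lambda>h. if \<forall>i<t. h i \<in> K
      then source t h \<bind> (\<lambda>x. \<pi> t (h, x) \<bind> (\<lambda>a. return XA (x, a)))
      else return XA (SOME z. z \<in> K)) \<in> histories t \<rightarrow>\<^sub>M prob_algebra XA"
    unfolding H_def by (subst measurable_If_restrict_space_iff[OF histories_feasible]) (intro conjI measurable_const)
  also have "(\<lambda>h. if \<forall>i<t. h i \<in> K
      then source t h \<bind> (\<lambda>x. \<pi> t (h, x) \<bind> (\<lambda>a. return XA (x, a)))
      else return XA (SOME z. z \<in> K)) = step_kernel M \<pi> t"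
    by (rule ext) (simp only: step_kernel_def source_def)
  finally show ?thesis .
qed

lemma Ionescu_Tulcea_step:
  assumes "\<pi> \<in> policies M"
  shows "Ionescu_Tulcea (step_kernel M \<pi>) (\<lambda>_. XA)"
proof (rule Ionescu_Tulcea.intro)
  show "step_kernel M \<pi> i \<in> PiM {0..<i} (\<lambda>_. XA) \<rightarrow>\<^sub>M subprob_algebra XA" for i
    using measurable_prob_algebraD[OF step_kernel_measurable[OF assms]] by (simp add: histories_def)
  show "x \<in> space (PiM {0..<i} (\<lambda>_. XA)) \<Longrightarrow> prob_space (step_kernel M \<pi> i x)" for i x
    using measurable_space[OF step_kernel_measurable[OF assms]] by (simp add: histories_def space_prob_algebra)
qed

lemma step_kernel_integral:
  assumes \<pi>: "\<pi> \<in> policies M" and h: "h \<in> space (histories t)" "\<forall>i<t. h i \<in> K"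
    and f: "f \<in> borel_measurable XA"
  shows "(\<integral>\<^sup>+z. f z \<partial>step_kernel M \<pi> t h) = (\<integral>\<^sup>+x. \<integral>\<^sup>+a. f (x, a) \<partial>\<pi> t (h, x) \<partial>source t h)"
proof -
  note p = policy_kernel(1)[OF \<pi> h]
  have r: "(\<lambda>z. return XA z) \<in> XA \<rightarrow>\<^sub>M prob_algebra XA" by measurable
  have sp: "space (source t h) = states M"
    using source_in_prob[OF h] sets_eq_imp_space_eq[of "source t h" X] by (simp add: space_prob_algebra)
  have "(\<integral>\<^sup>+z. f z \<partial>step_kernel M \<pi> t h) =
      (\<integral>\<^sup>+x. \<integral>\<^sup>+z. f z \<partial>(\<pi> t (h, x) \<bind> (\<lambda>a. return XA (x, a))) \<partial>source t h)"
    unfolding step_kernel_feasible[OF h(2)]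
  proof (rule nn_integral_bind_prob[OF source_in_prob[OF h] _ f], rule measurable_bind_prob_space2[OF p])
    show "(\<lambda>(x, a). return XA (x, a)) \<in> X \<Otimes>\<^sub>M A \<rightarrow>\<^sub>M prob_algebra XA"
      using r by simp
  qed
  also have "\<dots> = (\<integral>\<^sup>+x. \<integral>\<^sup>+a. f (x, a) \<partial>\<pi> t (h, x) \<partial>source t h)"
  proof (rule nn_integral_cong)
    fix x assume "x \<in> space (source t h)"
    then have x: "x \<in> states M" using sp by simp
    then have px: "\<pi> t (h, x) \<in> space (prob_algebra A)" using measurable_space[OF p] by simp
    have ra: "(\<lambda>a. return XA (x, a)) \<in> A \<rightarrow>\<^sub>M prob_algebra XA"
      using x by (intro measurable_compose[OF measurable_Pair1' r]) simp
    have spx: "space (\<pi> t (h, x)) = actions M"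
      using px sets_eq_imp_space_eq[of "\<pi> t (h, x)" A] by (simp add: space_prob_algebra)
    have "(\<integral>\<^sup>+z. f z \<partial>(\<pi> t (h, x) \<bind> (\<lambda>a. return XA (x, a)))) =
        (\<integral>\<^sup>+a. \<integral>\<^sup>+z. f z \<partial>return XA (x, a) \<partial>\<pi> t (h, x))"
      by (rule nn_integral_bind_prob[OF px ra f])
    also have "\<dots> = (\<integral>\<^sup>+a. f (x, a) \<partial>\<pi> t (h, x))"
      by (intro nn_integral_cong nn_integral_return f) (use x spx in auto)
    finally show "(\<integral>\<^sup>+z. f z \<partial>(\<pi> t (h, x) \<bind> (\<lambda>a. return XA (x, a)))) = (\<integral>\<^sup>+a. f (x, a) \<partial>\<pi> t (h, x))" .
  qed
  finally show ?thesis .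
qed

lemma step_kernel_AE:
  assumes \<pi>: "\<pi> \<in> policies M" and h: "h \<in> space (histories t)" "\<forall>i<t. h i \<in> K"
  shows "AE z in step_kernel M \<pi> t h. z \<in> K"
proof -
  define N where "N = space XA - K"
  have N[measurable]: "N \<in> sets XA" unfolding N_def by measurable
  have s: "sets (step_kernel M \<pi> t h) = sets XA"
    using measurable_space[OF step_kernel_measurable[OF \<pi>] h(1)] by (simp add: space_prob_algebra)
  have sp: "space (source t h) = states M"
    using source_in_prob[OF h] sets_eq_imp_space_eq[of "source t h" X] by (simp add: space_prob_algebra)
  have "(\<integral>\<^sup>+z. indicator N z \<partial>step_kernel M \<pi> t h) =
      (\<integral>\<^sup>+x. \<integral>\<^sup>+a. indicator N (x, a) \<partial>\<pi> t (h, x) \<partial>source t h)"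
    by (rule step_kernel_integral[OF \<pi> h]) measurable
  also have "\<dots> = (\<integral>\<^sup>+x. 0 \<partial>source t h)"
  proof (rule nn_integral_cong)
    fix x assume "x \<in> space (source t h)"
    then have x: "x \<in> states M" using sp by simp
    interpret prob_space "\<pi> t (h, x)"
      using measurable_space[OF policy_kernel(1)[OF \<pi> h], of x] x by (simp add: space_prob_algebra)
    have "AE a in \<pi> t (h, x). a \<in> admissible M x"
      by (rule AE_prob_1) (simp add: measure_def policy_kernel(2)[OF \<pi> h x])
    then have "AE a in \<pi> t (h, x). (indicator N (x, a) :: ennreal) = 0"
      by eventually_elim (use x in \<open>auto simp: N_def\<close>)
    then show "(\<integral>\<^sup>+a. indicator N (x, a) \<partial>\<pi> t (h, x)) = 0"
      by (subst nn_integral_cong_AE) auto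
  qed
  finally have "emeasure (step_kernel M \<pi> t h) N = 0" using N s by simp
  then have "N \<in> null_sets (step_kernel M \<pi> t h)" using N s by (simp add: null_sets_def)
  from AE_not_in[OF this] AE_space show ?thesis
    by eventually_elim (use sets_eq_imp_space_eq[OF s] in \<open>simp add: N_def\<close>)
qed

text \<open>All that later arguments use of the canonical process. \<open>m t\<close> is the law of
  the pair at stage \<open>t\<close>; the clauses give its support, its initial marginal, its
  one-step evolution, the conditional action law under a stationary policy, and the occupation
  measure as the sum of all \<open>m t\<close>.\<close>

lemma policy_flow:
  assumes \<pi>: "\<pi> \<in> policies M"
  obtains m where
    "\<And>t. m t \<in> space (prob_algebra XA)" "\<And>t. AE z in m t. z \<in> K"
    "\<And>g. g \<in> borel_measurable X \<Longrightarrow> (\<integral>\<^sup>+z. g (fst z) \<partial>m 0) = (\<integral>\<^sup>+x. g x \<partial>initial M)"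
    "\<And>t g. g \<in> borel_measurable X \<Longrightarrow>
       (\<integral>\<^sup>+z. g (fst z) \<partial>m (Suc t)) = (\<integral>\<^sup>+z. \<integral>\<^sup>+y. g y \<partial>Q z \<partial>m t)"
    "\<And>\<phi> t f. \<pi> = stationary_policy \<phi> \<Longrightarrow> markov \<phi> \<Longrightarrow> f \<in> borel_measurable XA \<Longrightarrow>
       (\<integral>\<^sup>+z. f z \<partial>m t) = (\<integral>\<^sup>+z. \<integral>\<^sup>+a. f (fst z, a) \<partial>\<phi> (fst z) \<partial>m t)"
    "sets (occupation_measure M \<pi>) = sets XA"
    "\<And>f. f \<in> borel_measurable XA \<Longrightarrow> (\<integral>\<^sup>+z. f z \<partial>occupation_measure M \<pi>) = (\<Sum>t. \<integral>\<^sup>+z. f z \<partial>m t)"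
proof -
  interpret IT: Ionescu_Tulcea "step_kernel M \<pi>" "\<lambda>_. XA" by (rule Ionescu_Tulcea_step[OF \<pi>])
  define P where "P = policy_measure M \<pi>"
  have P: "P = IT.PF.lim" by (simp add: P_def policy_measure_def)
  have sets_P[measurable_cong]: "sets P = sets (PiM UNIV (\<lambda>_. XA))" unfolding P by (rule IT.PF.sets_lim)
  \<comment> \<open>The projection of the limit to the empty index set is a probability measure,
    hence so is the limit.\<close>
  interpret P: prob_space P
  proof (rule prob_space_distrD)
    show "(\<lambda>\<omega>. restrict \<omega> {}) \<in> P \<rightarrow>\<^sub>M PiM {} (\<lambda>_. XA)"
      unfolding measurable_cong_sets[OF sets_P refl] by (rule measurable_restrict_subset) simp_all
    show "prob_space (distr P (PiM {} (\<lambda>_. XA)) (\<lambda>\<omega>. restrict \<omega> {}))"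
      unfolding P IT.distr_lim[OF finite.emptyI] by (rule IT.PF.prob_space_P) simp_all
  qed
  \<comment> \<open>\<open>H n\<close> is the law of the first \<open>n\<close> pairs.\<close>
  define H where "H n = IT.C 0 n (\<lambda>_. undefined)" for n
  have und: "(\<lambda>_. undefined) \<in> space (PiM {0..<0::nat} (\<lambda>_. XA))" by (simp add: space_PiM)
  have sets_H: "sets (H n) = sets (histories n)" for n
    using IT.sets_C[OF und, of n] by (simp add: H_def histories_def)
  have space_H: "space (H n) = space (histories n)" for n
    by (rule sets_eq_imp_space_eq[OF sets_H])
  note comp = history_component
  have eP: "IT.eP n \<in> histories n \<rightarrow>\<^sub>M subprob_algebra (histories (Suc n))" for n
    using IT.measurable_eP[of n] by (simp add: histories_def)
  have eP_H: "IT.eP n \<in> H n \<rightarrow>\<^sub>M subprob_algebra (histories (Suc n))" for n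
    using eP by (simp add: measurable_cong_sets[OF sets_H refl])
  have H_Suc: "H (Suc n) = H n \<bind> IT.eP n" for n by (simp add: H_def)
  have up: "IT.up_to {0..<n} = n" for n
    using IT.up_to_iff[of "{0..<n}" n] IT.up_to_iff[of "{0..<n}" "IT.up_to {0..<n}"]
    by (cases n) (auto intro: antisym)
  have upd: "(\<lambda>z. h(n := z)) \<in> step_kernel M \<pi> n h \<rightarrow>\<^sub>M histories (Suc n)" if "h \<in> space (histories n)" for h n
    using that IT.sets_P[of h n] unfolding histories_def
    by (subst measurable_cong_sets[OF _ refl, of _ XA])
      (auto intro!: measurable_fun_upd[where J="{0..<n}"] simp: space_PiM PiE_iff)
  have int_H: "(\<integral>\<^sup>+h. F h \<partial>H (Suc n)) = (\<integral>\<^sup>+h. \<integral>\<^sup>+z. F (h(n := z)) \<partial>step_kernel M \<pi> n h \<partial>H n)"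
    if "F \<in> borel_measurable (histories (Suc n))" for F n
    unfolding H_Suc nn_integral_bind[OF that eP_H]
    using that by (intro nn_integral_cong IT.nn_integral_eP) (simp_all add: space_H histories_def)
  have feas: "Measurable.pred (histories n) (\<lambda>h. \<forall>i<n. h i \<in> K)" for n
    unfolding pred_def by (rule histories_feasible)
  \<comment> \<open>Almost sure feasibility comes first, since the integral formula for
    \<open>step_kernel\<close> is valid on feasible histories.\<close>
  have H_feas: "AE h in H n. \<forall>i<n. h i \<in> K" for n
  proof (induction n)
    case (Suc n)
    have "AE h in H n. AE h' in IT.eP n h. \<forall>i<Suc n. h' i \<in> K"
      using Suc AE_space
    proof eventually_elim
      case (elim h)
      then have h: "h \<in> space (histories n)" using space_H by simp
      have "AE z in step_kernel M \<pi> n h. \<forall>i<Suc n. (h(n := z)) i \<in> K"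
        using step_kernel_AE[OF \<pi> h elim(1)]
        by eventually_elim (use elim(1) in \<open>auto simp: less_Suc_eq\<close>)
      moreover have "{h' \<in> space (histories (Suc n)). \<forall>i<Suc n. h' i \<in> K} \<in> sets (histories (Suc n))"
        by (rule histories_feasible)
      ultimately show ?case
        unfolding IT.eP_def using upd[OF h]
        by (subst AE_distr_iff) (simp_all add: histories_def)
    qed
    then show ?case
      unfolding H_Suc by (subst AE_bind[OF eP_H feas])
  qed simp
  have int_P: "(\<integral>\<^sup>+\<omega>. f (\<omega> t) \<partial>P) = (\<integral>\<^sup>+h. \<integral>\<^sup>+z. f z \<partial>step_kernel M \<pi> t h \<partial>H t)"
    if f: "f \<in> borel_measurable XA" for f t
  proof -
    define F where "F h = f (h t)" for h
    have F: "F \<in> borel_measurable (histories (Suc t))"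
      unfolding F_def by (rule measurable_compose[OF comp f]) simp
    have res: "(\<lambda>\<omega>. restrict \<omega> {0..<Suc t}) \<in> P \<rightarrow>\<^sub>M histories (Suc t)"
      unfolding histories_def measurable_cong_sets[OF sets_P refl] by (rule measurable_restrict_subset) simp_all
    have resH: "(\<lambda>\<omega>. restrict \<omega> {0..<Suc t}) \<in> H (Suc t) \<rightarrow>\<^sub>M histories (Suc t)"
      unfolding measurable_cong_sets[OF sets_H refl] unfolding histories_def by (rule measurable_restrict_subset) simp_all
    have "(\<integral>\<^sup>+\<omega>. f (\<omega> t) \<partial>P) = (\<integral>\<^sup>+\<omega>. F (restrict \<omega> {0..<Suc t}) \<partial>P)"
      by (simp add: F_def)
    also have "\<dots> = (\<integral>\<^sup>+h. F h \<partial>distr P (histories (Suc t)) (\<lambda>\<omega>. restrict \<omega> {0..<Suc t}))"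
      by (rule nn_integral_distr[symmetric, OF res]) (use F in simp)
    also have "distr P (histories (Suc t)) (\<lambda>\<omega>. restrict \<omega> {0..<Suc t}) = IT.CI {0..<Suc t}"
      unfolding histories_def P by (rule IT.distr_lim) simp
    also have "\<dots> = distr (H (Suc t)) (histories (Suc t)) (\<lambda>\<omega>. restrict \<omega> {0..<Suc t})"
      unfolding IT.CI_def up by (simp add: H_def histories_def)
    also have "(\<integral>\<^sup>+h. F h \<partial>distr (H (Suc t)) (histories (Suc t)) (\<lambda>\<omega>. restrict \<omega> {0..<Suc t})) =
        (\<integral>\<^sup>+h. F (restrict h {0..<Suc t}) \<partial>H (Suc t))"
      by (rule nn_integral_distr[OF resH]) (use F in simp)
    also have "\<dots> = (\<integral>\<^sup>+h. F h \<partial>H (Suc t))" by (simp add: F_def)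
    also have "\<dots> = (\<integral>\<^sup>+h. \<integral>\<^sup>+z. f z \<partial>step_kernel M \<pi> t h \<partial>H t)"
      unfolding int_H[OF F] by (simp add: F_def)
    finally show ?thesis .
  qed
  define m where "m t = distr P XA (\<lambda>\<omega>. \<omega> t)" for t
  have compP: "(\<lambda>\<omega>. \<omega> t) \<in> P \<rightarrow>\<^sub>M XA" for t
    unfolding measurable_cong_sets[OF sets_P refl] by (rule measurable_component_singleton) simp
  have m: "m t \<in> space (prob_algebra XA)" for t
    unfolding m_def space_prob_algebra using P.prob_space_distr[OF compP] by simp
  have int_m: "(\<integral>\<^sup>+z. f z \<partial>m t) = (\<integral>\<^sup>+h. \<integral>\<^sup>+z. f z \<partial>step_kernel M \<pi> t h \<partial>H t)"
    if f: "f \<in> borel_measurable XA" for f t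
    unfolding m_def int_P[OF f, symmetric] by (rule nn_integral_distr[OF compP]) (use f in simp)
  have int_m': "(\<integral>\<^sup>+z. f z \<partial>m t) = (\<integral>\<^sup>+h. \<integral>\<^sup>+x. \<integral>\<^sup>+a. f (x, a) \<partial>\<pi> t (h, x) \<partial>source t h \<partial>H t)"
    if f: "f \<in> borel_measurable XA" for f t
    unfolding int_m[OF f]
  proof (rule nn_integral_cong_AE)
    show "AE h in H t. (\<integral>\<^sup>+z. f z \<partial>step_kernel M \<pi> t h) =
        (\<integral>\<^sup>+x. \<integral>\<^sup>+a. f (x, a) \<partial>\<pi> t (h, x) \<partial>source t h)"
      using H_feas AE_space
      by eventually_elim (auto simp: space_H intro!: step_kernel_integral[OF \<pi> _ _ f])
  qed
  have space_src: "space (source t h) = states M" if "h \<in> space (histories t)" "\<forall>i<t. h i \<in> K" for t h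
    using source_in_prob[OF that] sets_eq_imp_space_eq[of "source t h" X] by (simp add: space_prob_algebra)
  have int_fst: "(\<integral>\<^sup>+z. g (fst z) \<partial>m t) = (\<integral>\<^sup>+h. \<integral>\<^sup>+x. g x \<partial>source t h \<partial>H t)"
    if g: "g \<in> borel_measurable X" for g t
  proof -
    have "(\<integral>\<^sup>+z. g (fst z) \<partial>m t) = (\<integral>\<^sup>+h. \<integral>\<^sup>+x. \<integral>\<^sup>+a. g x \<partial>\<pi> t (h, x) \<partial>source t h \<partial>H t)"
      by (subst int_m') (auto intro: measurable_compose[OF measurable_fst g])
    also have "\<dots> = (\<integral>\<^sup>+h. \<integral>\<^sup>+x. g x \<partial>source t h \<partial>H t)"
    proof (rule nn_integral_cong_AE)
      show "AE h in H t. (\<integral>\<^sup>+x. \<integral>\<^sup>+a. g x \<partial>\<pi> t (h, x) \<partial>source t h) = (\<integral>\<^sup>+x. g x \<partial>source t h)"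
        using H_feas AE_space
      proof eventually_elim
        case (elim h)
        then have h: "h \<in> space (histories t)" using space_H by simp
        show ?case
        proof (rule nn_integral_cong)
          fix x assume "x \<in> space (source t h)"
          then have "x \<in> states M" using space_src[OF h elim(1)] by simp
          then have "prob_space (\<pi> t (h, x))"
            using measurable_space[OF policy_kernel(1)[OF \<pi> h elim(1)], of x] by (simp add: space_prob_algebra)
          then show "(\<integral>\<^sup>+a. g x \<partial>\<pi> t (h, x)) = g x"
            by (simp add: prob_space.emeasure_space_1)
        qed
      qed
    qed
    finally show ?thesis .
  qed
  show ?thesis
  proof (rule that[of m])
    show "m t \<in> space (prob_algebra XA)" for t by (rule m)
    show "AE z in m t. z \<in> K" for t
    proof -
      define N where "N = space XA - K"
      have N[measurable]: "N \<in> sets XA" unfolding N_def by measurable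
      have sm: "sets (m t) = sets XA" by (simp add: m_def)
      have "(\<integral>\<^sup>+z. indicator N z \<partial>m t) = (\<integral>\<^sup>+h. 0 \<partial>H t)"
        unfolding int_m[OF borel_measurable_indicator[OF N]]
      proof (rule nn_integral_cong_AE)
        show "AE h in H t. (\<integral>\<^sup>+z. indicator N z \<partial>step_kernel M \<pi> t h) = 0"
          using H_feas AE_space
        proof eventually_elim
          case (elim h)
          then have h: "h \<in> space (histories t)" using space_H by simp
          have "AE z in step_kernel M \<pi> t h. (indicator N z :: ennreal) = 0"
            using step_kernel_AE[OF \<pi> h elim(1)] by eventually_elim (auto simp: N_def)
          then show ?case by (subst nn_integral_cong_AE) auto
        qed
      qed
      then have "N \<in> null_sets (m t)" using N sm by (simp add: null_sets_def)
      from AE_not_in[OF this] AE_space show ?thesis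
        by eventually_elim (use sets_eq_imp_space_eq[OF sm] in \<open>simp add: N_def\<close>)
    qed
    show "(\<integral>\<^sup>+z. g (fst z) \<partial>m 0) = (\<integral>\<^sup>+x. g x \<partial>initial M)" if "g \<in> borel_measurable X" for g
    proof -
      have "emeasure (H 0) (space (H 0)) = 1"
        using prob_space.emeasure_space_1[OF IT.prob_space_C[OF und, of 0]] by (simp add: H_def)
      then show ?thesis by (simp add: int_fst[OF that] source_def)
    qed
    show "(\<integral>\<^sup>+z. g (fst z) \<partial>m (Suc t)) = (\<integral>\<^sup>+z. \<integral>\<^sup>+y. g y \<partial>Q z \<partial>m t)" if g: "g \<in> borel_measurable X" for g t
    proof -
      define F where "F z = (\<integral>\<^sup>+y. g y \<partial>Q z)" for z
      have F: "F \<in> borel_measurable XA" unfolding F_def by (rule Q_integral_measurable[OF g])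
      have "(\<integral>\<^sup>+z. g (fst z) \<partial>m (Suc t)) = (\<integral>\<^sup>+h. F (h t) \<partial>H (Suc t))"
        unfolding int_fst[OF g]
      proof (rule nn_integral_cong_AE)
        show "AE h in H (Suc t). (\<integral>\<^sup>+x. g x \<partial>source (Suc t) h) = F (h t)"
          using H_feas by eventually_elim (simp add: source_def F_def Q_def)
      qed
      also have "\<dots> = (\<integral>\<^sup>+z. F z \<partial>m t)"
        unfolding int_m[OF F] by (subst int_H) (auto intro: measurable_compose[OF comp F])
      finally show ?thesis by (simp add: F_def)
    qed
    show "(\<integral>\<^sup>+z. f z \<partial>m t) = (\<integral>\<^sup>+z. \<integral>\<^sup>+a. f (fst z, a) \<partial>\<phi> (fst z) \<partial>m t)"
      if "\<pi> = stationary_policy \<phi>" "markov \<phi>" and f: "f \<in> borel_measurable XA" for \<phi> t f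
      using that(1) by (simp add: int_m'[OF f] stationary_policy_def
          int_fst[OF nn_integral_prob_kernel_measurable[OF markovD[OF that(2)] f]])
    have ev: "emeasure P {\<omega> \<in> space P. \<omega> t \<in> \<Gamma>} = emeasure (m t) \<Gamma>" if "\<Gamma> \<in> sets XA" for t \<Gamma>
      unfolding m_def using that by (subst emeasure_distr[OF compP]) (auto intro!: arg_cong2[where f=emeasure])
    have occ_eq: "occupation_measure M \<pi> = sum_measure XA m"
      unfolding occupation_measure_def sum_measure_def P_def[symmetric]
    proof (rule measure_of_eq[OF sets.space_closed])
      fix \<Gamma> assume "\<Gamma> \<in> sigma_sets (space XA) (sets XA)"
      then have "\<Gamma> \<in> sets XA" by (simp only: sets.sigma_sets_eq)
      then show "(\<Sum>t. emeasure P {\<omega> \<in> space P. \<omega> t \<in> \<Gamma>}) = (\<Sum>t. emeasure (m t) \<Gamma>)"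
        by (simp add: ev)
    qed
    show "sets (occupation_measure M \<pi>) = sets XA" by (simp add: occ_eq)
    show "(\<integral>\<^sup>+z. f z \<partial>occupation_measure M \<pi>) = (\<Sum>t. \<integral>\<^sup>+z. f z \<partial>m t)" if "f \<in> borel_measurable XA" for f
      unfolding occ_eq by (rule nn_integral_sum_measure[OF _ that]) (simp add: m_def)
  qed
qed

text \<open>Initial marginal, one-step evolution and conditional action laws determine the state
  marginals, whatever process \<open>m\<close> comes from.\<close>

lemma law_of_flow:
  assumes k: "\<And>t. markov (k t)"
    and m0: "\<And>g. g \<in> borel_measurable X \<Longrightarrow> (\<integral>\<^sup>+z. g (fst z) \<partial>m 0) = (\<integral>\<^sup>+x. g x \<partial>initial M)"
    and mSuc: "\<And>t g. g \<in> borel_measurable X \<Longrightarrow>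
       (\<integral>\<^sup>+z. g (fst z) \<partial>m (Suc t)) = (\<integral>\<^sup>+z. \<integral>\<^sup>+y. g y \<partial>Q z \<partial>m t)"
    and mk: "\<And>t f. f \<in> borel_measurable XA \<Longrightarrow>
       (\<integral>\<^sup>+z. f z \<partial>m t) = (\<integral>\<^sup>+z. \<integral>\<^sup>+a. f (fst z, a) \<partial>k t (fst z) \<partial>m t)"
    and g: "g \<in> borel_measurable X"
  shows "(\<integral>\<^sup>+z. g (fst z) \<partial>m t) = (\<integral>\<^sup>+x. g x \<partial>law k t)"
  using g
proof (induction t arbitrary: g)
  case 0
  then show ?case by (simp add: m0)
next
  case (Suc t)
  have Qm: "(\<lambda>z. \<integral>\<^sup>+y. g y \<partial>Q z) \<in> borel_measurable XA" by (rule Q_integral_measurable[OF Suc.prems])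
  have "(\<integral>\<^sup>+z. g (fst z) \<partial>m (Suc t)) = (\<integral>\<^sup>+z. \<integral>\<^sup>+a. \<integral>\<^sup>+y. g y \<partial>Q (fst z, a) \<partial>k t (fst z) \<partial>m t)"
    unfolding mSuc[OF Suc.prems] by (rule mk[OF Qm])
  also have "\<dots> = (\<integral>\<^sup>+x. \<integral>\<^sup>+a. \<integral>\<^sup>+y. g y \<partial>Q (x, a) \<partial>k t x \<partial>law k t)"
    by (rule Suc.IH) (rule nn_integral_prob_kernel_measurable[OF markovD[OF k] Qm])
  finally show ?case unfolding nn_integral_law_Suc[OF k Suc.prems] .
qed

text \<open>\<open>k t\<close> is the conditional law of the action at stage \<open>t\<close> given
  the current state alone. Forgetting the past changes the law of the process but not the law of any
  single pair, and only the latter enters the occupation measure.\<close>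

lemma policy_markov:
  assumes \<pi>: "\<pi> \<in> policies M"
  obtains k where "\<And>t. markov (k t)" "sets (occupation_measure M \<pi>) = sets XA"
    "\<And>f. f \<in> borel_measurable XA \<Longrightarrow> (\<integral>\<^sup>+z. f z \<partial>occupation_measure M \<pi>) = occ k f"
proof -
  show thesis
  proof (rule policy_flow[OF \<pi>])
    fix m assume m: "\<And>t. m t \<in> space (prob_algebra XA)" "\<And>t. AE z in m t. z \<in> K"
    "\<And>g. g \<in> borel_measurable X \<Longrightarrow> (\<integral>\<^sup>+z. g (fst z) \<partial>m 0) = (\<integral>\<^sup>+x. g x \<partial>initial M)"
    "\<And>t g. g \<in> borel_measurable X \<Longrightarrow>
       (\<integral>\<^sup>+z. g (fst z) \<partial>m (Suc t)) = (\<integral>\<^sup>+z. \<integral>\<^sup>+y. g y \<partial>Q z \<partial>m t)"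
    "\<And>\<phi>' t f. \<pi> = stationary_policy \<phi>' \<Longrightarrow> markov \<phi>' \<Longrightarrow> f \<in> borel_measurable XA \<Longrightarrow>
       (\<integral>\<^sup>+z. f z \<partial>m t) = (\<integral>\<^sup>+z. \<integral>\<^sup>+a. f (fst z, a) \<partial>\<phi>' (fst z) \<partial>m t)"
    "sets (occupation_measure M \<pi>) = sets XA"
    "\<And>f. f \<in> borel_measurable XA \<Longrightarrow>
       (\<integral>\<^sup>+z. f z \<partial>occupation_measure M \<pi>) = (\<Sum>t. \<integral>\<^sup>+z. f z \<partial>m t)"
  have "\<exists>k. markov k \<and> (\<forall>f\<in>borel_measurable XA.
      (\<integral>\<^sup>+z. f z \<partial>m t) = (\<integral>\<^sup>+x. \<integral>\<^sup>+a. f (x, a) \<partial>k x \<partial>distr (m t) X fst))" for t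
    by (rule markov_disintegration[OF m(1,2)])
  then have "\<forall>t. \<exists>k. markov k \<and> (\<forall>f\<in>borel_measurable XA.
      (\<integral>\<^sup>+z. f z \<partial>m t) = (\<integral>\<^sup>+x. \<integral>\<^sup>+a. f (x, a) \<partial>k x \<partial>distr (m t) X fst))"
    by (rule allI)
  from choice[OF this] obtain k where kk: "\<forall>t. markov (k t) \<and> (\<forall>f\<in>borel_measurable XA.
      (\<integral>\<^sup>+z. f z \<partial>m t) = (\<integral>\<^sup>+x. \<integral>\<^sup>+a. f (x, a) \<partial>k t x \<partial>distr (m t) X fst))"
    by (elim exE)
  have k: "markov (k t)" for t
    using spec[OF kk, of t] by (rule conjunct1)
  have kf: "(\<integral>\<^sup>+z. f z \<partial>m t) = (\<integral>\<^sup>+x. \<integral>\<^sup>+a. f (x, a) \<partial>k t x \<partial>distr (m t) X fst)"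
    if "f \<in> borel_measurable XA" for t f
    using spec[OF kk, of t] that by (elim conjE bspec)
  have mk: "(\<integral>\<^sup>+z. f z \<partial>m t) = (\<integral>\<^sup>+z. \<integral>\<^sup>+a. f (fst z, a) \<partial>k t (fst z) \<partial>m t)"
    if f: "f \<in> borel_measurable XA" for t f
  proof -
    have fm: "fst \<in> m t \<rightarrow>\<^sub>M X" using m(1)[of t] by (simp add: space_prob_algebra cong: measurable_cong_sets)
    show ?thesis
      unfolding kf[OF f]
      by (rule nn_integral_distr[OF fm]) (simp add: nn_integral_prob_kernel_measurable[OF markovD[OF k] f])
  qed
  show thesis
  proof (rule that[of k, OF k m(6)])
    fix f :: "'x \<times> 'a \<Rightarrow> ennreal" assume f: "f \<in> borel_measurable XA"
    have "(\<integral>\<^sup>+z. f z \<partial>m t) = (\<integral>\<^sup>+x. \<integral>\<^sup>+a. f (x, a) \<partial>k t x \<partial>law k t)" for t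
      unfolding mk[OF f]
      by (rule law_of_flow[of k m, OF k m(3,4) mk nn_integral_prob_kernel_measurable[OF markovD[OF k] f]])
    then show "(\<integral>\<^sup>+z. f z \<partial>occupation_measure M \<pi>) = occ k f" by (simp add: m(7)[OF f] occ_def)
  qed
qed
qed

text \<open>The formula is needed for the given rule \<open>\<phi>\<close>, while disintegration
  would determine a rule only almost everywhere; hence the clause of \<open>policy_flow\<close> on
  stationary policies.\<close>

lemma stationary_markov:
  assumes \<phi>: "markov \<phi>"
  shows "stationary_policy \<phi> \<in> policies M"
    and "sets (occupation_measure M (stationary_policy \<phi>)) = sets XA"
    and "f \<in> borel_measurable XA \<Longrightarrow>
      (\<integral>\<^sup>+z. f z \<partial>occupation_measure M (stationary_policy \<phi>)) = occ (\<lambda>_. \<phi>) f"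
proof -
  have "(\<lambda>z. \<phi> (snd z)) \<in> history_space M t \<rightarrow>\<^sub>M prob_algebra A" for t
    by (rule measurable_compose[OF measurable_snd markovD[OF \<phi>]])
  moreover have "\<forall>(h, x)\<in>space (history_space M t). emeasure (\<phi> x) (admissible M x) = 1" for t
    using \<phi> by (auto simp: space_pair_measure markov_def)
  ultimately show pol: "stationary_policy \<phi> \<in> policies M"
    by (simp add: policies_def stationary_policy_def split_beta')
  have "sets (occupation_measure M (stationary_policy \<phi>)) = sets XA \<and> (\<forall>f\<in>borel_measurable XA.
      (\<integral>\<^sup>+z. f z \<partial>occupation_measure M (stationary_policy \<phi>)) = occ (\<lambda>_. \<phi>) f)"
  proof (rule policy_flow[OF pol], intro conjI ballI)
    fix m assume m: "\<And>t. m t \<in> space (prob_algebra XA)" "\<And>t. AE z in m t. z \<in> K"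
    "\<And>g. g \<in> borel_measurable X \<Longrightarrow> (\<integral>\<^sup>+z. g (fst z) \<partial>m 0) = (\<integral>\<^sup>+x. g x \<partial>initial M)"
    "\<And>t g. g \<in> borel_measurable X \<Longrightarrow>
       (\<integral>\<^sup>+z. g (fst z) \<partial>m (Suc t)) = (\<integral>\<^sup>+z. \<integral>\<^sup>+y. g y \<partial>Q z \<partial>m t)"
    "\<And>\<phi>' t f. stationary_policy \<phi> = stationary_policy \<phi>' \<Longrightarrow> markov \<phi>' \<Longrightarrow> f \<in> borel_measurable XA \<Longrightarrow>
       (\<integral>\<^sup>+z. f z \<partial>m t) = (\<integral>\<^sup>+z. \<integral>\<^sup>+a. f (fst z, a) \<partial>\<phi>' (fst z) \<partial>m t)"
    "sets (occupation_measure M (stationary_policy \<phi>)) = sets XA"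
    "\<And>f. f \<in> borel_measurable XA \<Longrightarrow>
       (\<integral>\<^sup>+z. f z \<partial>occupation_measure M (stationary_policy \<phi>)) = (\<Sum>t. \<integral>\<^sup>+z. f z \<partial>m t)"
  show "sets (occupation_measure M (stationary_policy \<phi>)) = sets XA" by (rule m(6))
  show "(\<integral>\<^sup>+z. f z \<partial>occupation_measure M (stationary_policy \<phi>)) = occ (\<lambda>_. \<phi>) f"
    if f: "f \<in> borel_measurable XA" for f
  proof -
    note mk = m(5)[OF refl \<phi>]
    have "(\<integral>\<^sup>+z. f z \<partial>m t) = (\<integral>\<^sup>+x. \<integral>\<^sup>+a. f (x, a) \<partial>\<phi> x \<partial>law (\<lambda>_. \<phi>) t)" for t
      unfolding mk[OF f]
      by (rule law_of_flow[of "\<lambda>_. \<phi>" m, OF \<phi> m(3,4) mk nn_integral_prob_kernel_measurable[OF markovD[OF \<phi>] f]])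
    then show ?thesis by (simp add: m(7)[OF f] occ_def)
  qed
qed
  then show "sets (occupation_measure M (stationary_policy \<phi>)) = sets XA"
    "f \<in> borel_measurable XA \<Longrightarrow>
      (\<integral>\<^sup>+z. f z \<partial>occupation_measure M (stationary_policy \<phi>)) = occ (\<lambda>_. \<phi>) f"
    by auto
qed

end

section \<open>Measures defined by pairs of kernels\<close>

text \<open>A mixture over the two-point counting measure.\<close>

lemma nn_integral_add_measure:
  assumes "sets N1 = sets S" "sets N2 = sets S" "sets N = sets S"
    and "\<And>B. B \<in> sets S \<Longrightarrow> emeasure N B = emeasure N1 B + emeasure N2 B"
    and "f \<in> borel_measurable S"
  shows "(\<integral>\<^sup>+z. f z \<partial>N) = (\<integral>\<^sup>+z. f z \<partial>N1) + (\<integral>\<^sup>+z. f z \<partial>N2)"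
  using nn_integral_mixture[of "count_space (UNIV :: bool set)" "\<lambda>b. if b then N1 else N2" S N f] assms
  by (simp add: nn_integral_count_space_finite UNIV_bool add.commute)

lemma emeasure_add_measure:
  assumes "sets N1 = sets S" "sets N2 = sets S" "B \<in> sets S"
  shows "emeasure (measure_of (space S) (sets S) (\<lambda>B. emeasure N1 B + emeasure N2 B)) B =
    emeasure N1 B + emeasure N2 B"
  using emeasure_mixture[of "count_space (UNIV :: bool set)" "\<lambda>b. if b then N1 else N2" S B] assms
  by (simp add: nn_integral_count_space_finite UNIV_bool add.commute)

text \<open>The factor \<open>c\<close> is \<infinity> for the first kernel of a pair and 1 for the
  second. With \<infinity> the result is in general not sigma-finite, so it is obtained as a
  mixture.\<close>

lemma ex_kernel_product:
  assumes \<phi>: "finite_kernel S T \<phi>" and p: "sets p = sets S"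
  shows "\<exists>N. sets N = sets (S \<Otimes>\<^sub>M T) \<and>
    (\<forall>G\<in>sets (S \<Otimes>\<^sub>M T). emeasure N G = (\<integral>\<^sup>+x. c * emeasure (\<phi> x) (Pair x -` G) \<partial>p)) \<and>
    (\<forall>f\<in>borel_measurable (S \<Otimes>\<^sub>M T). (\<integral>\<^sup>+z. f z \<partial>N) = (\<integral>\<^sup>+x. c * (\<integral>\<^sup>+a. f (x, a) \<partial>\<phi> x) \<partial>p))"
proof -
  note [measurable_cong] = p
  have spp: "space p = space S" using p by (rule sets_eq_imp_space_eq)
  define k where "k x = scale_measure c (distr (\<phi> x) (S \<Otimes>\<^sub>M T) (Pair x))" for x
  have Pm: "Pair x \<in> \<phi> x \<rightarrow>\<^sub>M S \<Otimes>\<^sub>M T" if "x \<in> space S" for x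
    using that by (simp add: measurable_cong_sets[OF finite_kernel_sets[OF \<phi> that] refl])
  have e: "emeasure (k x) G = c * emeasure (\<phi> x) (Pair x -` G)"
    if "x \<in> space S" "G \<in> sets (S \<Otimes>\<^sub>M T)" for x G
  proof -
    have "Pair x -` G \<inter> space (\<phi> x) = Pair x -` G"
      using sets.sets_into_space[OF that(2)] finite_kernel_space[OF \<phi> that(1)]
      by (auto simp: space_pair_measure)
    then show ?thesis using that by (simp add: k_def emeasure_distr Pm)
  qed
  have m: "(\<lambda>x. emeasure (k x) G) \<in> borel_measurable p" if G: "G \<in> sets (S \<Otimes>\<^sub>M T)" for G
  proof -
    have "(\<lambda>x. c * emeasure (\<phi> x) (Pair x -` G)) \<in> borel_measurable p"
      using finite_kernel_section[OF \<phi> G] by measurable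
    moreover have "(\<lambda>x. emeasure (k x) G) \<in> borel_measurable p \<longleftrightarrow>
        (\<lambda>x. c * emeasure (\<phi> x) (Pair x -` G)) \<in> borel_measurable p"
      by (rule measurable_cong) (use e[OF _ G] spp in simp)
    ultimately show ?thesis by simp
  qed
  have sk: "sets (k x) = sets (S \<Otimes>\<^sub>M T)" for x by (simp add: k_def)
  define N where "N = measure_of (space (S \<Otimes>\<^sub>M T)) (sets (S \<Otimes>\<^sub>M T)) (\<lambda>G. \<integral>\<^sup>+x. emeasure (k x) G \<partial>p)"
  have sN: "sets N = sets (S \<Otimes>\<^sub>M T)" by (simp add: N_def sets.sets_measure_of_eq)
  have eN: "emeasure N G = (\<integral>\<^sup>+x. emeasure (k x) G \<partial>p)" if "G \<in> sets (S \<Otimes>\<^sub>M T)" for G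
    unfolding N_def by (rule emeasure_mixture[OF sk m that])
  show ?thesis
  proof (intro exI[of _ N] conjI ballI sN)
    fix G assume G: "G \<in> sets (S \<Otimes>\<^sub>M T)"
    show "emeasure N G = (\<integral>\<^sup>+x. c * emeasure (\<phi> x) (Pair x -` G) \<partial>p)"
      unfolding eN[OF G] by (intro nn_integral_cong e G) (simp add: spp)
  next
    fix f :: "_ \<Rightarrow> ennreal" assume f: "f \<in> borel_measurable (S \<Otimes>\<^sub>M T)"
    have "(\<integral>\<^sup>+z. f z \<partial>N) = (\<integral>\<^sup>+x. \<integral>\<^sup>+z. f z \<partial>k x \<partial>p)"
      using nn_integral_mixture[OF sk m sN eN f] by blast
    also have "\<dots> = (\<integral>\<^sup>+x. c * (\<integral>\<^sup>+a. f (x, a) \<partial>\<phi> x) \<partial>p)"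
    proof (rule nn_integral_cong)
      fix x assume "x \<in> space p"
      then have x: "x \<in> space S" using spp by simp
      have "(\<integral>\<^sup>+z. f z \<partial>k x) = c * (\<integral>\<^sup>+z. f z \<partial>distr (\<phi> x) (S \<Otimes>\<^sub>M T) (Pair x))"
        unfolding k_def by (rule nn_integral_scale_measure) (use f in simp)
      also have "\<dots> = c * (\<integral>\<^sup>+a. f (x, a) \<partial>\<phi> x)"
        using f by (simp add: nn_integral_distr[OF Pm[OF x]])
      finally show "(\<integral>\<^sup>+z. f z \<partial>k x) = c * (\<integral>\<^sup>+a. f (x, a) \<partial>\<phi> x)" .
    qed
    finally show "(\<integral>\<^sup>+z. f z \<partial>N) = (\<integral>\<^sup>+x. c * (\<integral>\<^sup>+a. f (x, a) \<partial>\<phi> x) \<partial>p)" .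
  qed
qed

section \<open>Kernel pairs as functionals and the balance equation\<close>

context controlled_model
begin

lemma
  assumes \<kappa>: "finite_kernel X A \<kappa>" and \<phi>: "finite_kernel X A \<phi>" and p: "sets p = sets X"
  shows sets_kernel_pair_measure: "sets (kernel_pair_measure M p (\<kappa>, \<phi>)) = sets XA"
    and nn_integral_kernel_pair_measure: "f \<in> borel_measurable XA \<Longrightarrow>
      (\<integral>\<^sup>+z. f z \<partial>kernel_pair_measure M p (\<kappa>, \<phi>)) =
      (\<integral>\<^sup>+x. \<infinity> * (\<integral>\<^sup>+a. f (x, a) \<partial>\<kappa> x) + (\<integral>\<^sup>+a. f (x, a) \<partial>\<phi> x) \<partial>p)"
proof -
  obtain N1 where N1: "sets N1 = sets XA"
    "\<forall>G\<in>sets XA. emeasure N1 G = (\<integral>\<^sup>+x. \<infinity> * emeasure (\<kappa> x) (Pair x -` G) \<partial>p)"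
    "\<forall>f\<in>borel_measurable XA. (\<integral>\<^sup>+z. f z \<partial>N1) = (\<integral>\<^sup>+x. \<infinity> * (\<integral>\<^sup>+a. f (x, a) \<partial>\<kappa> x) \<partial>p)"
    using ex_kernel_product[OF \<kappa> p, of \<infinity>] by (elim exE conjE)
  obtain N2 where N2: "sets N2 = sets XA"
    "\<forall>G\<in>sets XA. emeasure N2 G = (\<integral>\<^sup>+x. 1 * emeasure (\<phi> x) (Pair x -` G) \<partial>p)"
    "\<forall>f\<in>borel_measurable XA. (\<integral>\<^sup>+z. f z \<partial>N2) = (\<integral>\<^sup>+x. 1 * (\<integral>\<^sup>+a. f (x, a) \<partial>\<phi> x) \<partial>p)"
    using ex_kernel_product[OF \<phi> p, of 1] by (elim exE conjE)
  have eq: "kernel_pair_measure M p (\<kappa>, \<phi>) =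
      measure_of (space XA) (sets XA) (\<lambda>B. emeasure N1 B + emeasure N2 B)"
    unfolding kernel_pair_measure_def prod.case
  proof (rule measure_of_eq[OF sets.space_closed])
    fix G assume "G \<in> sigma_sets (space XA) (sets XA)"
    then have "G \<in> sets XA" by (simp only: sets.sigma_sets_eq)
    then show "(\<integral>\<^sup>+x. \<infinity> * emeasure (\<kappa> x) (Pair x -` G) \<partial>p) + (\<integral>\<^sup>+x. emeasure (\<phi> x) (Pair x -` G) \<partial>p) =
        emeasure N1 G + emeasure N2 G"
      using N1(2) N2(2) by simp
  qed
  show s: "sets (kernel_pair_measure M p (\<kappa>, \<phi>)) = sets XA"
    unfolding eq by (rule sets.sets_measure_of_eq)
  show "(\<integral>\<^sup>+z. f z \<partial>kernel_pair_measure M p (\<kappa>, \<phi>)) =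
      (\<integral>\<^sup>+x. \<infinity> * (\<integral>\<^sup>+a. f (x, a) \<partial>\<kappa> x) + (\<integral>\<^sup>+a. f (x, a) \<partial>\<phi> x) \<partial>p)"
    if f: "f \<in> borel_measurable XA"
  proof -
    have "(\<integral>\<^sup>+z. f z \<partial>kernel_pair_measure M p (\<kappa>, \<phi>)) = (\<integral>\<^sup>+z. f z \<partial>N1) + (\<integral>\<^sup>+z. f z \<partial>N2)"
    proof (rule nn_integral_add_measure[OF N1(1) N2(1) s _ f])
      show "emeasure (kernel_pair_measure M p (\<kappa>, \<phi>)) B = emeasure N1 B + emeasure N2 B" if "B \<in> sets XA" for B
        unfolding eq by (rule emeasure_add_measure[OF N1(1) N2(1) that])
    qed
    also have "\<dots> = (\<integral>\<^sup>+x. \<infinity> * (\<integral>\<^sup>+a. f (x, a) \<partial>\<kappa> x) \<partial>p) + (\<integral>\<^sup>+x. (\<integral>\<^sup>+a. f (x, a) \<partial>\<phi> x) \<partial>p)"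
      using N1(3) N2(3) f by simp
    also have "\<dots> = (\<integral>\<^sup>+x. \<infinity> * (\<integral>\<^sup>+a. f (x, a) \<partial>\<kappa> x) + (\<integral>\<^sup>+a. f (x, a) \<partial>\<phi> x) \<partial>p)"
      by (intro nn_integral_add[symmetric])
        (use finite_kernel_nn_integral[OF \<kappa> f] finite_kernel_nn_integral[OF \<phi> f] p
          in \<open>simp_all cong: measurable_cong_sets add: borel_measurable_times_ennreal\<close>)
    finally show ?thesis .
  qed
qed

text \<open>Feasible variables without the requirement that the state marginal charges all of \<open>p\<close>.\<close>

definition balanced :: "'x measure \<Rightarrow> ('x, 'a) kernel_pair \<Rightarrow> bool" where
  "balanced p = (\<lambda>(\<kappa>, \<phi>).
     finite_kernel X A \<kappa> \<and> finite_kernel X A \<phi> \<and>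
     (\<forall>x\<in>states M. emeasure (\<kappa> x) (actions M - admissible M x) +
          emeasure (\<phi> x) (actions M - admissible M x) = 0) \<and>
     (\<forall>\<Lambda>\<in>sets X.
        emeasure (distr (kernel_pair_measure M p (\<kappa>, \<phi>)) X fst) \<Lambda> =
        emeasure (initial M) \<Lambda> +
          (\<integral>\<^sup>+z\<in>K. emeasure (transition M z) \<Lambda> \<partial>kernel_pair_measure M p (\<kappa>, \<phi>))))"

lemma feasible_variables_iff:
  "(\<kappa>, \<phi>) \<in> feasible_variables M p \<longleftrightarrow> balanced p (\<kappa>, \<phi>) \<and>
    (\<forall>x\<in>states M. emeasure (\<kappa> x) (actions M) + emeasure (\<phi> x) (actions M) > 0)"
  unfolding feasible_variables_def balanced_def by auto

text \<open>The functional form of a kernel pair measure, in which identities between pairs can be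
  checked state by state.\<close>

definition pair_integral :: "'x measure \<Rightarrow> ('x, 'a) kernel_pair \<Rightarrow> ('x \<times> 'a \<Rightarrow> ennreal) \<Rightarrow> ennreal" where
  "pair_integral p = (\<lambda>(\<kappa>, \<phi>) f.
     \<integral>\<^sup>+x. \<infinity> * (\<integral>\<^sup>+a. f (x, a) \<partial>\<kappa> x) + (\<integral>\<^sup>+a. f (x, a) \<partial>\<phi> x) \<partial>p)"

lemma nn_integral_pair:
  assumes "finite_kernel X A \<kappa>" "finite_kernel X A \<phi>" "sets p = sets X" "f \<in> borel_measurable XA"
  shows "(\<integral>\<^sup>+z. f z \<partial>kernel_pair_measure M p (\<kappa>, \<phi>)) = pair_integral p (\<kappa>, \<phi>) f"
  using nn_integral_kernel_pair_measure[OF assms] by (simp add: pair_integral_def)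

lemma emeasure_Q_measurable: "\<Lambda> \<in> sets X \<Longrightarrow> (\<lambda>z. emeasure (Q z) \<Lambda>) \<in> borel_measurable XA"
  by (rule finite_kernel_measurable[OF finite_kernel_prob[OF Q_measurable]])

lemma concentrated_AE:
  assumes \<phi>: "finite_kernel X A \<phi>" and x: "x \<in> states M"
    and 0: "emeasure (\<phi> x) (actions M - admissible M x) = 0"
  shows "AE a in \<phi> x. a \<in> admissible M x"
proof -
  have "actions M - admissible M x \<in> sets (\<phi> x)"
    using sets.Diff[OF sets.top admissible_sets[OF x]] finite_kernel_sets[OF \<phi>] x by simp
  then have "actions M - admissible M x \<in> null_sets (\<phi> x)" using 0 by (simp add: null_sets_def)
  from AE_not_in[OF this] AE_space show ?thesis
    by eventually_elim (use finite_kernel_space[OF \<phi>] x in auto)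
qed

lemma pair_integral_cong:
  assumes "finite_kernel X A \<kappa>" "finite_kernel X A \<phi>" "sets p = sets X"
    and c: "\<forall>x\<in>states M. emeasure (\<kappa> x) (actions M - admissible M x) +
          emeasure (\<phi> x) (actions M - admissible M x) = 0"
    and fg: "\<And>z. z \<in> K \<Longrightarrow> f z = g z"
  shows "pair_integral p (\<kappa>, \<phi>) f = pair_integral p (\<kappa>, \<phi>) g"
  unfolding pair_integral_def prod.case
proof (rule nn_integral_cong)
  fix x assume "x \<in> space p"
  then have x: "x \<in> states M" using sets_eq_imp_space_eq[OF assms(3)] by simp
  have "(\<integral>\<^sup>+a. f (x, a) \<partial>\<kappa> x) = (\<integral>\<^sup>+a. g (x, a) \<partial>\<kappa> x)"
    using concentrated_AE[OF assms(1) x] c x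
    by (intro nn_integral_cong_AE) (auto simp: fg elim!: eventually_mono)
  moreover have "(\<integral>\<^sup>+a. f (x, a) \<partial>\<phi> x) = (\<integral>\<^sup>+a. g (x, a) \<partial>\<phi> x)"
    using concentrated_AE[OF assms(2) x] c x
    by (intro nn_integral_cong_AE) (auto simp: fg elim!: eventually_mono)
  ultimately show "\<infinity> * (\<integral>\<^sup>+a. f (x, a) \<partial>\<kappa> x) + (\<integral>\<^sup>+a. f (x, a) \<partial>\<phi> x) =
      \<infinity> * (\<integral>\<^sup>+a. g (x, a) \<partial>\<kappa> x) + (\<integral>\<^sup>+a. g (x, a) \<partial>\<phi> x)" by simp
qed

text \<open>Both sides of the balance equation become values of one functional. The cut-off at
  \<open>K\<close> disappears because both kernels live on admissible actions.\<close>

lemma balanced_iff: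
  assumes p: "sets p = sets X"
  shows "balanced p (\<kappa>, \<phi>) \<longleftrightarrow> finite_kernel X A \<kappa> \<and> finite_kernel X A \<phi> \<and>
     (\<forall>x\<in>states M. emeasure (\<kappa> x) (actions M - admissible M x) +
          emeasure (\<phi> x) (actions M - admissible M x) = 0) \<and>
     (\<forall>\<Lambda>\<in>sets X. pair_integral p (\<kappa>, \<phi>) (\<lambda>z. indicator \<Lambda> (fst z)) =
        emeasure (initial M) \<Lambda> + pair_integral p (\<kappa>, \<phi>) (\<lambda>z. emeasure (Q z) \<Lambda>))"
proof -
  have "emeasure (distr (kernel_pair_measure M p (\<kappa>, \<phi>)) X fst) \<Lambda> = pair_integral p (\<kappa>, \<phi>) (\<lambda>z. indicator \<Lambda> (fst z))"
    "(\<integral>\<^sup>+z\<in>K. emeasure (transition M z) \<Lambda> \<partial>kernel_pair_measure M p (\<kappa>, \<phi>)) =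
      pair_integral p (\<kappa>, \<phi>) (\<lambda>z. emeasure (Q z) \<Lambda>)"
    if k: "finite_kernel X A \<kappa>" "finite_kernel X A \<phi>"
      and c: "\<forall>x\<in>states M. emeasure (\<kappa> x) (actions M - admissible M x) +
          emeasure (\<phi> x) (actions M - admissible M x) = 0"
      and \<Lambda>: "\<Lambda> \<in> sets X" for \<Lambda>
  proof -
    define \<eta> where "\<eta> = kernel_pair_measure M p (\<kappa>, \<phi>)"
    have s: "sets \<eta> = sets XA" unfolding \<eta>_def by (rule sets_kernel_pair_measure[OF k p])
    have fst: "fst \<in> \<eta> \<rightarrow>\<^sub>M X" unfolding measurable_cong_sets[OF s refl] by measurable
    have i: "(\<lambda>z. indicator \<Lambda> (fst z) :: ennreal) \<in> borel_measurable XA"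
      using \<Lambda> by measurable
    have "emeasure (distr \<eta> X fst) \<Lambda> = (\<integral>\<^sup>+x. indicator \<Lambda> x \<partial>distr \<eta> X fst)"
      using \<Lambda> by simp
    also have "\<dots> = (\<integral>\<^sup>+z. indicator \<Lambda> (fst z) \<partial>\<eta>)"
      by (rule nn_integral_distr[OF fst]) (use \<Lambda> in simp)
    finally show "emeasure (distr (kernel_pair_measure M p (\<kappa>, \<phi>)) X fst) \<Lambda> = pair_integral p (\<kappa>, \<phi>) (\<lambda>z. indicator \<Lambda> (fst z))"
      unfolding \<eta>_def nn_integral_pair[OF k p i] .
    have Qi: "(\<lambda>z. emeasure (Q z) \<Lambda> * indicator K z) \<in> borel_measurable XA"
      using emeasure_Q_measurable[OF \<Lambda>] by measurable
    have "(\<integral>\<^sup>+z\<in>K. emeasure (transition M z) \<Lambda> \<partial>\<eta>) = (\<integral>\<^sup>+z. emeasure (Q z) \<Lambda> * indicator K z \<partial>\<eta>)"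
      by (intro nn_integral_cong) (auto simp: Q_def indicator_def)
    also have "\<dots> = pair_integral p (\<kappa>, \<phi>) (\<lambda>z. emeasure (Q z) \<Lambda> * indicator K z)"
      unfolding \<eta>_def by (rule nn_integral_pair[OF k p Qi])
    also have "\<dots> = pair_integral p (\<kappa>, \<phi>) (\<lambda>z. emeasure (Q z) \<Lambda>)"
      by (rule pair_integral_cong[OF k p c]) simp
    finally show "(\<integral>\<^sup>+z\<in>K. emeasure (transition M z) \<Lambda> \<partial>kernel_pair_measure M p (\<kappa>, \<phi>)) =
      pair_integral p (\<kappa>, \<phi>) (\<lambda>z. emeasure (Q z) \<Lambda>)" unfolding \<eta>_def .
  qed
  then show ?thesis
    unfolding balanced_def prod.case by (intro conj_cong refl ball_cong) simp_all
qed

end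

section \<open>Densities with respect to the reference measure\<close>

locale reference_model = controlled_model M
  for M :: "('x::polish_space, 'a::polish_space) cmdm" +
  fixes \<xi> :: "nat \<Rightarrow> 'x \<Rightarrow> 'a" and p :: "'x measure"
  assumes compact: "\<And>x. x \<in> states M \<Longrightarrow> compact (admissible M x)"
    and continuous: "\<And>x \<Lambda>. x \<in> states M \<Longrightarrow> \<Lambda> \<in> sets (state_space M) \<Longrightarrow>
      continuous_on (admissible M x) (\<lambda>a. measure (transition M (x, a)) \<Lambda>)"
    and selectors: "\<And>k. k \<ge> 1 \<Longrightarrow> measurable_selector M (\<xi> k)"
    and dense: "\<And>x. x \<in> states M \<Longrightarrow> admissible M x = closure {\<xi> k x | k. k \<ge> 1}"
    and p_def: "p = reference_measure M \<xi>"
begin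

lemma \<xi>_measurable: "\<xi> (Suc k) \<in> X \<rightarrow>\<^sub>M A" and \<xi>_admissible: "x \<in> states M \<Longrightarrow> \<xi> (Suc k) x \<in> admissible M x"
  using selectors[of "Suc k"] by (auto simp: measurable_selector_def)

text \<open>The rule that draws \<open>\<xi> k\<close> with probability \<open>2^-k\<close>. Its
  transition kernel is \<open>mixed_kernel\<close>, so the measures mixed in \<open>p\<close> are
  the state laws of the stationary policy \<open>spread\<close>.\<close>

definition spread :: "'x \<Rightarrow> 'a measure" where
  "spread x = geometric_mixture A (\<lambda>k. return A (\<xi> (Suc k) x))"

lemma spread_prob: "x \<in> states M \<Longrightarrow> spread x \<in> space (prob_algebra A)"
  unfolding spread_def
  by (intro prob_space_geometric_mixture measurable_space[OF measurable_return_prob_space]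
    measurable_space[OF \<xi>_measurable]) simp

lemma emeasure_spread:
  "B \<in> sets A \<Longrightarrow> emeasure (spread x) B = (\<Sum>k. ennreal ((1 / 2) ^ Suc k) * indicator B (\<xi> (Suc k) x))"
  unfolding spread_def by (subst emeasure_geometric_mixture) simp_all

lemma markov_spread: "markov spread"
  unfolding markov_def
proof (intro conjI ballI)
  show "spread \<in> X \<rightarrow>\<^sub>M prob_algebra A"
  proof (rule measurable_prob_algebraI, goal_cases)
    case 2
    show ?case
    proof (rule measurable_subprob_algebra)
      fix B assume B: "B \<in> sets A"
      have "(\<lambda>x. indicator B (\<xi> (Suc k) x) :: ennreal) \<in> borel_measurable X" for k
        using measurable_compose[OF \<xi>_measurable borel_measurable_indicator[OF B]] .
      then show "(\<lambda>x. emeasure (spread x) B) \<in> borel_measurable X"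
        unfolding emeasure_spread[OF B] by measurable
    qed (use spread_prob prob_space_imp_subprob_space in \<open>auto simp: space_prob_algebra\<close>)
  qed (use spread_prob in \<open>auto simp: space_prob_algebra\<close>)
  fix x assume x: "x \<in> states M"
  show "emeasure (spread x) (admissible M x) = 1"
    unfolding emeasure_spread[OF admissible_sets[OF x]]
    using half_suminf \<xi>_admissible[OF x] by simp
qed

lemma nn_integral_spread:
  assumes x: "x \<in> states M" and f: "f \<in> borel_measurable A"
  shows "(\<integral>\<^sup>+a. f a \<partial>spread x) = (\<Sum>k. ennreal ((1 / 2) ^ Suc k) * f (\<xi> (Suc k) x))"
proof -
  have "(\<integral>\<^sup>+a. f a \<partial>spread x) =
      (\<Sum>k. \<integral>\<^sup>+a. f a \<partial>scale_measure (ennreal ((1 / 2) ^ Suc k)) (return A (\<xi> (Suc k) x)))"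
    unfolding spread_def geometric_mixture_eq_sum_measure
    by (rule nn_integral_sum_measure[OF _ f]) simp
  also have "\<dots> = (\<Sum>k. ennreal ((1 / 2) ^ Suc k) * f (\<xi> (Suc k) x))"
  proof (intro suminf_cong)
    fix k
    have "\<xi> (Suc k) x \<in> space A" using measurable_space[OF \<xi>_measurable] x by simp
    then show "(\<integral>\<^sup>+a. f a \<partial>scale_measure (ennreal ((1 / 2) ^ Suc k)) (return A (\<xi> (Suc k) x))) =
        ennreal ((1 / 2) ^ Suc k) * f (\<xi> (Suc k) x)"
      by (subst nn_integral_scale_measure) (use f in \<open>simp_all add: nn_integral_return\<close>)
  qed
  finally show ?thesis .
qed

lemma nxt_spread:
  assumes x: "x \<in> states M"
  shows "nxt spread x = mixed_kernel M \<xi> x"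
proof (rule measure_eqI)
  have Qx: "transition M (x, \<xi> (Suc k) x) = Q (x, \<xi> (Suc k) x)" for k
    using \<xi>_admissible[OF x] x by (simp add: Q_def)
  have sQ: "sets (Q (x, \<xi> (Suc k) x)) = sets X" for k
    using measurable_space[OF Q_measurable, of "(x, \<xi> (Suc k) x)"] x measurable_space[OF \<xi>_measurable, of x]
    by (simp add: space_prob_algebra)
  have sn: "sets (nxt spread x) = sets X"
    using measurable_space[OF nxt_measurable[OF markov_spread], of x] x by (simp add: space_prob_algebra)
  show "sets (nxt spread x) = sets (mixed_kernel M \<xi> x)"
    by (simp add: sn mixed_kernel_def geometric_mixture_eq_sum_measure)
  fix \<Lambda> assume "\<Lambda> \<in> sets (nxt spread x)"
  then have \<Lambda>: "\<Lambda> \<in> sets X" using sn by simp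
  have Qm: "(\<lambda>a. emeasure (Q (x, a)) \<Lambda>) \<in> borel_measurable A"
    using x by (intro measurable_Pair2[OF emeasure_Q_measurable[OF \<Lambda>]]) simp
  have sQ': "sets (Q (x, a)) = sets X" if "a \<in> space (spread x)" for a
    using measurable_space[OF Q_measurable, of "(x, a)"] x that markov_space[OF markov_spread x]
    by (simp add: space_prob_algebra)
  have "emeasure (nxt spread x) \<Lambda> = (\<integral>\<^sup>+y. indicator \<Lambda> y \<partial>nxt spread x)" using \<Lambda> sn by simp
  also have "\<dots> = (\<integral>\<^sup>+a. \<integral>\<^sup>+y. indicator \<Lambda> y \<partial>Q (x, a) \<partial>spread x)"
    by (rule nn_integral_nxt[OF markov_spread x]) (use \<Lambda> in simp)
  also have "\<dots> = (\<integral>\<^sup>+a. emeasure (Q (x, a)) \<Lambda> \<partial>spread x)"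
    by (intro nn_integral_cong nn_integral_indicator) (use sQ' \<Lambda> in simp)
  also have "\<dots> = (\<Sum>k. ennreal ((1 / 2) ^ Suc k) * emeasure (Q (x, \<xi> (Suc k) x)) \<Lambda>)"
    by (rule nn_integral_spread[OF x Qm])
  also have "\<dots> = emeasure (mixed_kernel M \<xi> x) \<Lambda>"
    unfolding mixed_kernel_def Qx by (rule emeasure_geometric_mixture[OF sQ \<Lambda>, symmetric])
  finally show "emeasure (nxt spread x) \<Lambda> = emeasure (mixed_kernel M \<xi> x) \<Lambda>" .
qed

lemma p_eq: "p = geometric_mixture X (law (\<lambda>_. spread))"
proof -
  have mix: "mixed_kernel M \<xi> \<in> X \<rightarrow>\<^sub>M prob_algebra X"
    using nxt_measurable[OF markov_spread] nxt_spread
    by (subst measurable_cong[where g="nxt spread"]) simp_all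
  have "((\<lambda>\<mu>. \<mu> \<bind> mixed_kernel M \<xi>) ^^ k) (initial M) = law (\<lambda>_. spread) k" for k
  proof (induction k)
    case (Suc k)
    have "law (\<lambda>_. spread) k \<bind> mixed_kernel M \<xi> = law (\<lambda>_. spread) k \<bind> nxt spread"
    proof (rule bind_cong_AE'[OF law_prob[OF markov_spread] mix nxt_measurable[OF markov_spread]])
      show "AE x in law (\<lambda>_. spread) k. mixed_kernel M \<xi> x = nxt spread x"
        by (rule AE_I2) (simp add: nxt_spread space_law[of "\<lambda>_. spread", OF markov_spread])
    qed
    then show ?case using Suc by simp
  qed simp
  then have "(\<lambda>k. ((\<lambda>\<mu>. \<mu> \<bind> mixed_kernel M \<xi>) ^^ k) (initial M)) = law (\<lambda>_. spread)" by (rule ext)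
  then show ?thesis unfolding p_def reference_measure_def by (simp only:)
qed

lemma sets_p: "sets p = sets X"
  by (simp add: p_eq geometric_mixture_eq_sum_measure)

lemma space_p: "space p = states M"
  using sets_eq_imp_space_eq[OF sets_p] by simp

lemma measurable_p: "borel_measurable p = borel_measurable X"
  by (rule measurable_cong_sets[OF sets_p refl])

lemma prob_space_p: "prob_space p"
  using prob_space_geometric_mixture[of "law (\<lambda>_. spread)" X, OF law_prob[OF markov_spread]]
  by (simp add: p_eq space_prob_algebra)

lemma null_p_iff:
  "\<Lambda> \<in> sets X \<Longrightarrow> emeasure p \<Lambda> = 0 \<longleftrightarrow> (\<forall>t. emeasure (law (\<lambda>_. spread) t) \<Lambda> = 0)"
  unfolding p_eq by (rule null_geometric_mixture[OF sets_law[OF markov_spread]])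

lemma law_emeasure_Suc:
  assumes k: "\<And>t. markov (k t)" and \<Lambda>: "\<Lambda> \<in> sets X"
  shows "emeasure (law k (Suc t)) \<Lambda> = (\<integral>\<^sup>+x. \<integral>\<^sup>+a. emeasure (Q (x, a)) \<Lambda> \<partial>k t x \<partial>law k t)"
proof -
  have "emeasure (law k (Suc t)) \<Lambda> = (\<integral>\<^sup>+y. indicator \<Lambda> y \<partial>law k (Suc t))"
    using \<Lambda> sets_law[of k, OF k, of "Suc t"] by (intro nn_integral_indicator[symmetric]) simp
  also have "\<dots> = (\<integral>\<^sup>+x. \<integral>\<^sup>+a. \<integral>\<^sup>+y. indicator \<Lambda> y \<partial>Q (x, a) \<partial>k t x \<partial>law k t)"
    by (rule nn_integral_law_Suc[OF k]) (use \<Lambda> in simp)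
  also have "\<dots> = (\<integral>\<^sup>+x. \<integral>\<^sup>+a. emeasure (Q (x, a)) \<Lambda> \<partial>k t x \<partial>law k t)"
  proof (intro nn_integral_cong nn_integral_indicator)
    fix x a assume "x \<in> space (law k t)" "a \<in> space (k t x)"
    then have "(x, a) \<in> space XA" using space_law[of k, OF k, of t] markov_space[OF k, of x t] by simp
    then show "\<Lambda> \<in> sets (Q (x, a))" using measurable_space[OF Q_measurable] \<Lambda> by (simp add: space_prob_algebra)
  qed
  finally show ?thesis .
qed

text \<open>Here continuity of the transition law and density of the selectors enter. The state laws
  of \<open>spread\<close> at all later stages vanish on a \<open>p\<close>-null set too, so from
  almost every state each selector reaches it with probability 0; continuity extends this to the
  closure, that is, to all admissible actions.\<close>

lemma null_transition:
  assumes \<Lambda>: "\<Lambda> \<in> sets X" and 0: "emeasure p \<Lambda> = 0"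
  shows "AE x in p. \<forall>a\<in>admissible M x. emeasure (Q (x, a)) \<Lambda> = 0"
proof -
  \<comment> \<open>The integral of \<open>g\<close> over one state law of \<open>spread\<close> is
    the mass that the next state law gives to \<open>\<Lambda>\<close>.\<close>
  define g where "g x = (\<integral>\<^sup>+a. emeasure (Q (x, a)) \<Lambda> \<partial>spread x)" for x
  have g: "g \<in> borel_measurable X"
    unfolding g_def by (rule nn_integral_prob_kernel_measurable[OF markovD[OF markov_spread] emeasure_Q_measurable[OF \<Lambda>]])
  define N where "N = {x \<in> space X. g x \<noteq> 0}"
  have N: "N \<in> sets X" unfolding N_def using g by measurable
  have "emeasure (law (\<lambda>_. spread) t) N = 0" for t
  proof -
    have "(\<integral>\<^sup>+x. g x \<partial>law (\<lambda>_. spread) t) = 0"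
      using law_emeasure_Suc[of "\<lambda>_. spread", OF markov_spread \<Lambda>, of t] null_p_iff[OF \<Lambda>] 0
      by (simp add: g_def del: law.simps)
    moreover have "g \<in> borel_measurable (law (\<lambda>_. spread) t)"
      using g by (simp add: measurable_cong_sets[OF sets_law[of "\<lambda>_. spread", OF markov_spread] refl])
    ultimately have "emeasure (law (\<lambda>_. spread) t) {x \<in> space (law (\<lambda>_. spread) t). g x \<noteq> 0} = 0"
      by (simp add: nn_integral_0_iff)
    then show ?thesis by (simp add: N_def space_law[of "\<lambda>_. spread", OF markov_spread])
  qed
  then have "emeasure p N = 0" using null_p_iff[OF N] by simp
  then have "N \<in> null_sets p" using N by (simp add: null_sets_def sets_p)
  from AE_not_in[OF this] AE_space show ?thesis
  proof eventually_elim
    case (elim x)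
    then have x: "x \<in> states M" and gx: "g x = 0" by (auto simp: N_def space_p)
    have Qm: "(\<lambda>a. emeasure (Q (x, a)) \<Lambda>) \<in> borel_measurable A"
      using x by (intro measurable_Pair2[OF emeasure_Q_measurable[OF \<Lambda>]]) simp
    have "ennreal ((1 / 2) ^ Suc k) * emeasure (Q (x, \<xi> (Suc k) x)) \<Lambda> = 0" for k
    proof -
      have "(\<Sum>k. ennreal ((1 / 2) ^ Suc k) * emeasure (Q (x, \<xi> (Suc k) x)) \<Lambda>) = 0"
        using gx unfolding g_def nn_integral_spread[OF x Qm] .
      then show ?thesis by (subst (asm) suminf_eq_zero_iff) (simp_all del: power_Suc)
    qed
    then have z: "emeasure (Q (x, \<xi> (Suc k) x)) \<Lambda> = 0" for k
      using ennreal_half_pos[of "Suc k"] by (simp del: power_Suc)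
    have m0: "measure (transition M (x, a)) \<Lambda> = 0" if "a \<in> {\<xi> k x |k. k \<ge> 1}" for a
    proof -
      from that obtain k where "a = \<xi> (Suc k) x" by (auto simp: Suc_le_eq dest: gr0_implies_Suc)
      then show ?thesis using z[of k] \<xi>_admissible[OF x, of k] x by (simp add: Q_def measure_def)
    qed
    show ?case
    proof
      fix a assume a: "a \<in> admissible M x"
      have "measure (transition M (x, a)) \<Lambda> = 0"
        using continuous_constant_on_closure[of "{\<xi> k x |k. k \<ge> 1}" "\<lambda>a. measure (transition M (x, a)) \<Lambda>" 0 a]
          continuous[OF x \<Lambda>] m0 a unfolding dense[OF x] by blast
      moreover have "prob_space (Q (x, a))"
        using measurable_space[OF Q_measurable, of "(x, a)"] x admissible_sub[OF x a] by (simp add: space_prob_algebra)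
      ultimately show "emeasure (Q (x, a)) \<Lambda> = 0"
        using a x by (simp add: finite_measure.emeasure_eq_measure prob_space.finite_measure Q_def)
    qed
  qed
qed

text \<open>Each stage preserves domination by \<open>p\<close>: from almost every state no
  admissible action leads into a given null set.\<close>

lemma law_absolutely_continuous:
  assumes k: "\<And>t. markov (k t)"
  shows "absolutely_continuous p (law k t)"
proof (induction t)
  case 0
  show ?case unfolding absolutely_continuous_def
  proof
    fix \<Lambda> assume "\<Lambda> \<in> null_sets p"
    then have "\<Lambda> \<in> sets X" "emeasure p \<Lambda> = 0" by (auto simp: null_sets_def sets_p)
    then show "\<Lambda> \<in> null_sets (law k 0)"
      using null_p_iff[of \<Lambda>] sets_law[of k, OF k, of 0] by (auto simp: null_sets_def dest: spec[of _ 0])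
  qed
next
  case (Suc t)
  show ?case unfolding absolutely_continuous_def
  proof
    fix \<Lambda> assume "\<Lambda> \<in> null_sets p"
    then have \<Lambda>: "\<Lambda> \<in> sets X" "emeasure p \<Lambda> = 0" by (auto simp: null_sets_def sets_p)
    have "AE x in law k t. \<forall>a\<in>admissible M x. emeasure (Q (x, a)) \<Lambda> = 0"
      using absolutely_continuous_AE[OF _ Suc null_transition[OF \<Lambda>]] sets_law[of k, OF k, of t] sets_p by simp
    then have "AE x in law k t. (\<integral>\<^sup>+a. emeasure (Q (x, a)) \<Lambda> \<partial>k t x) = 0"
      using AE_space
    proof eventually_elim
      case (elim x)
      then have x: "x \<in> states M" using space_law[of k, OF k] by simp
      have "AE a in k t x. emeasure (Q (x, a)) \<Lambda> = 0"
        using markov_AE[OF k x] by eventually_elim (use elim(1) in blast)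
      then have "(\<integral>\<^sup>+a. emeasure (Q (x, a)) \<Lambda> \<partial>k t x) = (\<integral>\<^sup>+a. 0 \<partial>k t x)"
        by (intro nn_integral_cong_AE)
      then show ?case by simp
    qed
    then have "(\<integral>\<^sup>+x. \<integral>\<^sup>+a. emeasure (Q (x, a)) \<Lambda> \<partial>k t x \<partial>law k t) = (\<integral>\<^sup>+x. 0 \<partial>law k t)"
      by (intro nn_integral_cong_AE)
    then have "emeasure (law k (Suc t)) \<Lambda> = 0" unfolding law_emeasure_Suc[OF k \<Lambda>(1)] by simp
    then show "\<Lambda> \<in> null_sets (law k (Suc t))"
      using \<Lambda>(1) sets_law[of k, OF k, of "Suc t"] by (simp add: null_sets_def)
  qed
qed

text \<open>A Radon-Nikodym derivative is finite only almost everywhere. A version finite at every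
  state is chosen so that finitely many stages contribute a finite action measure at each
  \<open>x\<close>.\<close>

definition dens :: "(nat \<Rightarrow> 'x \<Rightarrow> 'a measure) \<Rightarrow> nat \<Rightarrow> 'x \<Rightarrow> ennreal" where
  "dens k t x = (if RN_deriv p (law k t) x = \<infinity> then 0 else RN_deriv p (law k t) x)"

lemma dens_measurable: "dens k t \<in> borel_measurable X"
proof -
  have "RN_deriv p (law k t) \<in> borel_measurable X"
    using borel_measurable_RN_deriv[of p "law k t"] by (simp add: measurable_p)
  then show ?thesis unfolding dens_def[abs_def] by measurable
qed

lemma dens_finite: "dens k t x < \<infinity>"
  by (simp add: dens_def less_top)

lemma nn_integral_law:
  assumes k: "\<And>t. markov (k t)" and f: "f \<in> borel_measurable X"
  shows "(\<integral>\<^sup>+x. f x \<partial>law k t) = (\<integral>\<^sup>+x. dens k t x * f x \<partial>p)"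
proof -
  interpret p: prob_space p by (rule prob_space_p)
  interpret l: prob_space "law k t" using law_prob[of k, OF k, of t] by (simp add: space_prob_algebra)
  have s: "sets (law k t) = sets p" using sets_law[of k, OF k] sets_p by simp
  note ac = law_absolutely_continuous[of k, OF k, of t]
  have fin: "AE x in p. RN_deriv p (law k t) x \<noteq> \<infinity>"
    by (rule p.RN_deriv_finite[OF l.sigma_finite_measure_axioms ac s])
  have "(\<integral>\<^sup>+x. f x \<partial>law k t) = (\<integral>\<^sup>+x. RN_deriv p (law k t) x * f x \<partial>p)"
    using p.RN_deriv_nn_integral[OF ac s, of f] f by (simp add: measurable_p)
  also have "\<dots> = (\<integral>\<^sup>+x. dens k t x * f x \<partial>p)"
    using fin by (intro nn_integral_cong_AE) (auto simp: dens_def elim!: eventually_mono)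
  finally show ?thesis .
qed

text \<open>The density of the state marginal of the occupation measure; where it is infinite,
  actions will have to be frozen.\<close>

definition total_dens :: "(nat \<Rightarrow> 'x \<Rightarrow> 'a measure) \<Rightarrow> 'x \<Rightarrow> ennreal" where
  "total_dens k x = (\<Sum>t. dens k t x)"

lemma total_dens_measurable: "total_dens k \<in> borel_measurable X"
  unfolding total_dens_def[abs_def] using dens_measurable by measurable

text \<open>The action kernel of the occupation measure relative to \<open>p\<close>. At states of
  infinite \<open>total_dens\<close> it is an infinite measure, hence in general no finite
  kernel.\<close>

definition occ_kernel :: "(nat \<Rightarrow> 'x \<Rightarrow> 'a measure) \<Rightarrow> 'x \<Rightarrow> 'a measure" where
  "occ_kernel k x = sum_measure A (\<lambda>t. scale_measure (dens k t x) (k t x))"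

lemma nn_integral_occ_kernel:
  assumes k: "\<And>t. markov (k t)" and x: "x \<in> states M" and f: "f \<in> borel_measurable A"
  shows "(\<integral>\<^sup>+a. f a \<partial>occ_kernel k x) = (\<Sum>t. dens k t x * (\<integral>\<^sup>+a. f a \<partial>k t x))"
proof -
  have s: "sets (k t x) = sets A" for t by (rule markov_sets[OF k x])
  have "(\<integral>\<^sup>+a. f a \<partial>scale_measure (dens k t x) (k t x)) = dens k t x * (\<integral>\<^sup>+a. f a \<partial>k t x)" for t
    by (rule nn_integral_scale_measure) (use f s in \<open>simp cong: measurable_cong_sets\<close>)
  then show ?thesis
    unfolding occ_kernel_def by (subst nn_integral_sum_measure[OF _ f]) (simp_all add: s)
qed

lemma section_measurable:
  "f \<in> borel_measurable XA \<Longrightarrow> x \<in> states M \<Longrightarrow> (\<lambda>a. f (x, a)) \<in> borel_measurable A"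
  using measurable_Pair2[of f X A borel x] by simp

lemma occ_eq_dens:
  assumes k: "\<And>t. markov (k t)" and f: "f \<in> borel_measurable XA"
  shows "occ k f = (\<integral>\<^sup>+x. (\<Sum>t. dens k t x * (\<integral>\<^sup>+a. f (x, a) \<partial>k t x)) \<partial>p)"
proof -
  have m: "(\<lambda>x. \<integral>\<^sup>+a. f (x, a) \<partial>k t x) \<in> borel_measurable X" for t
    by (rule nn_integral_prob_kernel_measurable[OF markovD[OF k] f])
  have "occ k f = (\<Sum>t. \<integral>\<^sup>+x. dens k t x * (\<integral>\<^sup>+a. f (x, a) \<partial>k t x) \<partial>p)"
    unfolding occ_def nn_integral_law[OF k m] ..
  also have "\<dots> = (\<integral>\<^sup>+x. (\<Sum>t. dens k t x * (\<integral>\<^sup>+a. f (x, a) \<partial>k t x)) \<partial>p)"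
    using m dens_measurable by (intro nn_integral_suminf[symmetric]) (simp add: measurable_p)
  finally show ?thesis .
qed

lemma occ_kernel_integral:
  assumes k: "\<And>t. markov (k t)" and f: "f \<in> borel_measurable XA"
  shows "occ k f = (\<integral>\<^sup>+x. \<integral>\<^sup>+a. f (x, a) \<partial>occ_kernel k x \<partial>p)"
  unfolding occ_eq_dens[OF k f]
  by (intro nn_integral_cong nn_integral_occ_kernel[OF k, symmetric]) (auto simp: space_p section_measurable[OF f])

lemma occ_kernel_integral_measurable:
  assumes k: "\<And>t. markov (k t)" and f: "f \<in> borel_measurable XA"
  shows "(\<lambda>x. \<integral>\<^sup>+a. f (x, a) \<partial>occ_kernel k x) \<in> borel_measurable X"
proof -
  have "(\<lambda>x. \<Sum>t. dens k t x * (\<integral>\<^sup>+a. f (x, a) \<partial>k t x)) \<in> borel_measurable X"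
    using dens_measurable nn_integral_prob_kernel_measurable[OF markovD[OF k] f] by measurable
  moreover have "(\<lambda>x. \<integral>\<^sup>+a. f (x, a) \<partial>occ_kernel k x) \<in> borel_measurable X \<longleftrightarrow>
      (\<lambda>x. \<Sum>t. dens k t x * (\<integral>\<^sup>+a. f (x, a) \<partial>k t x)) \<in> borel_measurable X"
    by (rule measurable_cong) (simp add: nn_integral_occ_kernel[OF k _ section_measurable[OF f]])
  ultimately show ?thesis by simp
qed

lemma occ_state:
  assumes k: "\<And>t. markov (k t)" and g: "g \<in> borel_measurable X"
  shows "occ k (\<lambda>z. g (fst z)) = (\<Sum>t. \<integral>\<^sup>+x. g x \<partial>law k t)"
  unfolding occ_def
proof (intro suminf_cong nn_integral_cong)
  fix t x assume "x \<in> space (law k t)"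
  then have "x \<in> states M" using space_law[of k, OF k] by simp
  then show "(\<integral>\<^sup>+a. g (fst (x, a)) \<partial>k t x) = g x"
    using markov_total[OF k, of x t] markov_space[OF k, of x t] by simp
qed

text \<open>Stage 0 contributes the initial distribution, stage \<open>t + 1\<close> the transitions
  out of stage \<open>t\<close>. Both sides may be infinite.\<close>

lemma occ_balance:
  assumes k: "\<And>t. markov (k t)" and \<Lambda>: "\<Lambda> \<in> sets X"
  shows "occ k (\<lambda>z. indicator \<Lambda> (fst z)) = emeasure (initial M) \<Lambda> + occ k (\<lambda>z. emeasure (Q z) \<Lambda>)"
proof -
  have e: "(\<integral>\<^sup>+x. indicator \<Lambda> x \<partial>law k t) = emeasure (law k t) \<Lambda>" for t
    using \<Lambda> sets_law[of k, OF k, of t] by (intro nn_integral_indicator) simp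
  have "occ k (\<lambda>z. indicator \<Lambda> (fst z)) = (\<Sum>t. emeasure (law k t) \<Lambda>)"
    using \<Lambda> by (subst occ_state[OF k]) (simp_all add: e)
  also have "\<dots> = emeasure (law k 0) \<Lambda> + (\<Sum>t. emeasure (law k (Suc t)) \<Lambda>)"
    using suminf_offset[of "\<lambda>t. emeasure (law k t) \<Lambda>" 1] by (simp del: law.simps)
  also have "(\<Sum>t. emeasure (law k (Suc t)) \<Lambda>) = occ k (\<lambda>z. emeasure (Q z) \<Lambda>)"
    unfolding occ_def law_emeasure_Suc[OF k \<Lambda>] ..
  finally show ?thesis by simp
qed

end

section \<open>Induced policies\<close>

text \<open>Multiplication by \<infinity> forgets finite positive factors, so it cannot tell a
  kernel from its normalisation.\<close>

lemma ennreal_inf_mult_scale: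
  fixes a b :: ennreal
  assumes "a \<noteq> 0" "a < \<infinity>"
  shows "\<infinity> * (a * b) = \<infinity> * b"
  using assms by (cases "b = 0") (auto simp: ennreal_mult_eq_top_iff ennreal_top_mult)

section \<open>Kernel pairs of Markov policies and the surplus of a feasible variable\<close>

context reference_model
begin

lemma markov_null: "markov k \<Longrightarrow> x \<in> states M \<Longrightarrow> emeasure (k x) (actions M - admissible M x) = 0"
  using markov_total[of k x] admissible_sets[of x] admissible_sub[of x] markov_sets[of k x] sets.top[of A]
  by (subst emeasure_Diff) (auto simp: markov_def)

lemma markov_measurable: "markov k \<Longrightarrow> B \<in> sets A \<Longrightarrow> (\<lambda>x. emeasure (k x) B) \<in> borel_measurable X"
  by (rule finite_kernel_measurable[OF finite_kernel_prob[OF markovD]])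

text \<open>Where the total density is finite, the whole occupation kernel goes into
  \<open>\<phi>\<close>. Where it is infinite, only the first \<open>T\<close> stages do; the later
  ones all use the law \<open>k T x\<close>, and their densities still sum to \<infinity>, so
  together they are \<infinity> times \<open>k T x\<close>.\<close>

lemma markov_pair:
  assumes k: "\<And>t. markov (k t)"
    and C: "AE x in p. total_dens k x < \<infinity> \<or> (\<forall>t\<ge>T. k t x = k T x)"
  obtains \<kappa> \<phi> where "balanced p (\<kappa>, \<phi>)"
    "\<And>f. f \<in> borel_measurable XA \<Longrightarrow> pair_integral p (\<kappa>, \<phi>) f = occ k f"
    "\<And>x. x \<in> states M \<Longrightarrow> total_dens k x > 0 \<Longrightarrow>
      emeasure (\<kappa> x) (actions M) + emeasure (\<phi> x) (actions M) > 0"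
proof -
  define c where "c t x = (if total_dens k x = \<infinity> \<and> T \<le> t then 0 else dens k t x)" for t x
  define \<kappa> where "\<kappa> x = (if total_dens k x = \<infinity> then k T x else null_measure A)" for x
  define \<phi> where "\<phi> x = sum_measure A (\<lambda>t. scale_measure (c t x) (k t x))" for x
  have act: "actions M \<in> sets A" using sets.top[of A] by simp
  have c_measurable: "c t \<in> borel_measurable X" for t
    unfolding c_def[abs_def] using total_dens_measurable[of k] dens_measurable[of k t] by measurable
  have ks: "sets (k t x) = sets A" if "x \<in> states M" for t x by (rule markov_sets[OF k that])
  have \<phi>_em: "emeasure (\<phi> x) B = (\<Sum>t. c t x * emeasure (k t x) B)" if "x \<in> states M" "B \<in> sets A" for x B
    unfolding \<phi>_def using that ks[OF that(1)] by (subst emeasure_sum_measure) simp_all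
  have \<phi>_int: "(\<integral>\<^sup>+a. f a \<partial>\<phi> x) = (\<Sum>t. c t x * (\<integral>\<^sup>+a. f a \<partial>k t x))"
    if x: "x \<in> states M" and f: "f \<in> borel_measurable A" for x f
  proof -
    have "(\<integral>\<^sup>+a. f a \<partial>scale_measure (c t x) (k t x)) = c t x * (\<integral>\<^sup>+a. f a \<partial>k t x)" for t
      by (rule nn_integral_scale_measure) (use f ks[OF x] in \<open>simp cong: measurable_cong_sets\<close>)
    then show ?thesis
      unfolding \<phi>_def by (subst nn_integral_sum_measure[OF _ f]) (simp_all add: ks[OF x])
  qed
  have c_sum: "(\<Sum>t. c t x) < \<infinity>" for x
  proof (cases "total_dens k x = \<infinity>")
    case True
    then have "(\<Sum>t. c t x) = (\<Sum>t<T. c t x)"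
      by (intro suminf_finite) (auto simp: c_def)
    also have "\<dots> < \<infinity>" using dens_finite[of k] by (auto simp: c_def less_top[symmetric])
    finally show ?thesis .
  next
    case False
    then have "c t x = dens k t x" for t by (simp add: c_def)
    then have "(\<Sum>t. c t x) = total_dens k x" by (simp add: total_dens_def)
    then show ?thesis using False by (simp add: less_top)
  qed
  have \<phi>_total: "emeasure (\<phi> x) (actions M) = (\<Sum>t. c t x)" if "x \<in> states M" for x
    using \<phi>_em[OF that act] markov_total[OF k that] by simp
  have \<kappa>_kernel: "finite_kernel X A \<kappa>"
    unfolding finite_kernel_def
  proof (intro conjI ballI)
    fix x assume "x \<in> space X"
    then have x: "x \<in> states M" by simp
    show "sets (\<kappa> x) = sets A" by (simp add: \<kappa>_def ks[OF x])
    show "finite_measure (\<kappa> x)"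
      by (rule finite_measureI)
        (use markov_total[OF k x, of T] markov_space[OF k x, of T] in \<open>simp add: \<kappa>_def\<close>)
  next
    fix B assume B: "B \<in> sets A"
    have "(\<lambda>x. emeasure (\<kappa> x) B) = (\<lambda>x. if total_dens k x = \<infinity> then emeasure (k T x) B else 0)"
      by (auto simp: \<kappa>_def)
    also have "\<dots> \<in> borel_measurable X"
      using total_dens_measurable[of k] markov_measurable[OF k B, of T] by measurable
    finally show "(\<lambda>x. emeasure (\<kappa> x) B) \<in> borel_measurable X" .
  qed
  have \<phi>_kernel: "finite_kernel X A \<phi>"
    unfolding finite_kernel_def
  proof (intro conjI ballI)
    fix x assume "x \<in> space X"
    then have x: "x \<in> states M" by simp
    show "sets (\<phi> x) = sets A" by (simp add: \<phi>_def)
    show "finite_measure (\<phi> x)"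
      by (rule finite_measureI) (use \<phi>_total[OF x] c_sum[of x] in \<open>simp add: \<phi>_def\<close>)
  next
    fix B assume B: "B \<in> sets A"
    have "(\<lambda>x. \<Sum>t. c t x * emeasure (k t x) B) \<in> borel_measurable X"
      using c_measurable markov_measurable[OF k B] by measurable
    moreover have "(\<lambda>x. emeasure (\<phi> x) B) \<in> borel_measurable X \<longleftrightarrow>
        (\<lambda>x. \<Sum>t. c t x * emeasure (k t x) B) \<in> borel_measurable X"
      by (rule measurable_cong) (simp add: \<phi>_em B)
    ultimately show "(\<lambda>x. emeasure (\<phi> x) B) \<in> borel_measurable X" by simp
  qed
  have conc: "\<forall>x\<in>states M. emeasure (\<kappa> x) (actions M - admissible M x) +
          emeasure (\<phi> x) (actions M - admissible M x) = 0"
  proof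
    fix x assume x: "x \<in> states M"
    have "actions M - admissible M x \<in> sets A" using act admissible_sets[OF x] by auto
    then show "emeasure (\<kappa> x) (actions M - admissible M x) + emeasure (\<phi> x) (actions M - admissible M x) = 0"
      by (simp add: \<phi>_em[OF x] \<kappa>_def markov_null[OF k x])
  qed
  have int: "pair_integral p (\<kappa>, \<phi>) f = occ k f" if f: "f \<in> borel_measurable XA" for f
    unfolding pair_integral_def prod.case occ_eq_dens[OF k f]
  proof (rule nn_integral_cong_AE)
    show "AE x in p. \<infinity> * (\<integral>\<^sup>+a. f (x, a) \<partial>\<kappa> x) + (\<integral>\<^sup>+a. f (x, a) \<partial>\<phi> x) =
        (\<Sum>t. dens k t x * (\<integral>\<^sup>+a. f (x, a) \<partial>k t x))"
      using C AE_space
    proof eventually_elim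
      case (elim x)
      then have x: "x \<in> states M" by (simp add: space_p)
      define I where "I t = (\<integral>\<^sup>+a. f (x, a) \<partial>k t x)" for t
      have \<phi>I: "(\<integral>\<^sup>+a. f (x, a) \<partial>\<phi> x) = (\<Sum>t. c t x * I t)"
        unfolding I_def by (rule \<phi>_int[OF x section_measurable[OF f x]])
      show ?case
      proof (cases "total_dens k x = \<infinity>")
        case False
        then have "c t x = dens k t x" for t by (simp add: c_def)
        moreover have "(\<integral>\<^sup>+a. f (x, a) \<partial>\<kappa> x) = 0"
          using False by (simp add: \<kappa>_def)
        ultimately show ?thesis unfolding \<phi>I I_def[symmetric] by simp
      next
        case True
        then have "\<not> total_dens k x < \<infinity>" by simp
        with elim(1) have kT: "k t x = k T x" if "T \<le> t" for t using that by blast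
        \<comment> \<open>Removing finitely many finite densities leaves an infinite tail.\<close>
        have "total_dens k x = (\<Sum>t. dens k (t + T) x) + (\<Sum>t<T. dens k t x)"
          unfolding total_dens_def by (rule suminf_offset) simp
        moreover have "(\<Sum>t<T. dens k t x) < \<infinity>" using dens_finite[of k] by (simp add: less_top[symmetric])
        ultimately have tail: "(\<Sum>t. dens k (t + T) x) = \<infinity>"
          unfolding True by (metis ennreal_add_eq_top infinity_ennreal_def less_irrefl)
        have "(\<Sum>t. dens k t x * I t) = (\<Sum>t. dens k (t + T) x * I (t + T)) + (\<Sum>t<T. dens k t x * I t)"
          by (rule suminf_offset) simp
        also have "(\<Sum>t. dens k (t + T) x * I (t + T)) = (\<Sum>t. dens k (t + T) x * I T)"
          unfolding I_def by (subst kT[OF le_add2]) (rule refl)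
        also have "\<dots> = \<infinity> * I T" by (simp add: tail)
        also have "(\<Sum>t<T. dens k t x * I t) = (\<Sum>t. c t x * I t)"
          using True by (subst suminf_finite[of "{..<T}"]) (auto simp: c_def simp del: not_less)
        finally show ?thesis unfolding \<phi>I using True by (simp add: \<kappa>_def I_def)
      qed
    qed
  qed
  show thesis
  proof (rule that[of \<kappa> \<phi>])
    show "balanced p (\<kappa>, \<phi>)"
      unfolding balanced_iff[OF sets_p]
    proof (intro conjI \<kappa>_kernel \<phi>_kernel conc ballI)
      fix \<Lambda> assume \<Lambda>: "\<Lambda> \<in> sets X"
      have "(\<lambda>z. indicator \<Lambda> (fst z) :: ennreal) \<in> borel_measurable XA" using \<Lambda> by measurable
      then show "pair_integral p (\<kappa>, \<phi>) (\<lambda>z. indicator \<Lambda> (fst z)) =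
          emeasure (initial M) \<Lambda> + pair_integral p (\<kappa>, \<phi>) (\<lambda>z. emeasure (Q z) \<Lambda>)"
        by (simp add: int emeasure_Q_measurable[OF \<Lambda>] occ_balance[OF k \<Lambda>])
    qed
    show "pair_integral p (\<kappa>, \<phi>) f = occ k f" if "f \<in> borel_measurable XA" for f by (rule int[OF that])
    show "emeasure (\<kappa> x) (actions M) + emeasure (\<phi> x) (actions M) > 0"
      if x: "x \<in> states M" and pos: "total_dens k x > 0" for x
    proof (cases "total_dens k x = \<infinity>")
      case True
      then show ?thesis using markov_total[OF k x, of T] by (simp add: \<kappa>_def add_pos_nonneg)
    next
      case False
      then have "emeasure (\<phi> x) (actions M) = total_dens k x"
        by (simp add: \<phi>_total[OF x] c_def total_dens_def)
      then show ?thesis using pos by (simp add: add_nonneg_pos)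
    qed
  qed
qed

definition induced :: "('x, 'a) kernel_pair \<Rightarrow> 'x \<Rightarrow> 'a measure" where
  "induced = (\<lambda>(\<kappa>, \<phi>) x. if emeasure (\<kappa> x) (space (\<kappa> x)) \<noteq> 0 then normalized (\<kappa> x) else normalized (\<phi> x))"

lemma induced_policy_eq: "induced_policy \<Phi> = stationary_policy (induced \<Phi>)"
  by (simp add: induced_policy_def induced_def split_beta')

lemma feasible_pair:
  assumes "(\<kappa>, \<phi>) \<in> feasible_variables M p"
  shows "finite_kernel X A \<kappa>" "finite_kernel X A \<phi>"
    "\<forall>x\<in>states M. emeasure (\<kappa> x) (actions M - admissible M x) + emeasure (\<phi> x) (actions M - admissible M x) = 0"
    "\<And>\<Lambda>. \<Lambda> \<in> sets X \<Longrightarrow> pair_integral p (\<kappa>, \<phi>) (\<lambda>z. indicator \<Lambda> (fst z)) =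
        emeasure (initial M) \<Lambda> + pair_integral p (\<kappa>, \<phi>) (\<lambda>z. emeasure (Q z) \<Lambda>)"
    "\<And>x. x \<in> states M \<Longrightarrow> emeasure (\<kappa> x) (actions M) + emeasure (\<phi> x) (actions M) > 0"
  using assms unfolding feasible_variables_iff balanced_iff[OF sets_p] by blast+

lemma markov_induced:
  assumes F: "(\<kappa>, \<phi>) \<in> feasible_variables M p"
  shows "markov (induced (\<kappa>, \<phi>))"
proof -
  note fp = feasible_pair[OF F]
  have act: "actions M \<in> sets A" using sets.top[of A] by simp
  \<comment> \<open>The kernel that gets normalised; the positivity condition makes its mass
    nonzero.\<close>
  define \<mu> where "\<mu> x = (if emeasure (\<kappa> x) (actions M) \<noteq> 0 then \<kappa> x else \<phi> x)" for x
  have ind: "induced (\<kappa>, \<phi>) x = normalized (\<mu> x)" if "x \<in> states M" for x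
    using finite_kernel_space[OF fp(1), of x] that by (simp add: induced_def \<mu>_def)
  have s: "sets (\<mu> x) = sets A" "space (\<mu> x) = actions M" if "x \<in> states M" for x
    using that finite_kernel_sets[OF fp(1), of x] finite_kernel_sets[OF fp(2), of x]
      finite_kernel_space[OF fp(1), of x] finite_kernel_space[OF fp(2), of x] by (simp_all add: \<mu>_def)
  have pos: "emeasure (\<mu> x) (actions M) \<noteq> 0" and fin: "emeasure (\<mu> x) (actions M) \<noteq> \<infinity>"
    and null: "emeasure (\<mu> x) (actions M - admissible M x) = 0" if "x \<in> states M" for x
    using fp(5)[OF that] finite_kernel_finite[OF fp(1), of x] finite_kernel_finite[OF fp(2), of x] fp(3) that
    by (auto simp: \<mu>_def less_top)
  have em: "emeasure (induced (\<kappa>, \<phi>) x) B = inverse (emeasure (\<mu> x) (actions M)) * emeasure (\<mu> x) B"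
    if "x \<in> states M" "B \<in> sets A" for x B
    using that s[OF that(1)] by (simp add: ind normalized_def)
  have one: "emeasure (induced (\<kappa>, \<phi>) x) (actions M) = 1" if "x \<in> states M" for x
    using pos[OF that] fin[OF that] em[OF that act] ennreal_divide_self[of "emeasure (\<mu> x) (actions M)"]
    by (simp add: divide_ennreal_def mult.commute less_top)
  have sets: "sets (induced (\<kappa>, \<phi>) x) = sets A" if "x \<in> states M" for x
    using s[OF that] by (simp add: ind[OF that] normalized_def)
  have prob: "prob_space (induced (\<kappa>, \<phi>) x)" if "x \<in> states M" for x
    using one[OF that] sets_eq_imp_space_eq[OF sets[OF that]] by (intro prob_spaceI) simp
  have \<mu>_meas: "(\<lambda>x. emeasure (\<mu> x) B) \<in> borel_measurable X" if "B \<in> sets A" for B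
  proof -
    have "(\<lambda>x. emeasure (\<mu> x) B) = (\<lambda>x. if emeasure (\<kappa> x) (actions M) \<noteq> 0 then emeasure (\<kappa> x) B else emeasure (\<phi> x) B)"
      by (auto simp: \<mu>_def)
    also have "\<dots> \<in> borel_measurable X"
      using finite_kernel_measurable[OF fp(1) act] finite_kernel_measurable[OF fp(1) that]
        finite_kernel_measurable[OF fp(2) that] by measurable
    finally show ?thesis .
  qed
  have "induced (\<kappa>, \<phi>) \<in> X \<rightarrow>\<^sub>M prob_algebra A"
  proof (rule measurable_prob_algebraI, goal_cases)
    case (1 x)
    then show ?case using prob by simp
  next
    case 2
    show ?case
    proof (rule measurable_subprob_algebra)
      fix B assume B: "B \<in> sets A"
      have "(\<lambda>x. inverse (emeasure (\<mu> x) (actions M)) * emeasure (\<mu> x) B) \<in> borel_measurable X"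
        using \<mu>_meas[OF act] \<mu>_meas[OF B] by measurable
      moreover have "(\<lambda>x. emeasure (induced (\<kappa>, \<phi>) x) B) \<in> borel_measurable X \<longleftrightarrow>
          (\<lambda>x. inverse (emeasure (\<mu> x) (actions M)) * emeasure (\<mu> x) B) \<in> borel_measurable X"
        by (rule measurable_cong) (simp add: em B)
      ultimately show "(\<lambda>x. emeasure (induced (\<kappa>, \<phi>) x) B) \<in> borel_measurable X" by simp
    qed (use prob sets prob_space_imp_subprob_space in auto)
  qed
  moreover have "emeasure (induced (\<kappa>, \<phi>) x) (admissible M x) = 1" if x: "x \<in> states M" for x
  proof -
    have "emeasure (\<mu> x) (actions M) = emeasure (\<mu> x) (admissible M x) + emeasure (\<mu> x) (actions M - admissible M x)"
      using s[OF x] act admissible_sets[OF x] admissible_sub[OF x]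
      by (subst plus_emeasure) (auto intro!: arg_cong2[where f=emeasure])
    then show ?thesis
      using one[OF x] em[OF x act] em[OF x admissible_sets[OF x]] null[OF x] by simp
  qed
  ultimately show ?thesis by (simp add: markov_def)
qed

text \<open>Integrals of the pair in terms of the induced rule: an ordinary factor where
  \<open>\<kappa>\<close> vanishes, and equality up to the factor \<infinity> elsewhere.\<close>

lemma induced_integral:
  assumes F: "(\<kappa>, \<phi>) \<in> feasible_variables M p" and x: "x \<in> states M" and f: "f \<in> borel_measurable A"
  shows "emeasure (\<kappa> x) (actions M) = 0 \<Longrightarrow> (\<integral>\<^sup>+a. f a \<partial>\<kappa> x) = 0"
    and "emeasure (\<kappa> x) (actions M) = 0 \<Longrightarrow>
      (\<integral>\<^sup>+a. f a \<partial>\<phi> x) = emeasure (\<phi> x) (actions M) * (\<integral>\<^sup>+a. f a \<partial>induced (\<kappa>, \<phi>) x)"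
    and "emeasure (\<kappa> x) (actions M) \<noteq> 0 \<Longrightarrow> \<infinity> * (\<integral>\<^sup>+a. f a \<partial>induced (\<kappa>, \<phi>) x) = \<infinity> * (\<integral>\<^sup>+a. f a \<partial>\<kappa> x)"
proof -
  note fp = feasible_pair[OF F]
  have sp: "space (\<kappa> x) = actions M" "space (\<phi> x) = actions M"
    using finite_kernel_space[OF fp(1)] finite_kernel_space[OF fp(2)] x by simp_all
  have f\<kappa>: "f \<in> borel_measurable (\<kappa> x)" and f\<phi>: "f \<in> borel_measurable (\<phi> x)"
    using f x by (simp_all add: measurable_cong_sets[OF finite_kernel_sets[OF fp(1)] refl]
        measurable_cong_sets[OF finite_kernel_sets[OF fp(2)] refl])
  {
    assume 0: "emeasure (\<kappa> x) (actions M) = 0"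
    have "space (\<kappa> x) \<in> sets (\<kappa> x)" by (rule sets.top)
    then have "AE a in \<kappa> x. False" using 0 sp by (intro AE_I[of _ _ "space (\<kappa> x)"]) auto
    then have "AE a in \<kappa> x. f a = 0" by eventually_elim simp
    then show "(\<integral>\<^sup>+a. f a \<partial>\<kappa> x) = 0" by (subst nn_integral_cong_AE) auto
    have pos: "emeasure (\<phi> x) (actions M) \<noteq> 0" using fp(5)[OF x] 0 by auto
    have fin: "emeasure (\<phi> x) (actions M) < \<infinity>" using finite_kernel_finite[OF fp(2)] x by simp
    have "(\<integral>\<^sup>+a. f a \<partial>induced (\<kappa>, \<phi>) x) = inverse (emeasure (\<phi> x) (actions M)) * (\<integral>\<^sup>+a. f a \<partial>\<phi> x)"
      using 0 f\<phi> by (simp add: induced_def normalized_def sp nn_integral_scale_measure)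
    then show "(\<integral>\<^sup>+a. f a \<partial>\<phi> x) = emeasure (\<phi> x) (actions M) * (\<integral>\<^sup>+a. f a \<partial>induced (\<kappa>, \<phi>) x)"
      using pos fin ennreal_divide_self[of "emeasure (\<phi> x) (actions M)"]
      by (simp add: divide_ennreal_def mult.assoc[symmetric])
  next
    assume n0: "emeasure (\<kappa> x) (actions M) \<noteq> 0"
    have fin: "emeasure (\<kappa> x) (actions M) < \<infinity>" using finite_kernel_finite[OF fp(1)] x by simp
    have "(\<integral>\<^sup>+a. f a \<partial>induced (\<kappa>, \<phi>) x) = inverse (emeasure (\<kappa> x) (actions M)) * (\<integral>\<^sup>+a. f a \<partial>\<kappa> x)"
      using n0 f\<kappa> by (simp add: induced_def normalized_def sp nn_integral_scale_measure)
    then show "\<infinity> * (\<integral>\<^sup>+a. f a \<partial>induced (\<kappa>, \<phi>) x) = \<infinity> * (\<integral>\<^sup>+a. f a \<partial>\<kappa> x)"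
      using n0 fin by (simp only:) (intro ennreal_inf_mult_scale,
        auto simp: less_top[symmetric] ennreal_inverse_eq_top_iff)
  }
qed

text \<open>Iterates the balance equation. If the first \<open>n\<close> state densities of the
  induced policy sum to at most the density \<open>D\<close> of the state marginal of the variable,
  then the first \<open>n + 1\<close> give at most \<open>initial M\<close> plus the mass
  transported by the variable, which by balance is \<open>D\<close> again.\<close>

lemma induced_dominated:
  assumes F: "(\<kappa>, \<phi>) \<in> feasible_variables M p"
  defines "k \<equiv> \<lambda>_::nat. induced (\<kappa>, \<phi>)"
  shows "AE x in p. total_dens k x \<le> \<infinity> * emeasure (\<kappa> x) (actions M) + emeasure (\<phi> x) (actions M)"
proof -
  note fp = feasible_pair[OF F]
  note mi = markov_induced[OF F]
  have k: "markov (k t)" for t using mi by (simp add: k_def)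
  interpret p: prob_space p by (rule prob_space_p)
  have act: "actions M \<in> sets A" using sets.top[of A] by simp
  define D where "D x = \<infinity> * emeasure (\<kappa> x) (actions M) + emeasure (\<phi> x) (actions M)" for x
  have D_measurable: "D \<in> borel_measurable X"
    unfolding D_def[abs_def]
    using finite_kernel_measurable[OF fp(1) act] finite_kernel_measurable[OF fp(2) act] by measurable
  \<comment> \<open>Redistributing \<open>D x\<close> by the induced rule never exceeds the
    variable: where \<open>\<kappa>\<close> is nonzero, the part with the factor \<infinity> alone
    equals the left-hand side.\<close>
  have D_le: "D x * (\<integral>\<^sup>+a. f a \<partial>induced (\<kappa>, \<phi>) x) \<le> \<infinity> * (\<integral>\<^sup>+a. f a \<partial>\<kappa> x) + (\<integral>\<^sup>+a. f a \<partial>\<phi> x)"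
    if x: "x \<in> states M" and f: "f \<in> borel_measurable A" for x f
  proof (cases "emeasure (\<kappa> x) (actions M) = 0")
    case True
    then show ?thesis using induced_integral(1,2)[OF F x f True] by (simp add: D_def)
  next
    case False
    then have "D x = \<infinity>" by (simp add: D_def ennreal_top_mult)
    then show ?thesis using induced_integral(3)[OF F x f False] by simp
  qed
  have S_le: "AE x in p. (\<Sum>t<n. dens k t x) \<le> D x" for n
  proof (induction n)
    case (Suc n)
    show ?case
    proof (rule AE_le_of_set_nn_integral[OF p.finite_measure_axioms])
      show "(\<lambda>x. \<Sum>t<Suc n. dens k t x) \<in> borel_measurable p" "D \<in> borel_measurable p"
        using dens_measurable[of k] D_measurable by (simp_all add: measurable_p borel_measurable_sum del: sum.lessThan_Suc)
      fix \<Lambda> assume "\<Lambda> \<in> sets p"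
      then have \<Lambda>: "\<Lambda> \<in> sets X" by (simp add: sets_p)
      define R where "R x = (\<integral>\<^sup>+a. emeasure (Q (x, a)) \<Lambda> \<partial>induced (\<kappa>, \<phi>) x)" for x
      have R: "R \<in> borel_measurable X"
        unfolding R_def by (rule nn_integral_prob_kernel_measurable[OF markovD[OF mi] emeasure_Q_measurable[OF \<Lambda>]])
      have law_em: "emeasure (law k t) \<Lambda> = (\<integral>\<^sup>+x. dens k t x * indicator \<Lambda> x \<partial>p)" for t
        using nn_integral_law[of k "indicator \<Lambda>" t, OF k] \<Lambda> sets_law[of k, OF k, of t] by simp
      have "(\<integral>\<^sup>+x\<in>\<Lambda>. (\<Sum>t<Suc n. dens k t x) \<partial>p) = (\<Sum>t<Suc n. emeasure (law k t) \<Lambda>)"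
        unfolding law_em sum_distrib_right
        by (rule nn_integral_sum) (use dens_measurable[of k] \<Lambda> in \<open>simp add: measurable_p\<close>)
      also have "\<dots> = emeasure (law k 0) \<Lambda> + (\<Sum>t<n. emeasure (law k (Suc t)) \<Lambda>)"
        by (rule sum.lessThan_Suc_shift)
      also have "(\<Sum>t<n. emeasure (law k (Suc t)) \<Lambda>) = (\<Sum>t<n. \<integral>\<^sup>+x. dens k t x * R x \<partial>p)"
      proof (intro sum.cong refl)
        fix t
        have "emeasure (law k (Suc t)) \<Lambda> = (\<integral>\<^sup>+x. R x \<partial>law k t)"
          unfolding R_def using law_emeasure_Suc[of k, OF k \<Lambda>, of t] by (simp only: k_def)
        then show "emeasure (law k (Suc t)) \<Lambda> = (\<integral>\<^sup>+x. dens k t x * R x \<partial>p)"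
          using nn_integral_law[of k R t, OF k R] by simp
      qed
      also have "\<dots> = (\<integral>\<^sup>+x. (\<Sum>t<n. dens k t x) * R x \<partial>p)"
        unfolding sum_distrib_right
        by (rule nn_integral_sum[symmetric]) (use dens_measurable[of k] R in \<open>simp add: measurable_p\<close>)
      also have "\<dots> \<le> (\<integral>\<^sup>+x. D x * R x \<partial>p)"
        using Suc by (intro nn_integral_mono_AE) (auto elim!: eventually_mono intro: mult_right_mono)
      also have "\<dots> \<le> pair_integral p (\<kappa>, \<phi>) (\<lambda>z. emeasure (Q z) \<Lambda>)"
        unfolding pair_integral_def prod.case R_def
        by (intro nn_integral_mono D_le section_measurable[OF emeasure_Q_measurable[OF \<Lambda>]]) (simp_all add: space_p)
      finally have "(\<integral>\<^sup>+x\<in>\<Lambda>. (\<Sum>t<Suc n. dens k t x) \<partial>p) \<le>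
          emeasure (initial M) \<Lambda> + pair_integral p (\<kappa>, \<phi>) (\<lambda>z. emeasure (Q z) \<Lambda>)"
        by (simp add: add_left_mono)
      also have "\<dots> = pair_integral p (\<kappa>, \<phi>) (\<lambda>z. indicator \<Lambda> (fst z))"
        by (rule fp(4)[OF \<Lambda>, symmetric])
      also have "\<dots> = (\<integral>\<^sup>+x\<in>\<Lambda>. D x \<partial>p)"
        unfolding pair_integral_def prod.case
      proof (rule nn_integral_cong)
        fix x assume "x \<in> space p"
        then have x: "x \<in> states M" by (simp add: space_p)
        then show "\<infinity> * (\<integral>\<^sup>+a. indicator \<Lambda> (fst (x, a)) \<partial>\<kappa> x) + (\<integral>\<^sup>+a. indicator \<Lambda> (fst (x, a)) \<partial>\<phi> x) = D x * indicator \<Lambda> x"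
          using finite_kernel_space[OF fp(1), of x] finite_kernel_space[OF fp(2), of x]
          by (auto simp: D_def split: split_indicator)
      qed
      finally show "(\<integral>\<^sup>+x\<in>\<Lambda>. (\<Sum>t<Suc n. dens k t x) \<partial>p) \<le> (\<integral>\<^sup>+x\<in>\<Lambda>. D x \<partial>p)" .
    qed
  qed simp
  have "AE x in p. \<forall>n. (\<Sum>t<n. dens k t x) \<le> D x"
    using S_le by (subst AE_all_countable) (rule allI)
  then show ?thesis
    unfolding total_dens_def D_def[symmetric]
    by eventually_elim (intro suminf_le_const summableI, blast)
qed

text \<open>If the surplus of a feasible variable over the occupation measure of its induced policy
  had positive \<open>h\<close>-mass, adding multiples of the surplus would make the \<open>h\<close>-mass unbounded.\<close>

lemma
  assumes F: "(\<kappa>, \<phi>) \<in> feasible_variables M p"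
  defines "k \<equiv> \<lambda>_::nat. induced (\<kappa>, \<phi>)"
  shows occ_induced_le: "f \<in> borel_measurable XA \<Longrightarrow> occ k f \<le> pair_integral p (\<kappa>, \<phi>) f"
    and occ_induced_eq: "h \<in> borel_measurable XA \<Longrightarrow>
      (\<And>\<Psi>. \<Psi> \<in> feasible_variables M p \<Longrightarrow> pair_integral p \<Psi> h \<le> C) \<Longrightarrow> C < \<infinity> \<Longrightarrow>
      occ k h = pair_integral p (\<kappa>, \<phi>) h"
proof -
  note fp = feasible_pair[OF F]
  note mi = markov_induced[OF F]
  have k: "markov (k t)" for t using mi by (simp add: k_def)
  have act: "actions M \<in> sets A" using sets.top[of A] by simp
  define w where "w x = emeasure (\<phi> x) (actions M)" for x
  define S where "S = total_dens k"
  define E where "E x \<longleftrightarrow> emeasure (\<kappa> x) (actions M) = 0" for x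
  have S: "S \<in> borel_measurable X" unfolding S_def by (rule total_dens_measurable)
  have w: "w \<in> borel_measurable X"
    unfolding w_def by (rule finite_kernel_measurable[OF fp(2) act])
  have w_fin: "w x < \<infinity>" if "x \<in> states M" for x
    unfolding w_def using finite_kernel_finite[OF fp(2)] that by simp
  have E_pred: "Measurable.pred X E"
    unfolding E_def using finite_kernel_measurable[OF fp(1) act] by measurable
  have E_set: "{x \<in> space X. E x} \<in> sets X" using E_pred by measurable
  have SD: "AE x in p. E x \<longrightarrow> S x \<le> w x"
    using induced_dominated[OF F] unfolding k_def[symmetric] S_def
    by eventually_elim (auto simp: E_def w_def)
  define I where "I f x = (\<integral>\<^sup>+a. f (x, a) \<partial>induced (\<kappa>, \<phi>) x)" for f and x :: 'x
  define G where "G f x = \<infinity> * (\<integral>\<^sup>+a. f (x, a) \<partial>\<kappa> x) + (\<integral>\<^sup>+a. f (x, a) \<partial>\<phi> x)" for f and x :: 'x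
  \<comment> \<open>The surplus. Off \<open>E\<close> it may be all of \<open>G f\<close>: either
    the induced rule charges \<open>f\<close> and \<open>G f x\<close> is \<infinity>, or the
    occupation part vanishes. In both cases \<open>S x * I f x + W f x\<close> is
    \<open>G f x\<close>.\<close>
  define W where "W f x = (if E x then (w x - S x) * I f x else G f x)" for f x
  have I_m: "I f \<in> borel_measurable X" if "f \<in> borel_measurable XA" for f
    unfolding I_def by (rule nn_integral_prob_kernel_measurable[OF markovD[OF mi] that])
  have G_m: "G f \<in> borel_measurable X" if "f \<in> borel_measurable XA" for f
    unfolding G_def[abs_def]
    using finite_kernel_nn_integral[OF fp(1) that] finite_kernel_nn_integral[OF fp(2) that] by measurable
  have W_m: "W f \<in> borel_measurable X" if "f \<in> borel_measurable XA" for f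
    unfolding W_def[abs_def]
  proof (rule measurable_If[OF _ G_m[OF that] E_set])
    show "(\<lambda>x. (w x - S x) * I f x) \<in> borel_measurable X"
      using w S I_m[OF that] by measurable
  qed
  have G_E: "G f x = w x * I f x" if "E x" "x \<in> states M" "f \<in> borel_measurable XA" for f x
    using induced_integral(1,2)[OF F that(2) section_measurable[OF that(3,2)]] that(1)
    by (simp add: G_def I_def w_def E_def)
  have G_nE: "\<infinity> * (\<integral>\<^sup>+a. f (x, a) \<partial>\<kappa> x) = \<infinity> * I f x" if "\<not> E x" "x \<in> states M" "f \<in> borel_measurable XA" for f x
    using induced_integral(3)[OF F that(2) section_measurable[OF that(3,2)]] that(1)
    by (simp add: I_def E_def)
  have pair_G: "pair_integral p (\<kappa>, \<phi>) f = (\<integral>\<^sup>+x. G f x \<partial>p)" for f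
    by (simp add: pair_integral_def G_def)
  have occ_S: "occ k f = (\<integral>\<^sup>+x. S x * I f x \<partial>p)" if "f \<in> borel_measurable XA" for f
    unfolding occ_eq_dens[OF k that] by (simp add: k_def I_def S_def total_dens_def)
  have split: "pair_integral p (\<kappa>, \<phi>) f = occ k f + (\<integral>\<^sup>+x. W f x \<partial>p)" if f: "f \<in> borel_measurable XA" for f
  proof -
    have "pair_integral p (\<kappa>, \<phi>) f = (\<integral>\<^sup>+x. S x * I f x + W f x \<partial>p)"
      unfolding pair_G
    proof (rule nn_integral_cong_AE)
      show "AE x in p. G f x = S x * I f x + W f x"
        using SD AE_space
      proof eventually_elim
        case (elim x)
        then have x: "x \<in> states M" by (simp add: space_p)
        show ?case
        proof (cases "E x")
          case True
          with elim have "S x \<le> w x" by simp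
          then have "w x = S x + (w x - S x)" by (simp add: add_diff_inverse_ennreal)
          then have "G f x = (S x + (w x - S x)) * I f x" using G_E[OF True x f] by simp
          then show ?thesis using True by (simp add: W_def distrib_right)
        next
          case False
          show ?thesis
          proof (cases "I f x = 0")
            case True then show ?thesis using False by (simp add: W_def)
          next
            case I0: False
            then have "G f x = \<infinity>" unfolding G_def G_nE[OF False x f] by (simp add: ennreal_top_mult)
            then show ?thesis using False by (simp add: W_def)
          qed
        qed
      qed
    qed
    also have "\<dots> = (\<integral>\<^sup>+x. S x * I f x \<partial>p) + (\<integral>\<^sup>+x. W f x \<partial>p)"
      using S I_m[OF f] W_m[OF f] by (intro nn_integral_add) (simp_all add: measurable_p borel_measurable_times_ennreal)
    finally show ?thesis unfolding occ_S[OF f] .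
  qed
  show le: "occ k f \<le> pair_integral p (\<kappa>, \<phi>) f" if "f \<in> borel_measurable XA" for f
    unfolding split[OF that] by simp
  \<comment> \<open>Adds \<open>n\<close> copies of the surplus. On \<open>E\<close> the new kernel
    has total mass \<open>c n x\<close>; off \<open>E\<close> the part with the factor \<infinity>
    absorbs its own multiples, so only \<open>\<phi>\<close> is scaled.\<close>
  define c where "c n x = w x + of_nat n * (w x - S x)" for n :: nat and x
  define \<phi>' where "\<phi>' n x = (if E x then scale_measure (c n x) (induced (\<kappa>, \<phi>) x)
    else scale_measure (1 + of_nat n) (\<phi> x))" for n :: nat and x
  have c_m: "c n \<in> borel_measurable X" for n unfolding c_def[abs_def] using w S by measurable
  have c_fin: "c n x < \<infinity>" if "x \<in> states M" for n x
  proof -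
    have "w x - S x \<le> w x" by (rule diff_le_self_ennreal)
    then have "w x - S x < \<infinity>" using w_fin[OF that] by (rule le_less_trans)
    then show ?thesis using w_fin[OF that]
      by (simp add: c_def ennreal_mult_eq_top_iff less_top[symmetric])
  qed
  have \<phi>'_em: "emeasure (\<phi>' n x) B = (if E x then c n x * emeasure (induced (\<kappa>, \<phi>) x) B
      else (1 + of_nat n) * emeasure (\<phi> x) B)" for n x B
    by (simp add: \<phi>'_def)
  have \<phi>'_sets: "sets (\<phi>' n x) = sets A" if "x \<in> states M" for n x
    using markov_sets[OF mi that] finite_kernel_sets[OF fp(2)] that by (simp add: \<phi>'_def)
  have \<phi>'_int: "(\<integral>\<^sup>+a. f (x, a) \<partial>\<phi>' n x) = (if E x then c n x * I f x else (1 + of_nat n) * (\<integral>\<^sup>+a. f (x, a) \<partial>\<phi> x))"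
    if x: "x \<in> states M" and f: "f \<in> borel_measurable XA" for n x f
    using section_measurable[OF f x] markov_sets[OF mi x] finite_kernel_sets[OF fp(2)] x
    by (auto simp: \<phi>'_def I_def cong: measurable_cong_sets intro!: nn_integral_scale_measure)
  have \<phi>'_kernel: "finite_kernel X A (\<phi>' n)" for n
    unfolding finite_kernel_def
  proof (intro conjI ballI)
    fix x assume "x \<in> space X"
    then have x: "x \<in> states M" by simp
    show "sets (\<phi>' n x) = sets A" by (rule \<phi>'_sets[OF x])
    have sp: "space (\<phi>' n x) = actions M" using sets_eq_imp_space_eq[OF \<phi>'_sets[OF x]] by simp
    show "finite_measure (\<phi>' n x)"
      by (rule finite_measureI, unfold sp \<phi>'_em)
        (use c_fin[OF x, of n] markov_total[OF mi x] w_fin[OF x] in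
          \<open>auto simp: w_def ennreal_mult_eq_top_iff\<close>)
  next
    fix B assume B: "B \<in> sets A"
    show "(\<lambda>x. emeasure (\<phi>' n x) B) \<in> borel_measurable X"
      unfolding \<phi>'_em
    proof (rule measurable_If[OF _ _ E_set])
      show "(\<lambda>x. c n x * emeasure (induced (\<kappa>, \<phi>) x) B) \<in> borel_measurable X"
        using c_m markov_measurable[OF mi B] by measurable
      show "(\<lambda>x. (1 + of_nat n) * emeasure (\<phi> x) B) \<in> borel_measurable X"
        using finite_kernel_measurable[OF fp(2) B] by measurable
    qed
  qed
  have pair_n: "pair_integral p (\<kappa>, \<phi>' n) f = pair_integral p (\<kappa>, \<phi>) f + of_nat n * (\<integral>\<^sup>+x. W f x \<partial>p)"
    if f: "f \<in> borel_measurable XA" for n f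
  proof -
    have "pair_integral p (\<kappa>, \<phi>' n) f = (\<integral>\<^sup>+x. G f x + of_nat n * W f x \<partial>p)"
      unfolding pair_integral_def prod.case
    proof (rule nn_integral_cong)
      fix x assume "x \<in> space p"
      then have x: "x \<in> states M" by (simp add: space_p)
      show "\<infinity> * (\<integral>\<^sup>+a. f (x, a) \<partial>\<kappa> x) + (\<integral>\<^sup>+a. f (x, a) \<partial>\<phi>' n x) = G f x + of_nat n * W f x"
      proof (cases "E x")
        case True
        then have "(\<integral>\<^sup>+a. f (x, a) \<partial>\<kappa> x) = 0"
          using induced_integral(1)[OF F x section_measurable[OF f x]] by (simp add: E_def)
        then show ?thesis
          using True G_E[OF True x f] by (simp add: \<phi>'_int[OF x f] W_def c_def distrib_right mult.assoc)
      next
        case False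
        show ?thesis
        proof (cases "I f x = 0")
          case True
          then have "\<infinity> * (\<integral>\<^sup>+a. f (x, a) \<partial>\<kappa> x) = 0" using G_nE[OF False x f] by simp
          then show ?thesis
            using False by (simp only: \<phi>'_int[OF x f] W_def G_def if_False distrib_right mult_1_left add_0_left)
        next
          case I0: False
          then have "\<infinity> * (\<integral>\<^sup>+a. f (x, a) \<partial>\<kappa> x) = \<infinity>" using G_nE[OF False x f] by (simp add: ennreal_top_mult)
          then show ?thesis by (simp only: G_def ennreal_add_eq_top infinity_ennreal_def) simp
        qed
      qed
    qed
    also have "\<dots> = (\<integral>\<^sup>+x. G f x \<partial>p) + of_nat n * (\<integral>\<^sup>+x. W f x \<partial>p)"
      using G_m[OF f] W_m[OF f]
      by (subst nn_integral_add) (simp_all add: measurable_p borel_measurable_times_ennreal nn_integral_cmult)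
    finally show ?thesis unfolding pair_G .
  qed
  have feas: "(\<kappa>, \<phi>' n) \<in> feasible_variables M p" for n
    unfolding feasible_variables_iff balanced_iff[OF sets_p]
  proof (intro conjI fp(1) \<phi>'_kernel ballI)
    fix x assume x: "x \<in> states M"
    show "emeasure (\<kappa> x) (actions M - admissible M x) + emeasure (\<phi>' n x) (actions M - admissible M x) = 0"
      using fp(3) x markov_null[OF mi x] by (simp add: \<phi>'_em)
    have "0 < c n x" if "E x"
      using fp(5)[OF x] that by (simp add: E_def c_def w_def add_pos_nonneg)
    then show "emeasure (\<kappa> x) (actions M) + emeasure (\<phi>' n x) (actions M) > 0"
      using markov_total[OF mi x] by (cases "E x") (auto simp: \<phi>'_em E_def zero_less_iff_neq_zero)
  next
    fix \<Lambda> assume \<Lambda>: "\<Lambda> \<in> sets X"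
    define i :: "'x \<times> 'a \<Rightarrow> ennreal" where "i = (\<lambda>z. indicator \<Lambda> (fst z))"
    define q where "q = (\<lambda>z. emeasure (Q z) \<Lambda>)"
    have i: "i \<in> borel_measurable XA" unfolding i_def using \<Lambda> by measurable
    have q: "q \<in> borel_measurable XA" unfolding q_def by (rule emeasure_Q_measurable[OF \<Lambda>])
    have bal: "pair_integral p (\<kappa>, \<phi>) i = emeasure (initial M) \<Lambda> + pair_integral p (\<kappa>, \<phi>) q"
      unfolding i_def q_def by (rule fp(4)[OF \<Lambda>])
    have bal': "occ k i = emeasure (initial M) \<Lambda> + occ k q"
      unfolding i_def q_def by (rule occ_balance[OF k \<Lambda>])
    \<comment> \<open>The surplus is invariant: subtracting the balance of the occupation measure
      from that of the variable gives equal \<open>W\<close>-integrals for \<open>i\<close> and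
      \<open>q\<close>. Subtraction requires a finite value; an infinite one makes both sides
      \<infinity>.\<close>
    have "pair_integral p (\<kappa>, \<phi>) i + of_nat n * (\<integral>\<^sup>+x. W i x \<partial>p) =
        pair_integral p (\<kappa>, \<phi>) i + of_nat n * (\<integral>\<^sup>+x. W q x \<partial>p)"
    proof (cases "pair_integral p (\<kappa>, \<phi>) i = \<infinity>")
      case False
      have "occ k i + (\<integral>\<^sup>+x. W i x \<partial>p) = occ k i + (\<integral>\<^sup>+x. W q x \<partial>p)"
        using bal unfolding split[OF i] split[OF q] bal' by (simp add: add.assoc)
      moreover have "occ k i \<noteq> \<infinity>" using le[OF i] False by (auto simp: top_unique)
      ultimately have "(\<integral>\<^sup>+x. W i x \<partial>p) = (\<integral>\<^sup>+x. W q x \<partial>p)" by (simp add: ennreal_add_left_cancel)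
      then show ?thesis by simp
    qed simp
    then have "pair_integral p (\<kappa>, \<phi>' n) i = emeasure (initial M) \<Lambda> + pair_integral p (\<kappa>, \<phi>' n) q"
      unfolding pair_n[OF i] pair_n[OF q] by (simp add: bal add.assoc)
    then show "pair_integral p (\<kappa>, \<phi>' n) (\<lambda>z. indicator \<Lambda> (fst z)) =
        emeasure (initial M) \<Lambda> + pair_integral p (\<kappa>, \<phi>' n) (\<lambda>z. emeasure (Q z) \<Lambda>)"
      unfolding i_def q_def .
  qed
  show "occ k h = pair_integral p (\<kappa>, \<phi>) h"
    if h: "h \<in> borel_measurable XA" and bound: "\<And>\<Psi>. \<Psi> \<in> feasible_variables M p \<Longrightarrow> pair_integral p \<Psi> h \<le> C"
      and C: "C < \<infinity>" for h
  proof -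
    have *: "of_nat n * (\<integral>\<^sup>+x. W h x \<partial>p) \<le> C" for n
      using bound[OF feas[of n]] unfolding pair_n[OF h] by (rule order_trans[rotated]) simp
    have "(\<integral>\<^sup>+x. W h x \<partial>p) = 0"
    proof (rule ccontr)
      assume n0: "(\<integral>\<^sup>+x. W h x \<partial>p) \<noteq> 0"
      have "(SUP n. of_nat n * (\<integral>\<^sup>+x. W h x \<partial>p)) \<le> C" by (rule SUP_least) (rule *)
      moreover have "(SUP n. of_nat n * (\<integral>\<^sup>+x. W h x \<partial>p)) = \<infinity>"
        using n0 by (simp add: SUP_mult_right_ennreal[symmetric] ennreal_SUP_of_nat_eq_top ennreal_top_mult)
      ultimately show False using C by (simp add: top_unique)
    qed
    then show ?thesis unfolding split[OF h] by simp
  qed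
qed

end

section \<open>Measurable selection of points of infinite mass\<close>

text \<open>A node of a tree of successive ball intersections; radii halve along a branch, so the
  centres converge if the cells are nonempty.\<close>

definition cell :: "(nat \<Rightarrow> 'a::metric_space) \<Rightarrow> nat list \<Rightarrow> 'a set" where
  "cell s l = (\<Inter>j<length l. ball (s (l ! j)) ((1 / 2) ^ j))"

lemma cell_Nil [simp]: "cell s [] = UNIV"
  by (simp add: cell_def)

lemma cell_snoc: "cell s (l @ [i]) = cell s l \<inter> ball (s i) ((1 / 2) ^ length l)"
  by (auto simp: cell_def nth_append lessThan_Suc)

lemma cell_open: "open (cell s l)"
  by (auto simp: cell_def)

text \<open>The selected point is the intersection of nested balls of infinite mass; taking the least
  index of an admissible ball at each level makes the choice measurable.\<close>

lemma infinite_mass_selector: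
  fixes A0 :: "'a::polish_space set" and N :: "'x \<Rightarrow> 'a measure"
  defines "T \<equiv> restrict_space borel A0"
  assumes A0: "A0 \<in> sets borel"
    and N_sets: "\<And>x. x \<in> space S \<Longrightarrow> sets (N x) = sets T"
    and N_meas: "\<And>C. C \<in> sets T \<Longrightarrow> (\<lambda>x. emeasure (N x) C) \<in> borel_measurable S"
    and compact: "\<And>x. x \<in> space S \<Longrightarrow> compact (B x)"
    and null: "\<And>x. x \<in> space S \<Longrightarrow> emeasure (N x) (A0 - B x) = 0"
  shows "\<exists>y\<in>borel_measurable S. \<forall>x\<in>space S. emeasure (N x) A0 = \<infinity> \<longrightarrow>
    y x \<in> B x \<and> (\<forall>U. open U \<longrightarrow> y x \<in> U \<longrightarrow> emeasure (N x) (U \<inter> A0) = \<infinity>)"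
proof -
  obtain D :: "'a set" where D: "countable D" "\<And>V. open V \<Longrightarrow> V \<noteq> {} \<Longrightarrow> \<exists>d\<in>D. d \<in> V"
    using countable_dense_setE by blast
  define s where "s = from_nat_into D"
  have "D \<noteq> {}" using D(2)[of UNIV] by auto
  then have s: "\<exists>i. s i \<in> V" if "open V" "V \<noteq> {}" for V
    using D(2)[OF that] D(1) unfolding s_def by (metis from_nat_into_surj)
  have cap: "C \<inter> A0 \<in> sets T" if "C \<in> sets borel" for C
    unfolding T_def sets_restrict_space using that by auto
  have cell_T: "cell s l \<inter> A0 \<in> sets T" for l
    by (rule cap) (simp add: cell_open)
  define hot where "hot x l \<longleftrightarrow> emeasure (N x) (cell s l \<inter> A0) = \<infinity>" for x l
  \<comment> \<open>Where no index is admissible, \<open>LEAST\<close> is still some fixed number,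
    so the branch is defined and measurable on all of \<open>S\<close>.\<close>
  define path where "path x = rec_nat [] (\<lambda>_ l. l @ [LEAST i. hot x (l @ [i])])" for x
  have path_0: "path x 0 = []" and path_Suc: "path x (Suc m) = path x m @ [LEAST i. hot x (path x m @ [i])]" for x m
    by (simp_all add: path_def)
  have len: "length (path x m) = m" for x m by (induction m) (simp_all add: path_0 path_Suc)
  have hot_pred: "Measurable.pred S (\<lambda>x. hot x l)" for l
    unfolding hot_def using N_meas[OF cell_T] by measurable
  have path_m: "(\<lambda>x. path x m) \<in> S \<rightarrow>\<^sub>M count_space UNIV" for m
  proof (induction m)
    case 0 then show ?case by (simp add: path_0)
  next
    case (Suc m)
    have "(\<lambda>x. l @ [LEAST i. hot x (l @ [i])]) \<in> S \<rightarrow>\<^sub>M count_space UNIV" for l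
      by (rule measurable_compose[OF measurable_Least[OF hot_pred]]) simp
    from measurable_compose_countable[OF this Suc] show ?case by (simp add: path_Suc)
  qed
  define y where "y m x = s (last (path x (Suc m)))" for m x
  have y_m: "y m \<in> borel_measurable S" for m
    unfolding y_def by (rule measurable_compose[OF path_m]) simp
  define z where "z x = (if Cauchy (\<lambda>m. y m x) then lim (\<lambda>m. y m x) else s 0)" for x
  have z_m: "z \<in> borel_measurable S" unfolding z_def by (rule measurable_lim_complete[OF y_m])
  have main: "z x \<in> B x \<and> (\<forall>U. open U \<longrightarrow> z x \<in> U \<longrightarrow> emeasure (N x) (U \<inter> A0) = \<infinity>)"
    if x: "x \<in> space S" and inf: "emeasure (N x) A0 = \<infinity>" for x
  proof -
    have sN: "C \<inter> A0 \<in> sets (N x)" if "C \<in> sets borel" for C using cap[OF that] N_sets[OF x] by simp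
    have closedB: "closed (B x)" using compact[OF x] by (rule compact_imp_closed)
    have AB: "A0 - B x \<in> sets (N x)"
      using sN[of "- B x"] closedB by (simp add: Diff_eq Int_commute)
    have hot_path: "hot x (path x m)" for m
    proof (induction m)
      case 0 then show ?case using inf by (simp add: hot_def path_0)
    next
      case (Suc m)
      define c where "c = cell s (path x m)"
      define b where "b i = ball (s i) ((1 / 2 :: real) ^ m)" for i
      \<comment> \<open>Finitely many balls of the current radius cover \<open>B x\<close>, and
        there is no mass outside \<open>B x\<close>; hence one of them carries infinite mass within
        the current cell.\<close>
      have "B x \<subseteq> (\<Union>i. b i)"
      proof
        fix a assume "a \<in> B x"
        obtain i where "s i \<in> ball a ((1 / 2) ^ m)"
          using s[OF open_ball] centre_in_ball[of a "(1 / 2) ^ m"] by fastforce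
        then show "a \<in> (\<Union>i. b i)" by (auto simp: b_def dist_commute)
      qed
      then obtain F where F: "finite F" "B x \<subseteq> (\<Union>i\<in>F. b i)"
        using compactE_image[OF compact[OF x], of UNIV b] by (auto simp: b_def)
      have sb: "(c \<inter> b i) \<inter> A0 \<in> sets (N x)" for i
        by (rule sN) (simp add: c_def b_def cell_open open_Int)
      have SU: "(\<Union>i\<in>F. (c \<inter> b i) \<inter> A0) \<in> sets (N x)"
        by (rule sets.finite_UN[OF F(1)]) (rule sb)
      have "\<infinity> = emeasure (N x) (c \<inter> A0)" using Suc by (simp add: hot_def c_def)
      also have "\<dots> \<le> emeasure (N x) ((A0 - B x) \<union> (\<Union>i\<in>F. (c \<inter> b i) \<inter> A0))"
        by (intro emeasure_mono sets.Un AB SU) (use F(2) in auto)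
      also have "\<dots> \<le> emeasure (N x) (A0 - B x) + emeasure (N x) (\<Union>i\<in>F. (c \<inter> b i) \<inter> A0)"
        by (intro emeasure_subadditive AB SU)
      also have "\<dots> \<le> 0 + (\<Sum>i\<in>F. emeasure (N x) ((c \<inter> b i) \<inter> A0))"
        unfolding null[OF x] using sb by (intro add_left_mono emeasure_subadditive_finite[OF F(1)]) blast
      finally have "(\<Sum>i\<in>F. emeasure (N x) ((c \<inter> b i) \<inter> A0)) = \<infinity>" by (simp add: top_unique)
      then obtain i where "emeasure (N x) ((c \<inter> b i) \<inter> A0) = \<infinity>" using F(1) by auto
      then have "hot x (path x m @ [i])" by (simp add: hot_def cell_snoc len c_def b_def)
      then show ?case unfolding path_Suc by (rule LeastI)
    qed
    have cell_y: "cell s (path x (Suc m)) \<subseteq> ball (y m x) ((1 / 2) ^ m)" for m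
      by (simp add: y_def path_Suc cell_snoc len)
    have cell_mono: "cell s (path x n) \<subseteq> cell s (path x m)" if "m \<le> n" for m n
      using that by (induction rule: dec_induct) (auto simp: path_Suc cell_snoc)
    \<comment> \<open>Cells of infinite mass are nonempty, and a point common to two nested cells
      bounds the distance of their centres.\<close>
    have near: "dist (y m x) (y n x) < 2 * (1 / 2) ^ m" if "m \<le> n" for m n
    proof -
      have "cell s (path x (Suc n)) \<inter> A0 \<noteq> {}" using hot_path[of "Suc n"] by (auto simp: hot_def)
      then obtain a where a: "a \<in> cell s (path x (Suc n))" by auto
      then have "dist (y n x) a < (1 / 2) ^ n" using cell_y[of n] by auto
      moreover have "dist (y m x) a < (1 / 2) ^ m" using cell_y[of m] cell_mono[of "Suc m" "Suc n"] that a by auto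
      moreover have "(1 / 2 :: real) ^ n \<le> (1 / 2) ^ m" using that by (intro power_decreasing) auto
      moreover have "dist (y m x) (y n x) \<le> dist (y m x) a + dist (y n x) a" by (rule dist_triangle2)
      ultimately show ?thesis by linarith
    qed
    have small: "\<exists>m. 4 * (1 / 2 :: real) ^ m < e" if e: "e > 0" for e
    proof -
      obtain m where "(1 / 2 :: real) ^ m < e / 4"
        using real_arch_pow_inv[of "e / 4" "1 / 2"] e by auto
      then show ?thesis by (intro exI[of _ m]) simp
    qed
    have "Cauchy (\<lambda>m. y m x)"
    proof (rule metric_CauchyI)
      fix e :: real assume "e > 0"
      then obtain m where m: "4 * (1 / 2 :: real) ^ m < e" using small by blast
      show "\<exists>k. \<forall>n\<ge>k. \<forall>n'\<ge>k. dist (y n x) (y n' x) < e"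
      proof (intro exI allI impI)
        fix n n' assume "m \<le> n" "m \<le> n'"
        then have "dist (y m x) (y n x) < 2 * (1 / 2) ^ m" "dist (y m x) (y n' x) < 2 * (1 / 2) ^ m"
          using near by auto
        moreover have "dist (y n x) (y n' x) \<le> dist (y m x) (y n x) + dist (y m x) (y n' x)"
          by (metis dist_commute dist_triangle)
        ultimately show "dist (y n x) (y n' x) < e" using m by linarith
      qed
    qed
    then have lim: "(\<lambda>m. y m x) \<longlonglongrightarrow> z x"
      unfolding z_def Cauchy_convergent_iff by (simp add: convergent_LIMSEQ_iff)
    have dz: "dist (y m x) (z x) \<le> 2 * (1 / 2) ^ m" for m
    proof (rule LIMSEQ_le_const2[OF tendsto_dist[OF tendsto_const lim]])
      show "\<exists>N. \<forall>n\<ge>N. dist (y m x) (y n x) \<le> 2 * (1 / 2) ^ m"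
        using near[of m] by (intro exI[of _ m]) (auto intro: less_imp_le)
    qed
    have U: "emeasure (N x) (U \<inter> A0) = \<infinity>" if U: "open U" "z x \<in> U" for U
    proof -
      obtain e where e: "e > 0" "ball (z x) e \<subseteq> U" by (rule openE[OF U])
      obtain m where m: "4 * (1 / 2 :: real) ^ m < e" using small[OF e(1)] by blast
      have "cell s (path x (Suc m)) \<subseteq> U"
      proof
        fix a assume "a \<in> cell s (path x (Suc m))"
        then have "dist (y m x) a < (1 / 2) ^ m" using cell_y[of m] by auto
        moreover have "dist (z x) a \<le> dist (y m x) (z x) + dist (y m x) a"
          by (metis dist_commute dist_triangle)
        moreover have "0 < (1 / 2 :: real) ^ m" by simp
        ultimately have "dist (z x) a < e" using dz[of m] m by linarith
        then show "a \<in> U" using e(2) by auto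
      qed
      then have "emeasure (N x) (cell s (path x (Suc m)) \<inter> A0) \<le> emeasure (N x) (U \<inter> A0)"
        using sN[of U] U(1) by (intro emeasure_mono) auto
      then show ?thesis using hot_path[of "Suc m"] by (simp add: hot_def top_unique)
    qed
    \<comment> \<open>Otherwise the complement of \<open>B x\<close> would be an open neighbourhood
      of the point and carry infinite mass, yet it is null.\<close>
    moreover have "z x \<in> B x"
    proof (rule ccontr)
      assume "z x \<notin> B x"
      then have "emeasure (N x) (- B x \<inter> A0) = \<infinity>" using closedB by (intro U) auto
      then show False using null[OF x] by (simp add: Diff_eq Int_commute)
    qed
    ultimately show ?thesis by blast
  qed
  show ?thesis by (rule bexI[OF _ z_m]) (use main in blast)
qed

section \<open>Positive and negative parts of criteria\<close>

context controlled_model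
begin

text \<open>Cut off outside \<open>K\<close>, where \<open>h\<close> carries no information;
  measurability on the whole product then follows from measurability on feasible pairs.\<close>

definition pos :: "('x \<times> 'a \<Rightarrow> real) \<Rightarrow> 'x \<times> 'a \<Rightarrow> ennreal" where
  "pos h z = ennreal (max 0 (h z)) * indicator K z"

definition neg :: "('x \<times> 'a \<Rightarrow> real) \<Rightarrow> 'x \<times> 'a \<Rightarrow> ennreal" where
  "neg h z = ennreal (max 0 (- h z)) * indicator K z"

lemma pos_measurable:
  assumes "h \<in> borel_measurable (feasible_space M)"
  shows "pos h \<in> borel_measurable XA"
proof -
  have "(\<lambda>z. ennreal (max 0 (h z))) \<in> borel_measurable (feasible_space M)"
    by (intro measurable_compose[OF _ measurable_ennreal] borel_measurable_max measurable_const assms) simp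
  then show ?thesis
    unfolding pos_def[abs_def] using sets.Int[OF K_sets sets.top]
    by (subst borel_measurable_restrict_space_iff_ennreal[symmetric]) simp_all
qed

lemma neg_eq: "neg h = pos (\<lambda>z. - h z)"
  by (simp add: neg_def[abs_def] pos_def[abs_def])

lemma neg_measurable: "h \<in> borel_measurable (feasible_space M) \<Longrightarrow> neg h \<in> borel_measurable XA"
  unfolding neg_eq by (intro pos_measurable borel_measurable_uminus)

end

context reference_model
begin

section \<open>Approximation of Markov policies\<close>

lemma law_cong:
  assumes "\<And>s. s < t \<Longrightarrow> k' s = k s"
  shows "law k' t = law k t"
  using assms by (induction t) simp_all

text \<open>Used contrapositively: a function with finite integral against the occupation kernel is
  not bounded away from 0 near a point of infinite mass.\<close>

lemma null_or_infinite:
  assumes k: "\<And>t. markov (k t)" and x: "x \<in> states M" and f: "f \<in> borel_measurable A"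
    and c: "c > 0" and U: "open U" "emeasure (occ_kernel k x) (U \<inter> actions M) = \<infinity>"
    and le: "\<And>b. b \<in> U \<Longrightarrow> b \<in> admissible M x \<Longrightarrow> c \<le> f b"
    and null: "emeasure (occ_kernel k x) (actions M - admissible M x) = 0"
  shows "(\<integral>\<^sup>+a. f a \<partial>occ_kernel k x) = \<infinity>"
proof -
  have sN: "sets (occ_kernel k x) = sets A" by (simp add: occ_kernel_def)
  have UA: "U \<inter> actions M \<in> sets (occ_kernel k x)"
    unfolding sN sets_restrict_space using U(1) by (auto simp: Int_commute)
  have "actions M - admissible M x \<in> sets (occ_kernel k x)"
    using sets.Diff[OF sets.top admissible_sets[OF x]] sN by simp
  then have "actions M - admissible M x \<in> null_sets (occ_kernel k x)" using null by (simp add: null_sets_def)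
  from AE_not_in[OF this] have "AE a in occ_kernel k x. c * indicator (U \<inter> actions M) a \<le> f a"
    by eventually_elim (auto simp: le split: split_indicator)
  then have "(\<integral>\<^sup>+a. c * indicator (U \<inter> actions M) a \<partial>occ_kernel k x) \<le> (\<integral>\<^sup>+a. f a \<partial>occ_kernel k x)"
    by (rule nn_integral_mono_AE)
  also have "(\<integral>\<^sup>+a. c * indicator (U \<inter> actions M) a \<partial>occ_kernel k x) = \<infinity>"
    using U(2) c UA by (simp add: nn_integral_cmult_indicator ennreal_mult_top)
  finally show ?thesis by (simp add: top_unique)
qed

text \<open>From stage \<open>T\<close> on, states of infinite \<open>total_dens\<close> use a point
  of infinite mass of the occupation kernel. Finite integrals force negative parts to vanish there,
  and jumps to states of finite density to have probability 0. Hence densities on the finite part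
  only decrease, negative parts do not grow, and positive parts keep at least the first
  \<open>T\<close> stages.\<close>

lemma approximation:
  assumes k: "\<And>t. markov (k t)" and H: "finite H"
    and H_meas: "\<And>h. h \<in> H \<Longrightarrow> h \<in> borel_measurable (feasible_space M)"
    and H_usc: "\<And>h x. h \<in> H \<Longrightarrow> x \<in> states M \<Longrightarrow> usc_on (admissible M x) (\<lambda>a. h (x, a))"
    and H_neg: "\<And>h. h \<in> H \<Longrightarrow> occ k (neg h) < \<infinity>"
  obtains \<kappa> \<phi> where "balanced p (\<kappa>, \<phi>)"
    "\<And>h. h \<in> H \<Longrightarrow> pair_integral p (\<kappa>, \<phi>) (neg h) \<le> occ k (neg h)"
    "\<And>h. h \<in> H \<Longrightarrow> (\<Sum>t<T. \<integral>\<^sup>+x. \<integral>\<^sup>+a. pos h (x, a) \<partial>k t x \<partial>law k t) \<le> pair_integral p (\<kappa>, \<phi>) (pos h)"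
proof -
  interpret p: prob_space p by (rule prob_space_p)
  define S where "S = total_dens k"
  define N where "N = occ_kernel k"
  have S_m: "S \<in> borel_measurable X" unfolding S_def by (rule total_dens_measurable)
  have act: "actions M \<in> sets A" using sets.top[of A] by simp
  have N_sets: "sets (N x) = sets A" for x by (simp add: N_def occ_kernel_def)
  have N_em: "emeasure (N x) C = (\<Sum>t. dens k t x * emeasure (k t x) C)" if "x \<in> states M" "C \<in> sets A" for x C
    unfolding N_def occ_kernel_def using that markov_sets[OF k that(1)]
    by (subst emeasure_sum_measure) simp_all
  have N_total: "emeasure (N x) (actions M) = S x" if "x \<in> states M" for x
    using N_em[OF that act] markov_total[OF k that] by (simp add: S_def total_dens_def)
  have N_null: "emeasure (N x) (actions M - admissible M x) = 0" if x: "x \<in> states M" for x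
    using N_em[OF x, of "actions M - admissible M x"] markov_null[OF k x] act admissible_sets[OF x] by simp
  \<comment> \<open>The finite part \<open>F\<close> may have infinite occupation as a whole. On the
    layer \<open>L i\<close> the density is below \<open>i + 1\<close>, so each layer has finite
    occupation, and with it the expected number of jumps into the layer.\<close>
  define L where "L i = {x \<in> space X. of_nat i \<le> S x \<and> S x < of_nat (Suc i)}" for i :: nat
  have L: "L i \<in> sets X" for i unfolding L_def using S_m by measurable
  define F where "F = {x \<in> space X. S x < \<infinity>}"
  have F: "F \<in> sets X" unfolding F_def using S_m by measurable
  have F_L: "F = (\<Union>i. L i)"
  proof (intro equalityI subsetI)
    fix x assume x: "x \<in> F"
    then obtain r where r: "S x = ennreal r" "0 \<le> r" by (cases "S x") (auto simp: F_def)
    have "of_nat (nat \<lfloor>r\<rfloor>) \<le> r" "r < of_nat (Suc (nat \<lfloor>r\<rfloor>))" using r(2) by linarith+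
    then have "x \<in> L (nat \<lfloor>r\<rfloor>)" using x r by (simp add: L_def F_def ennreal_of_nat_eq_real_of_nat ennreal_less_iff del: of_nat_Suc)
    then show "x \<in> (\<Union>i. L i)" by blast
  next
    fix x assume "x \<in> (\<Union>i. L i)"
    then obtain i where i: "x \<in> L i" by blast
    have "(of_nat (Suc i) :: ennreal) < \<infinity>" by (simp add: less_top[symmetric] del: of_nat_Suc)
    with i show "x \<in> F" unfolding L_def F_def using less_trans by blast
  qed
  have fin_L: "occ k (\<lambda>z. emeasure (Q z) (L i)) < \<infinity>" for i
  proof -
    have "occ k (\<lambda>z. emeasure (Q z) (L i)) \<le> occ k (\<lambda>z. indicator (L i) (fst z))"
      unfolding occ_balance[OF k L] by simp
    also have "\<dots> = (\<Sum>t. \<integral>\<^sup>+x. dens k t x * indicator (L i) x \<partial>p)"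
      using L by (subst occ_state[OF k]) (simp_all add: nn_integral_law[OF k])
    also have "\<dots> = (\<integral>\<^sup>+x. (\<Sum>t. dens k t x * indicator (L i) x) \<partial>p)"
      using L dens_measurable[of k] by (intro nn_integral_suminf[symmetric]) (simp add: measurable_p)
    also have "\<dots> = (\<integral>\<^sup>+x. S x * indicator (L i) x \<partial>p)"
      by (simp add: S_def total_dens_def)
    also have "\<dots> \<le> (\<integral>\<^sup>+x. of_nat (Suc i) \<partial>p)"
      by (intro nn_integral_mono) (auto simp: L_def less_imp_le split: split_indicator simp del: of_nat_Suc)
    also have "\<dots> < \<infinity>" by (simp add: p.emeasure_space_1 less_top[symmetric] del: of_nat_Suc)
    finally show ?thesis .
  qed
  have fin_AE: "AE x in p. (\<integral>\<^sup>+a. f (x, a) \<partial>N x) \<noteq> \<infinity>"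
    if f: "f \<in> borel_measurable XA" and fin: "occ k f < \<infinity>" for f
    unfolding N_def
  proof (rule nn_integral_PInf_AE)
    show "(\<lambda>x. \<integral>\<^sup>+a. f (x, a) \<partial>occ_kernel k x) \<in> borel_measurable p"
      unfolding measurable_p by (rule occ_kernel_integral_measurable[OF k f])
    show "(\<integral>\<^sup>+x. \<integral>\<^sup>+a. f (x, a) \<partial>occ_kernel k x \<partial>p) \<noteq> \<infinity>"
      using fin occ_kernel_integral[OF k f] by simp
  qed
  have actions: "actions M \<in> sets borel" using model by (simp add: control_model_def)
  obtain y where y: "y \<in> borel_measurable X"
    and y_inf: "\<And>x. x \<in> states M \<Longrightarrow> S x = \<infinity> \<Longrightarrow> y x \<in> admissible M x"
      "\<And>x U. x \<in> states M \<Longrightarrow> S x = \<infinity> \<Longrightarrow> open U \<Longrightarrow> y x \<in> U \<Longrightarrow> emeasure (N x) (U \<inter> actions M) = \<infinity>"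
  proof -
    have "\<exists>y\<in>borel_measurable X. \<forall>x\<in>space X. emeasure (N x) (actions M) = \<infinity> \<longrightarrow>
        y x \<in> admissible M x \<and> (\<forall>U. open U \<longrightarrow> y x \<in> U \<longrightarrow> emeasure (N x) (U \<inter> actions M) = \<infinity>)"
    proof (rule infinite_mass_selector[OF actions N_sets])
      show "(\<lambda>x. emeasure (N x) C) \<in> borel_measurable X" if C: "C \<in> sets A" for C
      proof -
        have "(\<lambda>x. \<Sum>t. dens k t x * emeasure (k t x) C) \<in> borel_measurable X"
          using dens_measurable[of k] markov_measurable[OF k C] by measurable
        moreover have "(\<lambda>x. emeasure (N x) C) \<in> borel_measurable X \<longleftrightarrow>
            (\<lambda>x. \<Sum>t. dens k t x * emeasure (k t x) C) \<in> borel_measurable X"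
          by (rule measurable_cong) (simp add: N_em C)
        ultimately show ?thesis by simp
      qed
    qed (use compact N_null in simp_all)
    then obtain y where "y \<in> borel_measurable X" "\<forall>x\<in>space X. emeasure (N x) (actions M) = \<infinity> \<longrightarrow>
        y x \<in> admissible M x \<and> (\<forall>U. open U \<longrightarrow> y x \<in> U \<longrightarrow> emeasure (N x) (U \<inter> actions M) = \<infinity>)"
      by (elim bexE)
    then show thesis using N_total by (intro that[of y]) simp_all
  qed
  obtain s0 where s0: "s0 \<in> X \<rightarrow>\<^sub>M A" "\<And>x. x \<in> states M \<Longrightarrow> s0 x \<in> admissible M x"
    using obtain_selector by blast
  define s where "s x = (if S x = \<infinity> then y x else s0 x)" for x
  have s_adm: "s x \<in> admissible M x" if "x \<in> states M" for x
    using y_inf(1)[OF that] s0(2)[OF that] by (simp add: s_def)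
  have s_m: "s \<in> X \<rightarrow>\<^sub>M A"
  proof (rule measurable_restrict_space2)
    show "s \<in> space X \<rightarrow> actions M" using s_adm admissible_sub by auto
    have "s0 \<in> borel_measurable X" using s0(1) by (simp add: measurable_restrict_space2_iff)
    then show "s \<in> borel_measurable X" unfolding s_def[abs_def] using S_m y by measurable
  qed
  \<comment> \<open>The probability of jumping into \<open>L i\<close> has, at almost every state, a
    finite integral against the occupation kernel and is continuous in the action; so it vanishes at
    a point of infinite mass. \<open>F\<close> is the union of the layers.\<close>
  have s_good_Q: "AE x in p. S x = \<infinity> \<longrightarrow> emeasure (Q (x, s x)) F = 0"
  proof -
    have "AE x in p. \<forall>i. (\<integral>\<^sup>+a. emeasure (Q (x, a)) (L i) \<partial>N x) \<noteq> \<infinity>"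
      using fin_AE[OF emeasure_Q_measurable[OF L] fin_L] by (subst AE_all_countable) (rule allI)
    then show ?thesis
      using AE_space
    proof (eventually_elim, intro impI)
      fix x assume fin: "\<forall>i. (\<integral>\<^sup>+a. emeasure (Q (x, a)) (L i) \<partial>N x) \<noteq> \<infinity>" and "x \<in> space p"
        and Sx: "S x = \<infinity>"
      then have x: "x \<in> states M" by (simp add: space_p)
      have sx: "s x = y x" using Sx by (simp add: s_def)
      have prob: "prob_space (Q (x, a))" if "a \<in> admissible M x" for a
        using measurable_space[OF Q_measurable, of "(x, a)"] x admissible_sub[OF x that] by (simp add: space_prob_algebra)
      have em: "emeasure (Q (x, a)) \<Lambda> = ennreal (measure (transition M (x, a)) \<Lambda>)" if "a \<in> admissible M x" for a \<Lambda>
        using finite_measure.emeasure_eq_measure[OF prob_space.finite_measure[OF prob[OF that]], of \<Lambda>] that x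
        by (simp add: Q_def)
      have "emeasure (Q (x, s x)) (L i) = 0" for i
      proof (rule ccontr)
        assume n0: "emeasure (Q (x, s x)) (L i) \<noteq> 0"
        define m where "m a = measure (transition M (x, a)) (L i)" for a
        have ms: "0 < m (s x)" using n0 em[OF s_adm[OF x]] by (simp add: m_def zero_less_measure_iff)
        have "continuous_on (admissible M x) m" unfolding m_def by (rule continuous[OF x L])
        then have "(m \<longlongrightarrow> m (s x)) (at (s x) within admissible M x)"
          using s_adm[OF x] unfolding continuous_on_def by blast
        then have "\<forall>\<^sub>F b in at (s x) within admissible M x. m (s x) / 2 < m b"
          by (rule order_tendstoD) (use ms in simp)
        then obtain U where U: "open U" "s x \<in> U"
          and U': "\<And>b. b \<in> U \<Longrightarrow> b \<noteq> s x \<Longrightarrow> b \<in> admissible M x \<Longrightarrow> m (s x) / 2 < m b"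
          unfolding eventually_at_topological by blast
        have Um: "m (s x) / 2 < m b" if "b \<in> U" "b \<in> admissible M x" for b
          using U'[OF that(1) _ that(2)] ms by (cases "b = s x") auto
        have "(\<integral>\<^sup>+a. emeasure (Q (x, a)) (L i) \<partial>occ_kernel k x) = \<infinity>"
        proof (rule null_or_infinite[OF k x section_measurable[OF emeasure_Q_measurable[OF L] x] _ U(1)])
          show "0 < ennreal (m (s x) / 2)" using ms by simp
          show "emeasure (occ_kernel k x) (U \<inter> actions M) = \<infinity>"
            using y_inf(2)[OF x Sx U(1)] U(2) sx by (simp add: N_def)
          show "ennreal (m (s x) / 2) \<le> emeasure (Q (x, b)) (L i)" if "b \<in> U" "b \<in> admissible M x" for b
            using Um[OF that] by (simp add: em[OF that(2)] m_def[symmetric] ennreal_leI less_imp_le)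
          show "emeasure (occ_kernel k x) (actions M - admissible M x) = 0" using N_null[OF x] by (simp add: N_def)
        qed
        then show False using fin by (simp add: N_def)
      qed
      moreover have "sets (Q (x, s x)) = sets X"
        using measurable_space[OF Q_measurable, of "(x, s x)"] x admissible_sub[OF x s_adm[OF x]]
        by (simp add: space_prob_algebra)
      ultimately show "emeasure (Q (x, s x)) F = 0"
        unfolding F_L using L by (intro emeasure_UN_eq_0) auto
    qed
  qed
  \<comment> \<open>If \<open>h\<close> were negative at the chosen action, upper semicontinuity
    would keep it below half that value on a neighbourhood, and the negative part would have an
    infinite integral.\<close>
  have s_good_neg: "AE x in p. \<forall>h\<in>H. S x = \<infinity> \<longrightarrow> neg h (x, s x) = 0"
  proof -
    have "AE x in p. \<forall>h\<in>H. (\<integral>\<^sup>+a. neg h (x, a) \<partial>N x) \<noteq> \<infinity>"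
      using fin_AE[OF neg_measurable[OF H_meas] H_neg] by (subst AE_ball_countable[OF countable_finite[OF H]]) blast
    then show ?thesis
      using AE_space
    proof (eventually_elim, intro ballI impI)
      fix x h assume fin: "\<forall>h\<in>H. (\<integral>\<^sup>+a. neg h (x, a) \<partial>N x) \<noteq> \<infinity>" and "x \<in> space p"
        and h: "h \<in> H" and Sx: "S x = \<infinity>"
      then have x: "x \<in> states M" by (simp add: space_p)
      have sx: "s x = y x" using Sx by (simp add: s_def)
      show "neg h (x, s x) = 0"
      proof (rule ccontr)
        assume "neg h (x, s x) \<noteq> 0"
        then have n: "h (x, s x) < 0" using s_adm[OF x] x by (auto simp: neg_def max_def split: if_splits)
        define c where "c = h (x, s x) / 2"
        have c: "h (x, s x) < c" "c < 0" using n by (simp_all add: c_def)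
        have "\<forall>\<^sub>F b in at (s x) within admissible M x. h (x, b) < c"
          using H_usc[OF h x] s_adm[OF x] c(1) unfolding usc_on_def by blast
        then obtain U where U: "open U" "s x \<in> U"
          "\<And>b. b \<in> U \<Longrightarrow> b \<noteq> s x \<Longrightarrow> b \<in> admissible M x \<Longrightarrow> h (x, b) < c"
          unfolding eventually_at_topological by blast
        have hc: "h (x, b) < c" if "b \<in> U" "b \<in> admissible M x" for b
          using U(3)[OF that(1) _ that(2)] c(1) by (cases "b = s x") auto
        have "(\<integral>\<^sup>+a. neg h (x, a) \<partial>occ_kernel k x) = \<infinity>"
        proof (rule null_or_infinite[OF k x section_measurable[OF neg_measurable[OF H_meas[OF h]] x] _ U(1)])
          show "0 < ennreal (- c)" using c by simp
          show "emeasure (occ_kernel k x) (U \<inter> actions M) = \<infinity>"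
            using y_inf(2)[OF x Sx U(1)] U(2) sx by (simp add: N_def)
          show "ennreal (- c) \<le> neg h (x, b)" if "b \<in> U" "b \<in> admissible M x" for b
            using hc[OF that] c that x by (simp add: neg_def ennreal_leI)
          show "emeasure (occ_kernel k x) (actions M - admissible M x) = 0" using N_null[OF x] by (simp add: N_def)
        qed
        then show False using fin h by (simp add: N_def)
      qed
    qed
  qed
  \<comment> \<open>Switched are only states of infinite density under the original
    \<open>k\<close>, and only from \<open>T\<close> on, so the first \<open>T\<close> stages stay
    as they are.\<close>
  define k' where "k' t x = (if T \<le> t \<and> S x = \<infinity> then return A (s x) else k t x)" for t x
  have k'_early: "k' t = k t" if "t < T" for t using that by (auto simp: k'_def fun_eq_iff)
  have k': "markov (k' t)" for t
    unfolding markov_def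
  proof (intro conjI ballI)
    have "(\<lambda>x. return A (s x)) \<in> X \<rightarrow>\<^sub>M prob_algebra A"
      by (rule measurable_compose[OF s_m measurable_return_prob_space])
    moreover have "{x \<in> space X. T \<le> t \<and> S x = \<infinity>} \<in> sets X" using S_m by measurable
    ultimately show "k' t \<in> X \<rightarrow>\<^sub>M prob_algebra A"
      unfolding k'_def[abs_def] by (intro measurable_If markovD[OF k])
    fix x assume x: "x \<in> states M"
    then show "emeasure (k' t x) (admissible M x) = 1"
      using k[of t] s_adm[OF x] admissible_sets[OF x] by (auto simp: k'_def markov_def)
  qed
  have law_early: "law k' t = law k t" if "t \<le> T" for t
    by (rule law_cong) (use that k'_early in simp)
  have dens_early: "dens k' t = dens k t" if "t \<le> T" for t
    unfolding dens_def law_early[OF that] ..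
  have k'_int: "(\<integral>\<^sup>+a. f a \<partial>k' t x) = f (s x)" if "T \<le> t" "S x = \<infinity>" "x \<in> states M" "f \<in> borel_measurable A" for t x f
    using that s_m[THEN measurable_space, of x] by (simp add: k'_def nn_integral_return)
  \<comment> \<open>The switched states send nothing into \<open>F\<close>, and at states of
    \<open>F\<close> both policies act alike; so the mass in \<open>F\<close> can only shrink from
    stage to stage.\<close>
  have dens_le: "AE x in p. S x < \<infinity> \<longrightarrow> dens k' t x \<le> dens k t x" for t
  proof (induction t)
    case 0 show ?case using dens_early[of 0] by simp
  next
    case (Suc t)
    show ?case
    proof (cases "Suc t \<le> T")
      case True then show ?thesis by (simp add: dens_early)
    next
      case False
      then have tT: "T \<le> t" by simp
      have "AE x in p. dens k' (Suc t) x * indicator F x \<le> dens k (Suc t) x * indicator F x"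
      proof (rule AE_le_of_set_nn_integral[OF p.finite_measure_axioms])
        show "(\<lambda>x. dens k' (Suc t) x * indicator F x) \<in> borel_measurable p"
          "(\<lambda>x. dens k (Suc t) x * indicator F x) \<in> borel_measurable p"
          using dens_measurable[of k' "Suc t"] dens_measurable[of k "Suc t"] F by (simp_all add: measurable_p)
        fix \<Lambda> assume "\<Lambda> \<in> sets p"
        then have \<Lambda>: "\<Lambda> \<inter> F \<in> sets X" using F by (simp add: sets_p sets.Int)
        have law_dens: "(\<integral>\<^sup>+x\<in>\<Lambda>. (dens j (Suc t) x * indicator F x) \<partial>p) =
            (\<integral>\<^sup>+x. dens j t x * (\<integral>\<^sup>+a. emeasure (Q (x, a)) (\<Lambda> \<inter> F) \<partial>j t x) \<partial>p)"
          if j: "\<And>t. markov (j t)" for j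
        proof -
          have "(\<integral>\<^sup>+x\<in>\<Lambda>. (dens j (Suc t) x * indicator F x) \<partial>p) = (\<integral>\<^sup>+x. dens j (Suc t) x * indicator (\<Lambda> \<inter> F) x \<partial>p)"
            by (intro nn_integral_cong) (auto split: split_indicator)
          also have "\<dots> = emeasure (law j (Suc t)) (\<Lambda> \<inter> F)"
            using nn_integral_law[of j "indicator (\<Lambda> \<inter> F)" "Suc t", OF j] \<Lambda> sets_law[of j, OF j, of "Suc t"]
            by (simp del: law.simps)
          also have "\<dots> = (\<integral>\<^sup>+x. \<integral>\<^sup>+a. emeasure (Q (x, a)) (\<Lambda> \<inter> F) \<partial>j t x \<partial>law j t)"
            by (rule law_emeasure_Suc[OF j \<Lambda>])
          also have "\<dots> = (\<integral>\<^sup>+x. dens j t x * (\<integral>\<^sup>+a. emeasure (Q (x, a)) (\<Lambda> \<inter> F) \<partial>j t x) \<partial>p)"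
            by (rule nn_integral_law[OF j nn_integral_prob_kernel_measurable[OF markovD[OF j] emeasure_Q_measurable[OF \<Lambda>]]])
          finally show ?thesis .
        qed
        show "(\<integral>\<^sup>+x\<in>\<Lambda>. (dens k' (Suc t) x * indicator F x) \<partial>p) \<le> (\<integral>\<^sup>+x\<in>\<Lambda>. (dens k (Suc t) x * indicator F x) \<partial>p)"
          unfolding law_dens[OF k'] law_dens[OF k]
        proof (rule nn_integral_mono_AE)
          show "AE x in p. dens k' t x * (\<integral>\<^sup>+a. emeasure (Q (x, a)) (\<Lambda> \<inter> F) \<partial>k' t x) \<le>
              dens k t x * (\<integral>\<^sup>+a. emeasure (Q (x, a)) (\<Lambda> \<inter> F) \<partial>k t x)"
            using Suc s_good_Q AE_space
          proof eventually_elim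
            case (elim x)
            then have x: "x \<in> states M" by (simp add: space_p)
            show ?case
            proof (cases "S x = \<infinity>")
              case True
              have "emeasure (Q (x, s x)) (\<Lambda> \<inter> F) \<le> emeasure (Q (x, s x)) F"
                using F measurable_space[OF Q_measurable, of "(x, s x)"] x admissible_sub[OF x s_adm[OF x]]
                by (intro emeasure_mono) (auto simp: space_prob_algebra)
              then have "emeasure (Q (x, s x)) (\<Lambda> \<inter> F) = 0" using elim(2) True by simp
              then show ?thesis
                using k'_int[OF tT True x section_measurable[OF emeasure_Q_measurable[OF \<Lambda>] x]] by simp
            next
              case False
              then have "k' t x = k t x" by (simp add: k'_def)
              then show ?thesis using elim(1) False by (simp add: less_top mult_right_mono)
            qed
          qed
        qed
      qed
      then show ?thesis
        using AE_space by eventually_elim (auto simp: F_def space_p split: split_indicator_asm)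
    qed
  qed
  have dens_le_all: "AE x in p. \<forall>t. S x < \<infinity> \<longrightarrow> dens k' t x \<le> dens k t x"
    using dens_le by (subst AE_all_countable) (rule allI)
  \<comment> \<open>The hypothesis of \<open>markov_pair\<close>: finite total density on
    \<open>F\<close> by comparison with \<open>k\<close>, a constant rule from \<open>T\<close> on
    at all other states.\<close>
  have C: "AE x in p. total_dens k' x < \<infinity> \<or> (\<forall>t\<ge>T. k' t x = k' T x)"
    using dens_le_all
  proof eventually_elim
    case (elim x)
    show ?case
    proof (cases "S x = \<infinity>")
      case True then show ?thesis by (simp add: k'_def)
    next
      case False
      then have Sx: "S x < \<infinity>" by (simp add: less_top)
      have "total_dens k' x \<le> S x"
      proof -
        have "dens k' t x \<le> dens k t x" for t using elim Sx by blast
        then show ?thesis unfolding S_def total_dens_def by (intro suminf_le summableI)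
      qed
      then show ?thesis using False by (simp add: less_top le_less_trans)
    qed
  qed
  show thesis
  proof (rule markov_pair[of k' T, OF k' C])
    fix \<kappa> \<phi> assume bal: "balanced p (\<kappa>, \<phi>)"
      and int: "\<And>f. f \<in> borel_measurable XA \<Longrightarrow> pair_integral p (\<kappa>, \<phi>) f = occ k' f"
  show thesis
  proof (rule that[OF bal])
    fix h assume h: "h \<in> H"
    show "pair_integral p (\<kappa>, \<phi>) (neg h) \<le> occ k (neg h)"
      unfolding int[OF neg_measurable[OF H_meas[OF h]]] occ_eq_dens[OF k neg_measurable[OF H_meas[OF h]]]
        occ_eq_dens[OF k' neg_measurable[OF H_meas[OF h]]]
    proof (rule nn_integral_mono_AE)
      show "AE x in p. (\<Sum>t. dens k' t x * (\<integral>\<^sup>+a. neg h (x, a) \<partial>k' t x)) \<le>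
          (\<Sum>t. dens k t x * (\<integral>\<^sup>+a. neg h (x, a) \<partial>k t x))"
        using dens_le_all s_good_neg AE_space
      proof eventually_elim
        case (elim x)
        then have x: "x \<in> states M" by (simp add: space_p)
        have "dens k' t x * (\<integral>\<^sup>+a. neg h (x, a) \<partial>k' t x) \<le> dens k t x * (\<integral>\<^sup>+a. neg h (x, a) \<partial>k t x)" for t
        proof (cases "T \<le> t \<and> S x = \<infinity>")
          case True
          then show ?thesis
            using k'_int[of t x, OF _ _ x section_measurable[OF neg_measurable[OF H_meas[OF h]] x]] elim(2) h by simp
        next
          case False
          then have e: "k' t x = k t x" unfolding k'_def by (rule if_not_P)
          have "dens k' t x \<le> dens k t x"
          proof (cases "T \<le> t")
            case True
            with False have "S x < \<infinity>" by (simp add: less_top)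
            then show ?thesis using elim(1) by blast
          next
            case False then show ?thesis using dens_early[of t] by simp
          qed
          then show ?thesis unfolding e by (rule mult_right_mono) simp
        qed
        then show ?case by (intro suminf_le summableI)
      qed
    qed
    have "(\<Sum>t<T. \<integral>\<^sup>+x. \<integral>\<^sup>+a. pos h (x, a) \<partial>k t x \<partial>law k t) =
        (\<Sum>t<T. \<integral>\<^sup>+x. \<integral>\<^sup>+a. pos h (x, a) \<partial>k' t x \<partial>law k' t)"
      by (intro sum.cong refl) (simp add: k'_early law_early)
    also have "\<dots> \<le> occ k' (pos h)" unfolding occ_def by (intro sum_le_suminf) auto
    finally show "(\<Sum>t<T. \<integral>\<^sup>+x. \<integral>\<^sup>+a. pos h (x, a) \<partial>k t x \<partial>law k t) \<le> pair_integral p (\<kappa>, \<phi>) (pos h)"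
      unfolding int[OF pos_measurable[OF H_meas[OF h]]] .
  qed
qed
qed

end

section \<open>The constrained program\<close>

definition ediff :: "ennreal \<Rightarrow> ennreal \<Rightarrow> ereal" where
  "ediff P N = (if P = \<infinity> \<and> N = \<infinity> then - \<infinity> else enn2ereal P - enn2ereal N)"

text \<open>An infinite second argument yields minus infinity whatever the first one is; under this
  convention monotonicity has no exception.\<close>

lemma ediff_mono:
  assumes "P \<le> P'" "N' \<le> N"
  shows "ediff P N \<le> ediff P' N'"
proof (cases "N = \<infinity>")
  case True
  then have "ediff P N = - \<infinity>" by (cases P) (auto simp: ediff_def)
  then show ?thesis by simp
next
  case False
  then have "N' \<noteq> \<infinity>" using assms by (auto simp: top_unique)
  then show ?thesis
    using False assms by (auto simp: ediff_def less_eq_ennreal.rep_eq intro!: ereal_minus_mono)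
qed

lemma ediff_ennreal: "0 \<le> P \<Longrightarrow> 0 \<le> N \<Longrightarrow> ediff (ennreal P) (ennreal N) = ereal (P - N)"
  by (simp add: ediff_def enn2ereal_ennreal)

lemma ediff_zero: "ediff P 0 = enn2ereal P"
  by (simp add: ediff_def zero_ennreal.rep_eq)

context controlled_model
begin

lemma ext_integral_eq: "ext_integral M \<mu> h = ediff (\<integral>\<^sup>+z. pos h z \<partial>\<mu>) (\<integral>\<^sup>+z. neg h z \<partial>\<mu>)"
  by (simp add: ext_integral_def ediff_def pos_def neg_def Let_def)

text \<open>Translates suprema over positive parts, stated with \<open>max 0\<close>, into bounds on
  \<open>pos\<close>.\<close>

lemma ext_integral_pos: "ext_integral M \<mu> (\<lambda>z. max 0 (h z)) = enn2ereal (\<integral>\<^sup>+z. pos h z \<partial>\<mu>)"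
proof -
  have "pos (\<lambda>z. max 0 (h z)) = pos h" by (simp add: pos_def fun_eq_iff)
  moreover have "neg (\<lambda>z. max 0 (h z)) = (\<lambda>z. 0)" by (auto simp: neg_def fun_eq_iff max_def)
  ultimately show ?thesis by (simp add: ext_integral_eq ediff_zero)
qed

lemma ext_integral_neg: "ext_integral M \<mu> (\<lambda>z. max 0 (- h z)) = enn2ereal (\<integral>\<^sup>+z. neg h z \<partial>\<mu>)"
  unfolding ext_integral_pos neg_eq ..

section \<open>Convex combinations of kernel pairs\<close>

definition mix :: "ennreal \<Rightarrow> ennreal \<Rightarrow> ('x \<Rightarrow> 'a measure) \<Rightarrow> ('x \<Rightarrow> 'a measure) \<Rightarrow> 'x \<Rightarrow> 'a measure" where
  "mix a b \<kappa> \<kappa>' x = measure_of (space A) (sets A)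
    (\<lambda>B. emeasure (scale_measure a (\<kappa> x)) B + emeasure (scale_measure b (\<kappa>' x)) B)"

lemma sets_mix: "sets (mix a b \<kappa> \<kappa>' x) = sets A"
  unfolding mix_def by (rule sets.sets_measure_of_eq)

context
  fixes a b :: ennreal and \<kappa> \<kappa>' :: "'x \<Rightarrow> 'a measure"
  assumes \<kappa>: "finite_kernel X A \<kappa>" and \<kappa>': "finite_kernel X A \<kappa>'"
begin

lemma emeasure_mix:
  assumes "x \<in> states M" "B \<in> sets A"
  shows "emeasure (mix a b \<kappa> \<kappa>' x) B = a * emeasure (\<kappa> x) B + b * emeasure (\<kappa>' x) B"
  using emeasure_add_measure[of "scale_measure a (\<kappa> x)" A "scale_measure b (\<kappa>' x)" B]
    finite_kernel_sets[OF \<kappa>] finite_kernel_sets[OF \<kappa>'] assms by (simp add: mix_def)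

lemma nn_integral_mix:
  assumes x: "x \<in> states M" and f: "f \<in> borel_measurable A"
  shows "(\<integral>\<^sup>+y. f y \<partial>mix a b \<kappa> \<kappa>' x) = a * (\<integral>\<^sup>+y. f y \<partial>\<kappa> x) + b * (\<integral>\<^sup>+y. f y \<partial>\<kappa>' x)"
proof -
  have s: "sets (\<kappa> x) = sets A" "sets (\<kappa>' x) = sets A"
    using finite_kernel_sets[OF \<kappa>] finite_kernel_sets[OF \<kappa>'] x by simp_all
  have "(\<integral>\<^sup>+y. f y \<partial>mix a b \<kappa> \<kappa>' x) =
      (\<integral>\<^sup>+y. f y \<partial>scale_measure a (\<kappa> x)) + (\<integral>\<^sup>+y. f y \<partial>scale_measure b (\<kappa>' x))"
    by (rule nn_integral_add_measure[OF _ _ sets_mix _ f]) (simp_all add: s emeasure_mix x)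
  then show ?thesis
    using f s by (simp add: nn_integral_scale_measure cong: measurable_cong_sets)
qed

lemma finite_kernel_mix:
  assumes "a < \<infinity>" "b < \<infinity>"
  shows "finite_kernel X A (mix a b \<kappa> \<kappa>')"
  unfolding finite_kernel_def
proof (intro conjI ballI)
  have act: "actions M \<in> sets A" using sets.top[of A] by simp
  fix x assume "x \<in> space X"
  then have x: "x \<in> states M" by simp
  show "sets (mix a b \<kappa> \<kappa>' x) = sets A" by (rule sets_mix)
  have sp: "space (mix a b \<kappa> \<kappa>' x) = actions M" using sets_eq_imp_space_eq[OF sets_mix] by simp
  show "finite_measure (mix a b \<kappa> \<kappa>' x)"
    by (rule finite_measureI, unfold sp emeasure_mix[OF x act])
      (use assms finite_kernel_finite[OF \<kappa>, of x] finite_kernel_finite[OF \<kappa>', of x] x in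
        \<open>auto simp: ennreal_mult_eq_top_iff less_top\<close>)
next
  fix B assume B: "B \<in> sets A"
  have "(\<lambda>x. a * emeasure (\<kappa> x) B + b * emeasure (\<kappa>' x) B) \<in> borel_measurable X"
    using finite_kernel_measurable[OF \<kappa> B] finite_kernel_measurable[OF \<kappa>' B] by measurable
  moreover have "(\<lambda>x. emeasure (mix a b \<kappa> \<kappa>' x) B) \<in> borel_measurable X \<longleftrightarrow>
      (\<lambda>x. a * emeasure (\<kappa> x) B + b * emeasure (\<kappa>' x) B) \<in> borel_measurable X"
    by (rule measurable_cong) (simp add: emeasure_mix B)
  ultimately show "(\<lambda>x. emeasure (mix a b \<kappa> \<kappa>' x) B) \<in> borel_measurable X" by simp
qed

end

text \<open>The measure of a kernel pair is affine in the pair, as scalars commute with the factor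
  \<infinity>, so balance survives. Positivity comes from the second member as soon as its weight is
  positive: a small admixture of a feasible variable makes a balanced pair feasible.\<close>

lemma
  assumes p: "sets p = sets X" and b1: "balanced p (\<kappa>, \<phi>)" and b2: "balanced p (\<kappa>', \<phi>')"
    and ab: "a + b = 1"
  shows pair_integral_mix: "f \<in> borel_measurable XA \<Longrightarrow>
      pair_integral p (mix a b \<kappa> \<kappa>', mix a b \<phi> \<phi>') f =
        a * pair_integral p (\<kappa>, \<phi>) f + b * pair_integral p (\<kappa>', \<phi>') f"
    and balanced_mix: "balanced p (mix a b \<kappa> \<kappa>', mix a b \<phi> \<phi>')"
    and feasible_mix: "b > 0 \<Longrightarrow> (\<kappa>', \<phi>') \<in> feasible_variables M p \<Longrightarrow>
      (mix a b \<kappa> \<kappa>', mix a b \<phi> \<phi>') \<in> feasible_variables M p"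
proof -
  note b1 = b1[unfolded balanced_iff[OF p]] and b2 = b2[unfolded balanced_iff[OF p]]
  have \<kappa>: "finite_kernel X A \<kappa>" "finite_kernel X A \<kappa>'" and \<phi>: "finite_kernel X A \<phi>" "finite_kernel X A \<phi>'"
    using b1 b2 by simp_all
  have fin: "a < \<infinity>" "b < \<infinity>"
  proof -
    have "a \<le> 1" "b \<le> 1" unfolding ab[symmetric] by simp_all
    moreover have "(1 :: ennreal) < \<infinity>" by simp
    ultimately show "a < \<infinity>" "b < \<infinity>" by (blast intro: le_less_trans)+
  qed
  have act: "actions M \<in> sets A" using sets.top[of A] by simp
  show int: "pair_integral p (mix a b \<kappa> \<kappa>', mix a b \<phi> \<phi>') f =
      a * pair_integral p (\<kappa>, \<phi>) f + b * pair_integral p (\<kappa>', \<phi>') f" if f: "f \<in> borel_measurable XA" for f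
  proof -
    define G where "G \<kappa> \<phi> x = \<infinity> * (\<integral>\<^sup>+y. f (x, y) \<partial>\<kappa> x) + (\<integral>\<^sup>+y. f (x, y) \<partial>\<phi> x)"
      for \<kappa> \<phi> :: "'x \<Rightarrow> 'a measure" and x :: 'x
    have G: "G \<kappa> \<phi> \<in> borel_measurable p" if "finite_kernel X A \<kappa>" "finite_kernel X A \<phi>" for \<kappa> \<phi>
      unfolding G_def[abs_def] measurable_cong_sets[OF p refl]
      using finite_kernel_nn_integral[OF that(1) f] finite_kernel_nn_integral[OF that(2) f] by measurable
    have "pair_integral p (mix a b \<kappa> \<kappa>', mix a b \<phi> \<phi>') f = (\<integral>\<^sup>+x. a * G \<kappa> \<phi> x + b * G \<kappa>' \<phi>' x \<partial>p)"
      unfolding pair_integral_def prod.case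
    proof (rule nn_integral_cong)
      fix x assume "x \<in> space p"
      then have x: "x \<in> states M" using sets_eq_imp_space_eq[OF p] by simp
      have fx: "(\<lambda>y. f (x, y)) \<in> borel_measurable A" using measurable_Pair2[of f X A borel x] f x by simp
      show "\<infinity> * (\<integral>\<^sup>+y. f (x, y) \<partial>mix a b \<kappa> \<kappa>' x) + (\<integral>\<^sup>+y. f (x, y) \<partial>mix a b \<phi> \<phi>' x) =
          a * G \<kappa> \<phi> x + b * G \<kappa>' \<phi>' x"
        unfolding nn_integral_mix[OF \<kappa> x fx] nn_integral_mix[OF \<phi> x fx] G_def
        by (simp only: distrib_left mult.left_commute[of \<infinity>] add.assoc add.left_commute)
    qed
    also have "\<dots> = a * (\<integral>\<^sup>+x. G \<kappa> \<phi> x \<partial>p) + b * (\<integral>\<^sup>+x. G \<kappa>' \<phi>' x \<partial>p)"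
      using G[OF \<kappa>(1) \<phi>(1)] G[OF \<kappa>(2) \<phi>(2)]
      by (subst nn_integral_add) (simp_all add: borel_measurable_times_ennreal nn_integral_cmult)
    finally show ?thesis by (simp add: pair_integral_def G_def)
  qed
  show bal: "balanced p (mix a b \<kappa> \<kappa>', mix a b \<phi> \<phi>')"
    unfolding balanced_iff[OF p]
  proof (intro conjI finite_kernel_mix \<kappa> \<phi> fin ballI)
    fix x assume x: "x \<in> states M"
    have "actions M - admissible M x \<in> sets A" using act admissible_sets[OF x] by auto
    then show "emeasure (mix a b \<kappa> \<kappa>' x) (actions M - admissible M x) +
        emeasure (mix a b \<phi> \<phi>' x) (actions M - admissible M x) = 0"
      using b1 b2 x by (simp add: emeasure_mix[OF \<kappa> x] emeasure_mix[OF \<phi> x])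
  next
    fix \<Lambda> assume \<Lambda>: "\<Lambda> \<in> sets X"
    have i: "(\<lambda>z. indicator \<Lambda> (fst z) :: ennreal) \<in> borel_measurable XA" using \<Lambda> by measurable
    have e1: "pair_integral p (\<kappa>, \<phi>) (\<lambda>z. indicator \<Lambda> (fst z)) =
        emeasure (initial M) \<Lambda> + pair_integral p (\<kappa>, \<phi>) (\<lambda>z. emeasure (Q z) \<Lambda>)" using b1 \<Lambda> by blast
    have e2: "pair_integral p (\<kappa>', \<phi>') (\<lambda>z. indicator \<Lambda> (fst z)) =
        emeasure (initial M) \<Lambda> + pair_integral p (\<kappa>', \<phi>') (\<lambda>z. emeasure (Q z) \<Lambda>)" using b2 \<Lambda> by blast
    define q q' where "q = pair_integral p (\<kappa>, \<phi>) (\<lambda>z. emeasure (Q z) \<Lambda>)"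
      and "q' = pair_integral p (\<kappa>', \<phi>') (\<lambda>z. emeasure (Q z) \<Lambda>)"
    have "a * (emeasure (initial M) \<Lambda> + q) + b * (emeasure (initial M) \<Lambda> + q') =
        (a + b) * emeasure (initial M) \<Lambda> + (a * q + b * q')"
      by (simp only: distrib_left distrib_right add.assoc add.left_commute)
    then show "pair_integral p (mix a b \<kappa> \<kappa>', mix a b \<phi> \<phi>') (\<lambda>z. indicator \<Lambda> (fst z)) =
        emeasure (initial M) \<Lambda> + pair_integral p (mix a b \<kappa> \<kappa>', mix a b \<phi> \<phi>') (\<lambda>z. emeasure (Q z) \<Lambda>)"
      unfolding int[OF i] int[OF emeasure_Q_measurable[OF \<Lambda>]] e1 e2 q_def[symmetric] q'_def[symmetric] ab
      by simp
  qed
  show "(mix a b \<kappa> \<kappa>', mix a b \<phi> \<phi>') \<in> feasible_variables M p"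
    if b: "b > 0" and F: "(\<kappa>', \<phi>') \<in> feasible_variables M p"
    unfolding feasible_variables_iff
  proof (intro conjI bal ballI)
    fix x assume x: "x \<in> states M"
    have "0 < emeasure (\<kappa>' x) (actions M) + emeasure (\<phi>' x) (actions M)"
      using F x unfolding feasible_variables_iff by blast
    then have "0 < b * emeasure (\<kappa>' x) (actions M) + b * emeasure (\<phi>' x) (actions M)"
      using b by (auto simp: zero_less_iff_neq_zero)
    then show "0 < emeasure (mix a b \<kappa> \<kappa>' x) (actions M) + emeasure (mix a b \<phi> \<phi>' x) (actions M)"
      by (auto simp: emeasure_mix[OF \<kappa> x act] emeasure_mix[OF \<phi> x act] zero_less_iff_neq_zero)
  qed
qed

end

section \<open>A feasible variable from the policy that generates \<open>p\<close>\<close>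

context reference_model
begin

text \<open>A set on which the densities of all state laws of \<open>spread\<close> vanish is null
  for each of these laws, hence for their mixture \<open>p\<close>.\<close>

lemma total_dens_spread: "AE x in p. total_dens (\<lambda>_. spread) x > 0"
proof -
  define Z where "Z = {x \<in> space X. total_dens (\<lambda>_. spread) x = 0}"
  have Z: "Z \<in> sets X" unfolding Z_def using total_dens_measurable by measurable
  have "emeasure (law (\<lambda>_. spread) t) Z = 0" for t
  proof -
    have "emeasure (law (\<lambda>_. spread) t) Z = (\<integral>\<^sup>+x. indicator Z x \<partial>law (\<lambda>_. spread) t)"
      using Z sets_law[of "\<lambda>_. spread", OF markov_spread, of t] by simp
    also have "\<dots> = (\<integral>\<^sup>+x. dens (\<lambda>_. spread) t x * indicator Z x \<partial>p)"
      by (rule nn_integral_law[OF markov_spread]) (use Z in simp)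
    also have "\<dots> = (\<integral>\<^sup>+x. 0 \<partial>p)"
    proof (rule nn_integral_cong)
      fix x
      have "dens (\<lambda>_. spread) t x = 0" if "x \<in> Z"
      proof -
        have "(\<Sum>t. dens (\<lambda>_. spread) t x) = 0" using that by (simp add: Z_def total_dens_def)
        then show ?thesis by (subst (asm) suminf_eq_zero_iff) simp_all
      qed
      then show "dens (\<lambda>_. spread) t x * indicator Z x = 0" by (auto split: split_indicator)
    qed
    finally show ?thesis by simp
  qed
  then have "Z \<in> null_sets p" using null_p_iff[OF Z] Z by (simp add: null_sets_def sets_p)
  from AE_not_in[OF this] AE_space show ?thesis
    by eventually_elim (auto simp: Z_def space_p zero_less_iff_neq_zero)
qed

text \<open>A stationary policy satisfies the hypothesis of \<open>markov_pair\<close> with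
  \<open>T = 0\<close>. Positivity can fail only on the \<open>p\<close>-null set of zero total
  density; replacing \<open>\<phi>\<close> by \<open>spread\<close> there changes no
  integral.\<close>

lemma ex_feasible_spread:
  "\<exists>\<Phi>\<in>feasible_variables M p. \<forall>f\<in>borel_measurable XA. pair_integral p \<Phi> f = occ (\<lambda>_. spread) f"
proof (rule markov_pair[of "\<lambda>_. spread" 0, OF markov_spread])
  show "AE x in p. total_dens (\<lambda>_. spread) x < \<infinity> \<or> (\<forall>t\<ge>0. spread x = spread x)" by simp
  fix \<kappa> \<phi> assume bal: "balanced p (\<kappa>, \<phi>)"
    and int: "\<And>f. f \<in> borel_measurable XA \<Longrightarrow> pair_integral p (\<kappa>, \<phi>) f = occ (\<lambda>_. spread) f"
    and pos: "\<And>x. x \<in> states M \<Longrightarrow> total_dens (\<lambda>_. spread) x > 0 \<Longrightarrow>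
      emeasure (\<kappa> x) (actions M) + emeasure (\<phi> x) (actions M) > 0"
  note b = bal[unfolded balanced_iff[OF sets_p]]
  have act: "actions M \<in> sets A" using sets.top[of A] by simp
  define \<phi>' where "\<phi>' x = (if total_dens (\<lambda>_. spread) x = 0 then spread x else \<phi> x)" for x
  have fk: "finite_kernel X A \<phi>" "finite_kernel X A spread"
    using b finite_kernel_prob[OF markovD[OF markov_spread]] by simp_all
  have \<phi>': "finite_kernel X A \<phi>'"
    unfolding finite_kernel_def
  proof (intro conjI ballI)
    fix x assume "x \<in> space X"
    then show "sets (\<phi>' x) = sets A" "finite_measure (\<phi>' x)"
      using fk unfolding finite_kernel_def \<phi>'_def by auto
  next
    fix B assume B: "B \<in> sets A"
    have "(\<lambda>x. emeasure (\<phi>' x) B) = (\<lambda>x. if total_dens (\<lambda>_. spread) x = 0 then emeasure (spread x) B else emeasure (\<phi> x) B)"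
      by (auto simp: \<phi>'_def)
    also have "\<dots> \<in> borel_measurable X"
      using total_dens_measurable[of "\<lambda>_. spread"] finite_kernel_measurable[OF fk(1) B]
        finite_kernel_measurable[OF fk(2) B] by measurable
    finally show "(\<lambda>x. emeasure (\<phi>' x) B) \<in> borel_measurable X" .
  qed
  have same: "pair_integral p (\<kappa>, \<phi>') f = pair_integral p (\<kappa>, \<phi>) f" for f
    unfolding pair_integral_def prod.case
  proof (rule nn_integral_cong_AE)
    show "AE x in p. \<infinity> * (\<integral>\<^sup>+a. f (x, a) \<partial>\<kappa> x) + (\<integral>\<^sup>+a. f (x, a) \<partial>\<phi>' x) =
        \<infinity> * (\<integral>\<^sup>+a. f (x, a) \<partial>\<kappa> x) + (\<integral>\<^sup>+a. f (x, a) \<partial>\<phi> x)"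
      using total_dens_spread by eventually_elim (simp add: \<phi>'_def zero_less_iff_neq_zero)
  qed
  have "(\<kappa>, \<phi>') \<in> feasible_variables M p"
    unfolding feasible_variables_iff balanced_iff[OF sets_p] same
  proof (intro conjI \<phi>' ballI)
    show "finite_kernel X A \<kappa>" using b by simp
    fix x assume x: "x \<in> states M"
    show "emeasure (\<kappa> x) (actions M - admissible M x) + emeasure (\<phi>' x) (actions M - admissible M x) = 0"
      using b x markov_null[OF markov_spread x] by (simp add: \<phi>'_def)
    show "0 < emeasure (\<kappa> x) (actions M) + emeasure (\<phi>' x) (actions M)"
      using pos[OF x] markov_total[OF markov_spread x]
      by (auto simp: \<phi>'_def zero_less_iff_neq_zero)
  next
    fix \<Lambda> assume "\<Lambda> \<in> sets X"
    then show "pair_integral p (\<kappa>, \<phi>) (\<lambda>z. indicator \<Lambda> (fst z)) =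
        emeasure (initial M) \<Lambda> + pair_integral p (\<kappa>, \<phi>) (\<lambda>z. emeasure (Q z) \<Lambda>)" using b by blast
  qed
  then show ?thesis
    by (rule bexI[rotated]) (use int same in simp)
qed

end

section \<open>Reward and constraints as one finite family of criteria\<close>

locale constrained_program = reference_model M \<xi> p
  for M :: "('x::polish_space, 'a::polish_space) cmdm" and \<xi> p +
  fixes H :: "('x \<times> 'a \<Rightarrow> real) set"
  assumes finite_H: "finite H"
    and H_measurable: "\<And>h. h \<in> H \<Longrightarrow> h \<in> borel_measurable (feasible_space M)"
    and H_usc: "\<And>h x. h \<in> H \<Longrightarrow> x \<in> states M \<Longrightarrow> usc_on (admissible M x) (\<lambda>a. h (x, a))"
    and pos_bounded: "\<And>h. h \<in> H \<Longrightarrow> \<exists>C<\<infinity>. \<forall>\<Psi>\<in>feasible_variables M p. pair_integral p \<Psi> (pos h) \<le> C"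
    and neg_finite: "\<And>\<pi> h. \<pi> \<in> policies M \<Longrightarrow> h \<in> H \<Longrightarrow> (\<integral>\<^sup>+z. neg h z \<partial>occupation_measure M \<pi>) < \<infinity>"
begin

lemma pos_m: "h \<in> H \<Longrightarrow> pos h \<in> borel_measurable XA" and neg_m: "h \<in> H \<Longrightarrow> neg h \<in> borel_measurable XA"
  by (simp_all add: pos_measurable neg_measurable H_measurable)

lemma ext_integral_pair:
  assumes "balanced p \<Phi>" "h \<in> H"
  shows "ext_integral M (kernel_pair_measure M p \<Phi>) h =
    ediff (pair_integral p \<Phi> (pos h)) (pair_integral p \<Phi> (neg h))"
proof -
  obtain \<kappa> \<phi> where \<Phi>: "\<Phi> = (\<kappa>, \<phi>)" by (cases \<Phi>)
  have "finite_kernel X A \<kappa>" "finite_kernel X A \<phi>" using assms(1) by (simp_all add: \<Phi> balanced_iff[OF sets_p])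
  then show ?thesis
    unfolding ext_integral_eq \<Phi> using assms(2) by (simp add: nn_integral_pair sets_p pos_m neg_m)
qed

lemma feasible_balanced: "\<Phi> \<in> feasible_variables M p \<Longrightarrow> balanced p \<Phi>"
  by (cases \<Phi>) (simp add: feasible_variables_iff)

text \<open>Positive parts agree, since they are bounded over all feasible variables; negative parts
  can only shrink; and \<open>ediff\<close> is monotone.\<close>

lemma induced_improves:
  assumes \<Phi>: "\<Phi> \<in> feasible_variables M p"
  shows induced_policy_in: "induced_policy \<Phi> \<in> policies M"
    and "h \<in> H \<Longrightarrow> ext_integral M (kernel_pair_measure M p \<Phi>) h \<le> criterion M h (induced_policy \<Phi>)"
proof -
  obtain \<kappa> \<phi> where eq: "\<Phi> = (\<kappa>, \<phi>)" by (cases \<Phi>)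
  note F = \<Phi>[unfolded eq]
  note st = stationary_markov[OF markov_induced[OF F]]
  show "induced_policy \<Phi> \<in> policies M" unfolding eq induced_policy_eq by (rule st(1))
  assume h: "h \<in> H"
  obtain C where C: "C < \<infinity>" "\<And>\<Psi>. \<Psi> \<in> feasible_variables M p \<Longrightarrow> pair_integral p \<Psi> (pos h) \<le> C"
    using pos_bounded[OF h] by blast
  have "pair_integral p \<Phi> (pos h) = occ (\<lambda>_. induced (\<kappa>, \<phi>)) (pos h)"
    unfolding eq by (rule occ_induced_eq[OF F pos_m[OF h] C(2,1), symmetric])
  moreover have "occ (\<lambda>_. induced (\<kappa>, \<phi>)) (neg h) \<le> pair_integral p \<Phi> (neg h)"
    unfolding eq by (rule occ_induced_le[OF F neg_m[OF h]])
  ultimately have "ediff (pair_integral p \<Phi> (pos h)) (pair_integral p \<Phi> (neg h)) \<le>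
      ediff (occ (\<lambda>_. induced (\<kappa>, \<phi>)) (pos h)) (occ (\<lambda>_. induced (\<kappa>, \<phi>)) (neg h))"
    by (intro ediff_mono) simp_all
  also have "\<dots> = criterion M h (induced_policy \<Phi>)"
    unfolding criterion_def ext_integral_eq eq induced_policy_eq st(3)[OF pos_m[OF h]] st(3)[OF neg_m[OF h]] ..
  finally show "ext_integral M (kernel_pair_measure M p \<Phi>) h \<le> criterion M h (induced_policy \<Phi>)"
    unfolding ext_integral_pair[OF feasible_balanced[OF \<Phi>] h] .
qed

text \<open>The vector \<open>v\<close> collects the values of all criteria as reals. Requiring
  finite positive and negative parts keeps infinite values out of convex combinations.\<close>

definition attains :: "('x, 'a) kernel_pair \<Rightarrow> (('x \<times> 'a \<Rightarrow> real) \<Rightarrow> real) \<Rightarrow> bool" where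
  "attains \<Phi> v \<longleftrightarrow> balanced p \<Phi> \<and> (\<forall>h\<in>H. \<exists>P N. 0 \<le> P \<and> 0 \<le> N \<and>
     pair_integral p \<Phi> (pos h) = ennreal P \<and> pair_integral p \<Phi> (neg h) = ennreal N \<and> v h = P - N)"

lemma attains_ext_integral:
  "attains \<Phi> v \<Longrightarrow> h \<in> H \<Longrightarrow> ext_integral M (kernel_pair_measure M p \<Phi>) h = ereal (v h)"
  using ext_integral_pair[of \<Phi> h] unfolding attains_def by (auto dest!: bspec simp: ediff_ennreal)

lemma attainsI:
  assumes "balanced p \<Phi>"
    and "\<And>h. h \<in> H \<Longrightarrow> pair_integral p \<Phi> (pos h) < \<infinity>" "\<And>h. h \<in> H \<Longrightarrow> pair_integral p \<Phi> (neg h) < \<infinity>"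
  shows "attains \<Phi> (\<lambda>h. enn2real (pair_integral p \<Phi> (pos h)) - enn2real (pair_integral p \<Phi> (neg h)))"
  unfolding attains_def
proof (intro conjI ballI assms(1))
  fix h assume h: "h \<in> H"
  show "\<exists>P N. 0 \<le> P \<and> 0 \<le> N \<and> pair_integral p \<Phi> (pos h) = ennreal P \<and> pair_integral p \<Phi> (neg h) = ennreal N \<and>
      enn2real (pair_integral p \<Phi> (pos h)) - enn2real (pair_integral p \<Phi> (neg h)) = P - N"
    using assms(2,3)[OF h]
    by (intro exI[of _ "enn2real (pair_integral p \<Phi> (pos h))"] exI[of _ "enn2real (pair_integral p \<Phi> (neg h))"])
      (auto simp: less_top)
qed

lemma attains_mix:
  assumes v: "attains \<Phi> v" and w: "attains \<Psi> w" and c: "0 < c" "c < 1"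
  shows "\<exists>\<Theta>. attains \<Theta> (\<lambda>h. (1 - c) * v h + c * w h) \<and>
    (\<Psi> \<in> feasible_variables M p \<longrightarrow> \<Theta> \<in> feasible_variables M p)"
proof -
  obtain \<kappa> \<phi> where \<Phi>: "\<Phi> = (\<kappa>, \<phi>)" by (cases \<Phi>)
  obtain \<kappa>' \<phi>' where \<Psi>: "\<Psi> = (\<kappa>', \<phi>')" by (cases \<Psi>)
  have b: "balanced p (\<kappa>, \<phi>)" "balanced p (\<kappa>', \<phi>')" using v w by (simp_all add: attains_def \<Phi> \<Psi>)
  have one: "ennreal (1 - c) + ennreal c = 1" using c by (simp add: ennreal_plus[symmetric] del: ennreal_plus)
  define \<Theta> where "\<Theta> = (mix (ennreal (1 - c)) (ennreal c) \<kappa> \<kappa>', mix (ennreal (1 - c)) (ennreal c) \<phi> \<phi>')"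
  have "attains \<Theta> (\<lambda>h. (1 - c) * v h + c * w h)"
    unfolding attains_def
  proof (intro conjI ballI)
    show "balanced p \<Theta>" unfolding \<Theta>_def by (rule balanced_mix[OF sets_p b one])
    fix h assume h: "h \<in> H"
    obtain P N where 1: "0 \<le> P" "0 \<le> N" "pair_integral p (\<kappa>, \<phi>) (pos h) = ennreal P"
      "pair_integral p (\<kappa>, \<phi>) (neg h) = ennreal N" "v h = P - N"
      using v h unfolding attains_def \<Phi> by blast
    obtain P' N' where 2: "0 \<le> P'" "0 \<le> N'" "pair_integral p (\<kappa>', \<phi>') (pos h) = ennreal P'"
      "pair_integral p (\<kappa>', \<phi>') (neg h) = ennreal N'" "w h = P' - N'"
      using w h unfolding attains_def \<Psi> by blast
    have comb: "ennreal (1 - c) * ennreal x + ennreal c * ennreal y = ennreal ((1 - c) * x + c * y)"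
      if "0 \<le> x" "0 \<le> y" for x y
      using that c by (simp add: ennreal_mult)
    show "\<exists>P N. 0 \<le> P \<and> 0 \<le> N \<and> pair_integral p \<Theta> (pos h) = ennreal P \<and> pair_integral p \<Theta> (neg h) = ennreal N \<and>
        (1 - c) * v h + c * w h = P - N"
    proof (intro exI conjI)
      show "0 \<le> (1 - c) * P + c * P'" "0 \<le> (1 - c) * N + c * N'" using 1 2 c by simp_all
      show "pair_integral p \<Theta> (pos h) = ennreal ((1 - c) * P + c * P')"
        unfolding \<Theta>_def pair_integral_mix[OF sets_p b one pos_m[OF h]] 1(3) 2(3) by (rule comb[OF 1(1) 2(1)])
      show "pair_integral p \<Theta> (neg h) = ennreal ((1 - c) * N + c * N')"
        unfolding \<Theta>_def pair_integral_mix[OF sets_p b one neg_m[OF h]] 1(4) 2(4) by (rule comb[OF 1(2) 2(2)])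
      show "(1 - c) * v h + c * w h = ((1 - c) * P + c * P') - ((1 - c) * N + c * N')"
        unfolding 1(5) 2(5) by (simp add: algebra_simps)
    qed
  qed
  moreover have "\<Theta> \<in> feasible_variables M p" if "\<Psi> \<in> feasible_variables M p"
    unfolding \<Theta>_def using that c by (intro feasible_mix[OF sets_p b one]) (simp_all add: \<Psi>)
  ultimately show ?thesis by blast
qed

text \<open>A general feasible variable may have infinite negative parts, as their finiteness is
  assumed for occupation measures only. The variable of \<open>spread\<close> has the integrals of
  an occupation measure.\<close>

lemma ex_attains: "\<exists>\<Phi> v. \<Phi> \<in> feasible_variables M p \<and> attains \<Phi> v"
proof -
  obtain \<Phi> where \<Phi>: "\<Phi> \<in> feasible_variables M p"
    and int: "\<And>f. f \<in> borel_measurable XA \<Longrightarrow> pair_integral p \<Phi> f = occ (\<lambda>_. spread) f"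
    using ex_feasible_spread by blast
  have "attains \<Phi> (\<lambda>h. enn2real (pair_integral p \<Phi> (pos h)) - enn2real (pair_integral p \<Phi> (neg h)))"
  proof (rule attainsI[OF feasible_balanced[OF \<Phi>]])
    fix h assume h: "h \<in> H"
    show "pair_integral p \<Phi> (pos h) < \<infinity>"
      using pos_bounded[OF h] \<Phi> by (blast intro: le_less_trans)
    show "pair_integral p \<Phi> (neg h) < \<infinity>"
      unfolding int[OF neg_m[OF h]] stationary_markov(3)[OF markov_spread neg_m[OF h], symmetric]
      by (rule neg_finite[OF stationary_markov(1)[OF markov_spread] h])
  qed
  with \<Phi> show ?thesis by blast
qed

text \<open>Half a balanced pair plus half a feasible variable is feasible; hence the bound
  doubles.\<close>

lemma balanced_pos_bounded:
  assumes h: "h \<in> H"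
  shows "\<exists>C<\<infinity>. \<forall>\<Phi>. balanced p \<Phi> \<longrightarrow> pair_integral p \<Phi> (pos h) \<le> C"
proof -
  obtain C where C: "C < \<infinity>" "\<And>\<Psi>. \<Psi> \<in> feasible_variables M p \<Longrightarrow> pair_integral p \<Psi> (pos h) \<le> C"
    using pos_bounded[OF h] by blast
  obtain \<kappa>' \<phi>' where F: "(\<kappa>', \<phi>') \<in> feasible_variables M p"
    using ex_attains by (metis surj_pair)
  have half: "ennreal (1 / 2) + ennreal (1 / 2) = 1"
    by (subst ennreal_plus[symmetric]) simp_all
  have half_pos: "0 < ennreal (1 / 2)" by (simp del: ennreal_half)
  have two: "y = 2 * (ennreal (1 / 2) * y)" for y
  proof -
    have "2 * ennreal (1 / 2) = 1" unfolding mult_2 by (rule half)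
    then show ?thesis by (simp add: mult.assoc[symmetric] del: ennreal_half)
  qed
  have "pair_integral p \<Phi> (pos h) \<le> 2 * C" if "balanced p \<Phi>" for \<Phi>
  proof -
    obtain \<kappa> \<phi> where \<Phi>: "\<Phi> = (\<kappa>, \<phi>)" by (cases \<Phi>)
    note b = that[unfolded \<Phi>] feasible_balanced[OF F]
    have "ennreal (1 / 2) * pair_integral p \<Phi> (pos h) \<le>
        ennreal (1 / 2) * pair_integral p (\<kappa>, \<phi>) (pos h) + ennreal (1 / 2) * pair_integral p (\<kappa>', \<phi>') (pos h)"
      unfolding \<Phi> by simp
    also have "\<dots> \<le> C"
      unfolding pair_integral_mix[OF sets_p b half pos_m[OF h], symmetric]
      by (rule C(2)[OF feasible_mix[OF sets_p b half half_pos F]])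
    finally have "2 * (ennreal (1 / 2) * pair_integral p \<Phi> (pos h)) \<le> 2 * C" by (rule mult_left_mono) simp
    then show ?thesis unfolding two[symmetric] .
  qed
  moreover have "2 * C < \<infinity>" using C(1) by (simp add: ennreal_mult_less_top of_nat_less_top[of 2, simplified])
  ultimately show ?thesis by blast
qed

text \<open>The positive part of a policy is finite because its partial sums over stages lie below
  those of balanced pairs, which share a finite bound. One \<open>T\<close> serves all criteria at
  once because \<open>H\<close> is finite.\<close>

lemma policy_values:
  assumes \<pi>: "\<pi> \<in> policies M"
  shows "\<exists>v. (\<forall>h\<in>H. criterion M h \<pi> = ereal (v h)) \<and>
    (\<forall>e>0. \<exists>\<Phi> w. attains \<Phi> w \<and> (\<forall>h\<in>H. v h - e \<le> w h))"
proof (rule policy_markov[OF \<pi>])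
  fix k assume k: "\<And>t. markov (k t)"
    and int: "\<And>f. f \<in> borel_measurable XA \<Longrightarrow> (\<integral>\<^sup>+z. f z \<partial>occupation_measure M \<pi>) = occ k f"
  have neg: "occ k (neg h) < \<infinity>" if "h \<in> H" for h
    using neg_finite[OF \<pi> that] int[OF neg_m[OF that]] by simp
  define stage where "stage h t = (\<integral>\<^sup>+x. \<integral>\<^sup>+a. pos h (x, a) \<partial>k t x \<partial>law k t)" for h t
  have occ_stage: "occ k (pos h) = (\<Sum>t. stage h t)" for h by (simp add: occ_def stage_def)
  have approx: "\<exists>\<Phi>. balanced p \<Phi> \<and> (\<forall>h\<in>H. pair_integral p \<Phi> (neg h) \<le> occ k (neg h)) \<and>
      (\<forall>h\<in>H. (\<Sum>t<T. stage h t) \<le> pair_integral p \<Phi> (pos h))" for T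
    unfolding stage_def
    by (rule approximation[OF k finite_H H_measurable H_usc neg, of T]) blast+
  have pos_fin: "occ k (pos h) < \<infinity>" if h: "h \<in> H" for h
  proof -
    obtain C where C: "C < \<infinity>" "\<And>\<Phi>. balanced p \<Phi> \<Longrightarrow> pair_integral p \<Phi> (pos h) \<le> C"
      using balanced_pos_bounded[OF h] by blast
    have "(\<Sum>t<T. stage h t) \<le> C" for T
      using approx[of T] C(2) h by (meson order_trans)
    then have "occ k (pos h) \<le> C" unfolding occ_stage by (intro suminf_le_const summableI)
    then show ?thesis using C(1) by (rule le_less_trans)
  qed
  define v where "v h = enn2real (occ k (pos h)) - enn2real (occ k (neg h))" for h
  show ?thesis
  proof (intro exI[of _ v] conjI ballI allI impI)
    fix h assume h: "h \<in> H"
    have "criterion M h \<pi> = ediff (occ k (pos h)) (occ k (neg h))"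
      unfolding criterion_def ext_integral_eq int[OF pos_m[OF h]] int[OF neg_m[OF h]] ..
    also have "\<dots> = ediff (ennreal (enn2real (occ k (pos h)))) (ennreal (enn2real (occ k (neg h))))"
      using pos_fin[OF h] neg[OF h] by (simp add: less_top)
    finally show "criterion M h \<pi> = ereal (v h)" by (simp add: ediff_ennreal v_def)
  next
    fix e :: real assume e: "e > 0"
    have "\<forall>\<^sub>F T in sequentially. occ k (pos h) < (\<Sum>t<T. stage h t) + ennreal e" if h: "h \<in> H" for h
    proof -
      have "(\<lambda>T. (\<Sum>t<T. stage h t) + ennreal e) \<longlonglongrightarrow> occ k (pos h) + ennreal e"
        unfolding occ_stage by (intro tendsto_add tendsto_const summable_LIMSEQ summableI)
      moreover have "occ k (pos h) < occ k (pos h) + ennreal e"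
        using pos_fin[OF h] e by (cases "occ k (pos h)") (auto simp: ennreal_plus[symmetric] ennreal_less_iff simp del: ennreal_plus)
      ultimately show ?thesis by (rule order_tendstoD)
    qed
    then have "\<forall>\<^sub>F T in sequentially. \<forall>h\<in>H. occ k (pos h) < (\<Sum>t<T. stage h t) + ennreal e"
      by (simp add: eventually_ball_finite_distrib finite_H)
    from eventually_happens'[OF sequentially_bot this]
    obtain T where T: "\<And>h. h \<in> H \<Longrightarrow> occ k (pos h) < (\<Sum>t<T. stage h t) + ennreal e"
      by blast
    obtain \<Phi> where \<Phi>: "balanced p \<Phi>" "\<And>h. h \<in> H \<Longrightarrow> pair_integral p \<Phi> (neg h) \<le> occ k (neg h)"
      "\<And>h. h \<in> H \<Longrightarrow> (\<Sum>t<T. stage h t) \<le> pair_integral p \<Phi> (pos h)"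
      using approx[of T] by blast
    have fin: "pair_integral p \<Phi> (pos h) < \<infinity>" "pair_integral p \<Phi> (neg h) < \<infinity>" if "h \<in> H" for h
      using balanced_pos_bounded[OF that] \<Phi>(1) le_less_trans[OF \<Phi>(2)[OF that] neg[OF that]]
      by (blast intro: le_less_trans)+
    define w where "w h = enn2real (pair_integral p \<Phi> (pos h)) - enn2real (pair_integral p \<Phi> (neg h))" for h
    have "attains \<Phi> w" unfolding w_def by (rule attainsI[OF \<Phi>(1) fin])
    moreover have "v h - e \<le> w h" if h: "h \<in> H" for h
    proof -
      have "occ k (pos h) \<le> pair_integral p \<Phi> (pos h) + ennreal e"
        using T[OF h] \<Phi>(3)[OF h] by (meson add_right_mono less_imp_le order_trans)
      then have "enn2real (occ k (pos h)) \<le> enn2real (pair_integral p \<Phi> (pos h) + ennreal e)"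
        using fin(1)[OF h] by (intro enn2real_mono) (simp_all add: less_top[symmetric])
      also have "\<dots> = enn2real (pair_integral p \<Phi> (pos h)) + e"
        using fin(1)[OF h] e by (simp add: enn2real_plus less_top[symmetric])
      finally have "enn2real (occ k (pos h)) \<le> enn2real (pair_integral p \<Phi> (pos h)) + e" .
      moreover have "enn2real (pair_integral p \<Phi> (neg h)) \<le> enn2real (occ k (neg h))"
        using \<Phi>(2)[OF h] neg[OF h] by (intro enn2real_mono) simp_all
      ultimately show ?thesis by (simp add: v_def w_def)
    qed
    ultimately show "\<exists>\<Phi> w. attains \<Phi> w \<and> (\<forall>h\<in>H. v h - e \<le> w h)" by blast
  qed
qed

text \<open>Two mixtures. Weight \<open>b\<close> on the approximation of the Slater policy
  \<open>\<pi>'\<close> creates the slack \<open>b * \<sigma>\<close>; half of it pays for the error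
  \<open>e\<close>, half for the weight \<open>a\<close> on the feasible variable
  \<open>\<Phi>0\<close>, which supplies positivity. The reward loses at most
  \<open>\<epsilon> / 4\<close> through \<open>b\<close>, \<open>\<epsilon> / 4\<close> through
  \<open>e\<close> and \<open>\<epsilon> / 2\<close> through \<open>a\<close>.\<close>

lemma constrained_approximation:
  assumes I: "finite I" "\<And>i. i \<in> I \<Longrightarrow> c i \<in> H" and r: "r \<in> H"
    and \<pi>: "\<pi> \<in> policies M" "\<And>i. i \<in> I \<Longrightarrow> ereal (\<theta> i) \<le> criterion M (c i) \<pi>"
    and \<pi>': "\<pi>' \<in> policies M" "\<And>i. i \<in> I \<Longrightarrow> ereal (\<theta> i) < criterion M (c i) \<pi>'"
    and \<epsilon>: "\<epsilon> > 0"
  shows "\<exists>\<Phi>\<in>feasible_variables M p.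
    (\<forall>i\<in>I. ereal (\<theta> i) \<le> ext_integral M (kernel_pair_measure M p \<Phi>) (c i)) \<and>
    criterion M r \<pi> \<le> ext_integral M (kernel_pair_measure M p \<Phi>) r + ereal \<epsilon>"
proof -
  obtain v where v: "\<And>h. h \<in> H \<Longrightarrow> criterion M h \<pi> = ereal (v h)"
    "\<And>e. e > 0 \<Longrightarrow> \<exists>\<Phi> w. attains \<Phi> w \<and> (\<forall>h\<in>H. v h - e \<le> w h)"
    using policy_values[OF \<pi>(1)] by blast
  obtain v' where v': "\<And>h. h \<in> H \<Longrightarrow> criterion M h \<pi>' = ereal (v' h)"
    "\<And>e. e > 0 \<Longrightarrow> \<exists>\<Phi> w. attains \<Phi> w \<and> (\<forall>h\<in>H. v' h - e \<le> w h)"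
    using policy_values[OF \<pi>'(1)] by blast
  obtain \<Phi>0 v0 where \<Phi>0: "\<Phi>0 \<in> feasible_variables M p" "attains \<Phi>0 v0" using ex_attains by blast
  have \<theta>: "\<theta> i \<le> v (c i)" "\<theta> i < v' (c i)" if "i \<in> I" for i
    using \<pi>(2)[OF that] \<pi>'(2)[OF that] v(1)[OF I(2)[OF that]] v'(1)[OF I(2)[OF that]] by simp_all
  \<comment> \<open>The element 1 keeps the minimum meaningful if there are no constraints.\<close>
  define \<sigma> where "\<sigma> = Min (insert 1 ((\<lambda>i. v' (c i) - \<theta> i) ` I))"
  have \<sigma>: "\<sigma> > 0" unfolding \<sigma>_def using I(1) \<theta>(2) by (subst Min_gr_iff) auto
  have \<sigma>_le: "\<theta> i + \<sigma> \<le> v' (c i)" if "i \<in> I" for i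
  proof -
    have "\<sigma> \<le> v' (c i) - \<theta> i" unfolding \<sigma>_def using I(1) that by (intro Min_le) auto
    then show ?thesis by simp
  qed
  \<comment> \<open>The denominator \<open>D + 1\<close> also covers \<open>D = 0\<close>.\<close>
  have small: "\<exists>b>0. b < 1 \<and> b * D \<le> \<delta>" if "0 \<le> D" "0 < \<delta>" for D \<delta> :: real
  proof (intro exI conjI)
    show "0 < min (1 / 2) (\<delta> / (D + 1))" "min (1 / 2) (\<delta> / (D + 1)) < 1" using that by simp_all
    have "min (1 / 2) (\<delta> / (D + 1)) * D \<le> \<delta> / (D + 1) * (D + 1)" using that by (intro mult_mono) auto
    then show "min (1 / 2) (\<delta> / (D + 1)) * D \<le> \<delta>" using that by simp
  qed
  obtain b where b: "0 < b" "b < 1" "b * \<bar>v' r - v r\<bar> \<le> \<epsilon> / 4"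
    using small[of "\<bar>v' r - v r\<bar>" "\<epsilon> / 4"] \<epsilon> by auto
  define e where "e = min (\<epsilon> / 4) (b * \<sigma> / 2)"
  have e: "0 < e" "e \<le> \<epsilon> / 4" "e \<le> b * \<sigma> / 2" using \<epsilon> b \<sigma> by (simp_all add: e_def)
  obtain \<Phi>1 w1 where 1: "attains \<Phi>1 w1" "\<And>h. h \<in> H \<Longrightarrow> v h - e \<le> w1 h" using v(2)[OF e(1)] by blast
  obtain \<Phi>2 w2 where 2: "attains \<Phi>2 w2" "\<And>h. h \<in> H \<Longrightarrow> v' h - e \<le> w2 h" using v'(2)[OF e(1)] by blast
  define u where "u h = (1 - b) * w1 h + b * w2 h" for h
  obtain \<Psi> where \<Psi>: "attains \<Psi> u" using attains_mix[OF 1(1) 2(1) b(1,2)] unfolding u_def by blast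
  have u_ge: "(1 - b) * v h + b * v' h - e \<le> u h" if "h \<in> H" for h
  proof -
    have "(1 - b) * (v h - e) + b * (v' h - e) \<le> u h"
      unfolding u_def using b 1(2)[OF that] 2(2)[OF that] by (intro add_mono mult_left_mono) simp_all
    then show ?thesis by (simp add: algebra_simps)
  qed
  have u_r: "v r - \<epsilon> / 2 \<le> u r"
  proof -
    have "b * (v r - v' r) \<le> b * \<bar>v' r - v r\<bar>" using b(1) by (intro mult_left_mono) auto
    then show ?thesis using u_ge[OF r] b(3) e(2) by (simp add: algebra_simps)
  qed
  have u_c: "\<theta> i + b * \<sigma> / 2 \<le> u (c i)" if "i \<in> I" for i
  proof -
    have "(1 - b) * \<theta> i + b * (\<theta> i + \<sigma>) \<le> (1 - b) * v (c i) + b * v' (c i)"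
      using b \<theta>(1)[OF that] \<sigma>_le[OF that] by (intro add_mono mult_left_mono) simp_all
    then show ?thesis using u_ge[OF I(2)[OF that]] e(3) by (simp add: algebra_simps)
  qed
  \<comment> \<open>Bounds the change of every criterion per unit of weight on
    \<open>\<Phi>0\<close>.\<close>
  define D where "D = (\<Sum>h\<in>H. \<bar>v0 h - u h\<bar>)"
  have D: "0 \<le> D" "\<And>h. h \<in> H \<Longrightarrow> \<bar>v0 h - u h\<bar> \<le> D"
    unfolding D_def by (auto intro: sum_nonneg member_le_sum finite_H)
  define \<delta> where "\<delta> = min (\<epsilon> / 2) (b * \<sigma> / 2)"
  have \<delta>: "0 < \<delta>" "\<delta> \<le> \<epsilon> / 2" "\<delta> \<le> b * \<sigma> / 2" using \<epsilon> b \<sigma> by (simp_all add: \<delta>_def)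
  obtain a where a: "0 < a" "a < 1" "a * D \<le> \<delta>" using small[OF D(1) \<delta>(1)] by auto
  define w where "w h = (1 - a) * u h + a * v0 h" for h
  obtain \<Theta> where \<Theta>: "attains \<Theta> w" "\<Theta> \<in> feasible_variables M p"
    using attains_mix[OF \<Psi> \<Phi>0(2) a(1,2)] \<Phi>0(1) unfolding w_def by blast
  have w_ge: "u h - \<delta> \<le> w h" if "h \<in> H" for h
  proof -
    have "a * (u h - v0 h) \<le> a * D" using a(1) D(2)[OF that] by (intro mult_left_mono) auto
    then show ?thesis using a(3) unfolding w_def by (simp add: algebra_simps)
  qed
  show ?thesis
  proof (intro bexI[OF _ \<Theta>(2)] conjI ballI)
    fix i assume i: "i \<in> I"
    have "\<theta> i \<le> w (c i)" using w_ge[OF I(2)[OF i]] u_c[OF i] \<delta>(3) by linarith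
    then show "ereal (\<theta> i) \<le> ext_integral M (kernel_pair_measure M p \<Theta>) (c i)"
      by (simp add: attains_ext_integral[OF \<Theta>(1) I(2)[OF i]])
  next
    have "v r \<le> w r + \<epsilon>" using w_ge[OF r] u_r \<delta>(2) by linarith
    then show "criterion M r \<pi> \<le> ext_integral M (kernel_pair_measure M p \<Theta>) r + ereal \<epsilon>"
      by (simp add: attains_ext_integral[OF \<Theta>(1) r] v(1)[OF r])
  qed
qed

end

section \<open>Equality of the two values and optimality of induced policies\<close>

theorem theorem5p3:
  fixes M :: "('x::polish_space, 'a::polish_space) cmdm"
    and \<xi> :: "nat \<Rightarrow> 'x \<Rightarrow> 'a"
    and p :: "'x measure"
    and \<eta> :: "('x, 'a) kernel_pair \<Rightarrow> ('x \<times> 'a) measure"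
  assumes model: "control_model M"
    and compact: "\<And>x. x \<in> states M \<Longrightarrow> compact (admissible M x)"
    and continuous: "\<And>x \<Lambda>. x \<in> states M \<Longrightarrow> \<Lambda> \<in> sets (state_space M) \<Longrightarrow>
      continuous_on (admissible M x) (\<lambda>a. measure (transition M (x, a)) \<Lambda>)"
    and usc_reward: "\<And>x. x \<in> states M \<Longrightarrow> usc_on (admissible M x) (\<lambda>a. reward M (x, a))"
    and usc_constraint: "\<And>x i. x \<in> states M \<Longrightarrow> i \<in> {1..num_constraints M} \<Longrightarrow>
      usc_on (admissible M x) (\<lambda>a. constraint M i (x, a))"
    and selectors: "\<And>k. k \<ge> 1 \<Longrightarrow> measurable_selector M (\<xi> k)"
    and dense: "\<And>x. x \<in> states M \<Longrightarrow> admissible M x = closure {\<xi> k x | k. k \<ge> 1}"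
    and p_def: "p = reference_measure M \<xi>"
    and \<eta>_def: "\<eta> = kernel_pair_measure M p"
    and sup_reward: "(SUP \<Phi>\<in>feasible_variables M p. ext_integral M (\<eta> \<Phi>) (\<lambda>z. max 0 (reward M z))) < \<infinity>"
    and sup_constraint: "\<And>i. i \<in> {1..num_constraints M} \<Longrightarrow>
      (SUP \<Phi>\<in>feasible_variables M p. ext_integral M (\<eta> \<Phi>) (\<lambda>z. max 0 (constraint M i z))) < \<infinity>"
    and neg_reward: "\<And>\<mu>. \<mu> \<in> occupation_measures M \<Longrightarrow>
      ext_integral M \<mu> (\<lambda>z. max 0 (- reward M z)) < \<infinity>"
    and neg_constraint: "\<And>\<mu> i. \<mu> \<in> occupation_measures M \<Longrightarrow> i \<in> {1..num_constraints M} \<Longrightarrow>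
      ext_integral M \<mu> (\<lambda>z. max 0 (- constraint M i z)) < \<infinity>"
    and slater: "\<exists>\<mu>\<in>occupation_measures M.
      \<forall>i\<in>{1..num_constraints M}. threshold M i < ext_integral M \<mu> (constraint M i)"
  shows "(SUP \<pi>\<in>constrained_policies M. criterion M (reward M) \<pi>) =
      (SUP \<Phi>\<in>{\<Phi> \<in> feasible_variables M p.
          \<forall>i\<in>{1..num_constraints M}. ext_integral M (\<eta> \<Phi>) (constraint M i) \<ge> threshold M i}.
        ext_integral M (\<eta> \<Phi>) (reward M))
    \<and> (\<forall>\<Phi>\<in>feasible_variables M p.
        (\<forall>i\<in>{1..num_constraints M}. ext_integral M (\<eta> \<Phi>) (constraint M i) \<ge> threshold M i) \<and>
        ext_integral M (\<eta> \<Phi>) (reward M) =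
          (SUP \<Psi>\<in>{\<Psi> \<in> feasible_variables M p.
              \<forall>i\<in>{1..num_constraints M}. ext_integral M (\<eta> \<Psi>) (constraint M i) \<ge> threshold M i}.
            ext_integral M (\<eta> \<Psi>) (reward M)) \<longrightarrow>
        induced_policy \<Phi> \<in> constrained_policies M \<and>
        criterion M (reward M) (induced_policy \<Phi>) =
          (SUP \<pi>\<in>constrained_policies M. criterion M (reward M) \<pi>))"
proof -
  interpret reference_model M \<xi> p
    by unfold_locales (fact model compact continuous selectors dense p_def)+
  define I where "I = {1..num_constraints M}"
  define H where "H = insert (reward M) (constraint M ` I)"
  \<comment> \<open>The supremum is an extended real; \<open>e2ennreal\<close> makes a bound on
    masses of it, sending negative values to 0.\<close>
  have bound: "\<exists>C<\<infinity>. \<forall>\<Psi>\<in>feasible_variables M p. pair_integral p \<Psi> (pos h) \<le> C"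
    if meas: "h \<in> borel_measurable (feasible_space M)"
      and sup: "(SUP \<Phi>\<in>feasible_variables M p. ext_integral M (\<eta> \<Phi>) (\<lambda>z. max 0 (h z))) < \<infinity>" for h
  proof (intro exI conjI ballI)
    define s where "s = (SUP \<Phi>\<in>feasible_variables M p. ext_integral M (\<eta> \<Phi>) (\<lambda>z. max 0 (h z)))"
    have "s \<noteq> \<infinity>" using sup by (auto simp: s_def)
    then have "e2ennreal s \<noteq> \<infinity>" by (cases s) (auto simp: e2ennreal_neg)
    then show "e2ennreal s < \<infinity>" by (simp add: less_top)
    fix \<Psi> assume \<Psi>: "\<Psi> \<in> feasible_variables M p"
    obtain \<kappa> \<phi> where eq: "\<Psi> = (\<kappa>, \<phi>)" by (cases \<Psi>)
    have "(\<integral>\<^sup>+z. pos h z \<partial>\<eta> \<Psi>) = pair_integral p \<Psi> (pos h)"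
      unfolding \<eta>_def eq using feasible_pair(1,2)[OF \<Psi>[unfolded eq]]
      by (intro nn_integral_pair sets_p pos_measurable[OF meas])
    moreover have "ext_integral M (\<eta> \<Psi>) (\<lambda>z. max 0 (h z)) \<le> s"
      unfolding s_def using \<Psi> by (rule SUP_upper)
    ultimately have "enn2ereal (pair_integral p \<Psi> (pos h)) \<le> s" by (simp add: ext_integral_pos)
    then have "e2ennreal (enn2ereal (pair_integral p \<Psi> (pos h))) \<le> e2ennreal s" by (rule e2ennreal_mono)
    then show "pair_integral p \<Psi> (pos h) \<le> e2ennreal s" by simp
  qed
  have fin: "(\<integral>\<^sup>+z. neg h z \<partial>\<mu>) < \<infinity>" if "ext_integral M \<mu> (\<lambda>z. max 0 (- h z)) < \<infinity>" for h \<mu>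
  proof -
    have "enn2ereal (\<integral>\<^sup>+z. neg h z \<partial>\<mu>) < enn2ereal \<infinity>" using that by (simp add: ext_integral_neg)
    then show ?thesis by (simp add: less_ennreal.rep_eq)
  qed
  have r_meas: "reward M \<in> borel_measurable (feasible_space M)"
    and c_meas: "\<And>i. i \<in> I \<Longrightarrow> constraint M i \<in> borel_measurable (feasible_space M)"
    using model by (simp_all add: control_model_def I_def)
  interpret constrained_program M \<xi> p H
  proof unfold_locales
    show "finite H" by (simp add: H_def I_def)
    fix h assume "h \<in> H"
    then consider "h = reward M" | i where "i \<in> I" "h = constraint M i" by (auto simp: H_def)
    note h_cases = this
    show "h \<in> borel_measurable (feasible_space M)"
      by (cases rule: h_cases) (simp_all add: r_meas c_meas)
    show "\<exists>C<\<infinity>. \<forall>\<Psi>\<in>feasible_variables M p. pair_integral p \<Psi> (pos h) \<le> C"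
    proof (cases rule: h_cases)
      case 1 then show ?thesis using bound[OF r_meas sup_reward] by simp
    next
      case (2 i) then show ?thesis using bound[OF c_meas sup_constraint, of i] by (simp add: I_def)
    qed
    show "usc_on (admissible M x) (\<lambda>a. h (x, a))" if "x \<in> states M" for x
      by (cases rule: h_cases) (use usc_reward[OF that] usc_constraint[OF that] in \<open>simp_all add: I_def\<close>)
    show "(\<integral>\<^sup>+z. neg h z \<partial>occupation_measure M \<pi>) < \<infinity>" if "\<pi> \<in> policies M" for \<pi>
    proof -
      have o: "occupation_measure M \<pi> \<in> occupation_measures M" using that by (simp add: occupation_measures_def)
      show ?thesis
        by (cases rule: h_cases) (use fin[OF neg_reward[OF o]] fin[OF neg_constraint[OF o]] in \<open>simp_all add: I_def\<close>)
    qed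
  qed
  have rH: "reward M \<in> H" and cH: "\<And>i. i \<in> I \<Longrightarrow> constraint M i \<in> H" by (auto simp: H_def)
  define R where "R = {\<Phi> \<in> feasible_variables M p.
      \<forall>i\<in>I. ext_integral M (\<eta> \<Phi>) (constraint M i) \<ge> threshold M i}"
  have induced_constrained: "induced_policy \<Phi> \<in> constrained_policies M"
    and induced_better: "ext_integral M (\<eta> \<Phi>) (reward M) \<le> criterion M (reward M) (induced_policy \<Phi>)"
    if "\<Phi> \<in> R" for \<Phi>
  proof -
    have \<Phi>: "\<Phi> \<in> feasible_variables M p" using that by (simp add: R_def)
    note better = induced_improves(2)[OF \<Phi>, folded \<eta>_def]
    show "ext_integral M (\<eta> \<Phi>) (reward M) \<le> criterion M (reward M) (induced_policy \<Phi>)" by (rule better[OF rH])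
    show "induced_policy \<Phi> \<in> constrained_policies M"
      using that induced_policy_in[OF \<Phi>] better[OF cH] unfolding constrained_policies_def R_def I_def
      by (auto intro: order_trans)
  qed
  obtain \<pi>' where \<pi>': "\<pi>' \<in> policies M" "\<And>i. i \<in> I \<Longrightarrow> threshold M i < criterion M (constraint M i) \<pi>'"
    using slater by (auto simp: occupation_measures_def criterion_def I_def)
  have eq: "(SUP \<pi>\<in>constrained_policies M. criterion M (reward M) \<pi>) = (SUP \<Phi>\<in>R. ext_integral M (\<eta> \<Phi>) (reward M))"
  proof (rule antisym)
    show "(SUP \<Phi>\<in>R. ext_integral M (\<eta> \<Phi>) (reward M)) \<le> (SUP \<pi>\<in>constrained_policies M. criterion M (reward M) \<pi>)"
      by (rule SUP_mono) (use induced_constrained induced_better in blast)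
    show "(SUP \<pi>\<in>constrained_policies M. criterion M (reward M) \<pi>) \<le> (SUP \<Phi>\<in>R. ext_integral M (\<eta> \<Phi>) (reward M))"
    proof (rule SUP_least)
      fix \<pi> assume "\<pi> \<in> constrained_policies M"
      then have \<pi>: "\<pi> \<in> policies M" "\<And>i. i \<in> I \<Longrightarrow> threshold M i \<le> criterion M (constraint M i) \<pi>"
        by (auto simp: constrained_policies_def I_def)
      show "criterion M (reward M) \<pi> \<le> (SUP \<Phi>\<in>R. ext_integral M (\<eta> \<Phi>) (reward M))"
      \<comment> \<open>Only up to \<open>\<epsilon>\<close>: the occupation measure of a policy
        need not be that of a feasible variable.\<close>
      proof (rule ereal_le_epsilon2)
        fix \<epsilon> :: real assume \<epsilon>: "0 < \<epsilon>"
        have "finite I" by (simp add: I_def)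
        from constrained_approximation[of I "constraint M" "reward M" \<pi> "threshold M" \<pi>' \<epsilon>,
            OF this cH rH \<pi> \<pi>' \<epsilon>, folded \<eta>_def]
        obtain \<Phi> where \<Phi>: "\<Phi> \<in> R"
          and le: "criterion M (reward M) \<pi> \<le> ext_integral M (\<eta> \<Phi>) (reward M) + ereal \<epsilon>"
          by (auto simp: R_def)
        have "ext_integral M (\<eta> \<Phi>) (reward M) \<le> (SUP \<Phi>\<in>R. ext_integral M (\<eta> \<Phi>) (reward M))"
          using \<Phi> by (rule SUP_upper)
        with le show "criterion M (reward M) \<pi> \<le> (SUP \<Phi>\<in>R. ext_integral M (\<eta> \<Phi>) (reward M)) + ereal \<epsilon>"
          by (meson add_right_mono order_trans)
      qed
    qed
  qed
  \<comment> \<open>The induced policy is squeezed: it earns at least the value of the variable,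
    which is the common supremum, and as a constrained policy at most that.\<close>
  have opt: "criterion M (reward M) (induced_policy \<Phi>) = (SUP \<pi>\<in>constrained_policies M. criterion M (reward M) \<pi>)"
    if "\<Phi> \<in> R" "ext_integral M (\<eta> \<Phi>) (reward M) = (SUP \<Phi>\<in>R. ext_integral M (\<eta> \<Phi>) (reward M))" for \<Phi>
  proof (rule antisym)
    show "criterion M (reward M) (induced_policy \<Phi>) \<le> (SUP \<pi>\<in>constrained_policies M. criterion M (reward M) \<pi>)"
      by (rule SUP_upper[OF induced_constrained[OF that(1)]])
    show "(SUP \<pi>\<in>constrained_policies M. criterion M (reward M) \<pi>) \<le> criterion M (reward M) (induced_policy \<Phi>)"
      using induced_better[OF that(1)] that(2) by (simp add: eq)
  qed
  show ?thesis
    unfolding I_def[symmetric] R_def[symmetric]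
    using eq opt induced_constrained by (auto simp: R_def)
qed

end
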